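(* Let $\mathcal{G}$ be a graph. The $2$-step nilpotent Lie algebra $\mu_{\mathcal{G}}$ attached to $\mathcal{G}$ is an Einstein nilradical if and only if $\mathcal{G}$ is positive.
   Context: Graphs are finite, simple (no loops, no multiple edges), and have at least one edge. Let $\mathcal{G}$ have vertices $v_1,\dots,v_p$ and edges $l_1,\dots,l_q$. The Lie algebra attached to $\mathcal{G}$ is $(\mathbb{R}^n,\mu_{\mathcal{G}})$, $n=p+q$, where $\mu_{\mathcal{G}}$ is the skew-symmetric bilinear map given by $\mu_{\mathcal{G}}(e_i,e_j)=e_{p+k}$ if $l_k=v_iv_j$ with $i<j$, and all other brackets of canonical basis vectors (not obtained by skew-symmetry) zero. Two distinct edges are adjacent if they share a vertex. The line graph $L(\mathcal{G})$ is the graph whose vertices are the edges of $\mathcal{G}$, two being joined iff they are adjacent; $\mathrm{Adj}\,L(\mathcal{G})$ is its adjacency matrix (a symmetric $q\times q$ $0/1$-matrix). The matrix $3I+\mathrm{Adj}\,L(\mathcal{G})$ is positive definite. $\mathcal{G}$ is called positive if all entries of the vector $(3I+\mathrm{Adj}\,L(\mathcal{G}))^{-1}(1,\dots,1)^t$ are positive. A nilpotent Lie algebra $\mathfrak{n}$ is an Einstein nilradical if it admits an inner product $\langle\cdot,\cdot\rangle$ for which there exists a solvable Lie algebra $\mathfrak{s}$ with inner product $\langle\cdot,\cdot\rangle'$ and an orthogonal decomposition $\mathfrak{s}=\mathfrak{a}\oplus\mathfrak{n}$, with $\mathfrak{n}=[\mathfrak{s},\mathfrak{s}]$, $[\mathfrak{a},\mathfrak{a}]=0$,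 the bracket and inner product of $\mathfrak{s}$ restricting to those of $\mathfrak{n}$, such that the simply connected Lie group with Lie algebra $\mathfrak{s}$ and the left invariant metric determined by $\langle\cdot,\cdot\rangle'$ is an Einstein manifold. *)

theory Defs
  imports Complex_Main "Jordan_Normal_Form.VS_Connect"
begin

section \<open>Finite-dimensional real Lie algebras\<close>

text \<open>
  A Lie algebra of dimension \<open>N\<close> is a bracket on \<open>carrier_vec N\<close>, that is, on the space of
  real vectors with \<open>N\<close> coordinates. As \<open>N\<close> is a natural number (not a type), one can quantify
  over Lie algebras of arbitrary finite dimension; every finite-dimensional real Lie algebra is
  isomorphic to one of this form.
\<close>

abbreviation rvec_space :: "nat \<Rightarrow> (real, real vec) module" where
  "rvec_space N \<equiv> module_vec TYPE(real) N"

abbreviation linear_vec :: "nat \<Rightarrow> nat \<Rightarrow> (real vec \<Rightarrow> real vec) \<Rightarrow> bool" where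
  "linear_vec N M f \<equiv> linear_map class_ring (rvec_space N) (rvec_space M) f"

definition bilinear_vec :: "nat \<Rightarrow> (real vec \<Rightarrow> real vec \<Rightarrow> real vec) \<Rightarrow> bool" where
  "bilinear_vec N b \<longleftrightarrow>
     (\<forall>x\<in>carrier_vec N. linear_vec N N (\<lambda>y. b x y)) \<and>
     (\<forall>y\<in>carrier_vec N. linear_vec N N (\<lambda>x. b x y))"

definition lie_algebra :: "nat \<Rightarrow> (real vec \<Rightarrow> real vec \<Rightarrow> real vec) \<Rightarrow> bool" where
  "lie_algebra N br \<longleftrightarrow>
     bilinear_vec N br \<and>
     (\<forall>x\<in>carrier_vec N. br x x = 0\<^sub>v N) \<and>
     (\<forall>x\<in>carrier_vec N. \<forall>y\<in>carrier_vec N. \<forall>z\<in>carrier_vec N.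
        br x (br y z) + br y (br z x) + br z (br x y) = 0\<^sub>v N)"

definition bracket_span ::
  "nat \<Rightarrow> (real vec \<Rightarrow> real vec \<Rightarrow> real vec) \<Rightarrow> real vec set \<Rightarrow> real vec set \<Rightarrow> real vec set" where
  "bracket_span N br A B =
     LinearCombinations.module.span class_ring (rvec_space N) {br x y | x y. x \<in> A \<and> y \<in> B}"

primrec lower_central_series ::
  "nat \<Rightarrow> (real vec \<Rightarrow> real vec \<Rightarrow> real vec) \<Rightarrow> nat \<Rightarrow> real vec set" where
  "lower_central_series N br 0 = carrier_vec N"
| "lower_central_series N br (Suc k) =
     bracket_span N br (carrier_vec N) (lower_central_series N br k)"

primrec derived_series ::
  "nat \<Rightarrow> (real vec \<Rightarrow> real vec \<Rightarrow> real vec) \<Rightarrow> nat \<Rightarrow> real vec set" where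
  "derived_series N br 0 = carrier_vec N"
| "derived_series N br (Suc k) =
     bracket_span N br (derived_series N br k) (derived_series N br k)"

definition nilpotent_lie_algebra :: "nat \<Rightarrow> (real vec \<Rightarrow> real vec \<Rightarrow> real vec) \<Rightarrow> bool" where
  "nilpotent_lie_algebra N br \<longleftrightarrow>
     lie_algebra N br \<and> (\<exists>k. lower_central_series N br k = {0\<^sub>v N})"

definition solvable_lie_algebra :: "nat \<Rightarrow> (real vec \<Rightarrow> real vec \<Rightarrow> real vec) \<Rightarrow> bool" where
  "solvable_lie_algebra N br \<longleftrightarrow>
     lie_algebra N br \<and> (\<exists>k. derived_series N br k = {0\<^sub>v N})"

definition inner_product :: "nat \<Rightarrow> (real vec \<Rightarrow> real vec \<Rightarrow> real) \<Rightarrow> bool" where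
  "inner_product N g \<longleftrightarrow>
     (\<forall>x\<in>carrier_vec N. \<forall>y\<in>carrier_vec N. \<forall>z\<in>carrier_vec N. g (x + y) z = g x z + g y z) \<and>
     (\<forall>c. \<forall>x\<in>carrier_vec N. \<forall>y\<in>carrier_vec N. g (c \<cdot>\<^sub>v x) y = c * g x y) \<and>
     (\<forall>x\<in>carrier_vec N. \<forall>y\<in>carrier_vec N. g x y = g y x) \<and>
     (\<forall>x\<in>carrier_vec N. x \<noteq> 0\<^sub>v N \<longrightarrow> 0 < g x x)"


section \<open>Curvature of left invariant metrics\<close>

text \<open>
  Let \<open>S\<close> be the simply connected Lie group with Lie algebra \<open>(carrier_vec N, br)\<close>, carrying
  the left invariant Riemannian metric determined by the inner product \<open>g\<close>. The elements of
  the Lie algebra are the left invariant vector fields on \<open>S\<close>; they form a global frame, and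
  the functions \<open>g(X, Y)\<close> are constant for left invariant \<open>X\<close>, \<open>Y\<close>. The Levi-Civita connection
  of \<open>S\<close> is left invariant, so it is given by a bilinear map \<open>D\<close> on the Lie algebra,
  \<open>D X Y\<close> being the covariant derivative of \<open>Y\<close> along \<open>X\<close>. On left invariant fields, its two
  defining properties read as below: it is torsion-free, and compatible with the metric
  (\<open>X (g(Y, Z)) = g(D X Y, Z) + g(Y, D X Z)\<close>, the left-hand side being zero).
\<close>

definition levi_civita ::
  "nat \<Rightarrow> (real vec \<Rightarrow> real vec \<Rightarrow> real vec) \<Rightarrow> (real vec \<Rightarrow> real vec \<Rightarrow> real) \<Rightarrow>
   (real vec \<Rightarrow> real vec \<Rightarrow> real vec) \<Rightarrow> bool" where
  "levi_civita N br g D \<longleftrightarrow>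
     bilinear_vec N D \<and>
     (\<forall>X\<in>carrier_vec N. \<forall>Y\<in>carrier_vec N. D X Y - D Y X = br X Y) \<and>
     (\<forall>X\<in>carrier_vec N. \<forall>Y\<in>carrier_vec N. \<forall>Z\<in>carrier_vec N.
        g (D X Y) Z + g Y (D X Z) = 0)"

definition riemann_curvature ::
  "(real vec \<Rightarrow> real vec \<Rightarrow> real vec) \<Rightarrow> (real vec \<Rightarrow> real vec \<Rightarrow> real vec) \<Rightarrow>
   real vec \<Rightarrow> real vec \<Rightarrow> real vec \<Rightarrow> real vec" where
  "riemann_curvature br D X Y Z = D X (D Y Z) - D Y (D X Z) - D (br X Y) Z"

text \<open>The trace of the endomorphism \<open>Z \<mapsto> R(Z, X) Y\<close>.\<close>

definition ricci_curvature ::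
  "nat \<Rightarrow> (real vec \<Rightarrow> real vec \<Rightarrow> real vec) \<Rightarrow> (real vec \<Rightarrow> real vec \<Rightarrow> real vec) \<Rightarrow>
   real vec \<Rightarrow> real vec \<Rightarrow> real" where
  "ricci_curvature N br D X Y = (\<Sum>i<N. riemann_curvature br D (unit_vec N i) X Y $ i)"

text \<open>
  The Einstein equation \<open>Ric = c g\<close> for the left invariant metric. Both sides are left invariant
  tensors, so the equation holds on the whole group iff it holds for left invariant fields.
\<close>

definition left_invariant_einstein ::
  "nat \<Rightarrow> (real vec \<Rightarrow> real vec \<Rightarrow> real vec) \<Rightarrow> (real vec \<Rightarrow> real vec \<Rightarrow> real) \<Rightarrow> bool" where
  "left_invariant_einstein N br g \<longleftrightarrow>
     (\<exists>D. levi_civita N br g D \<and>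
       (\<exists>c. \<forall>X\<in>carrier_vec N. \<forall>Y\<in>carrier_vec N. ricci_curvature N br D X Y = c * g X Y))"


section \<open>Einstein nilradicals\<close>

text \<open>
  The inclusion of the metric nilpotent Lie algebra \<open>(carrier_vec n, br, g)\<close> in the metric
  solvable Lie algebra \<open>(carrier_vec N, br', g')\<close> is given by a linear map \<open>\<iota>\<close> preserving brackets
  and inner products (hence injective).
\<close>

definition einstein_solvable_extension ::
  "nat \<Rightarrow> (real vec \<Rightarrow> real vec \<Rightarrow> real vec) \<Rightarrow> (real vec \<Rightarrow> real vec \<Rightarrow> real) \<Rightarrow>
   nat \<Rightarrow> (real vec \<Rightarrow> real vec \<Rightarrow> real vec) \<Rightarrow> (real vec \<Rightarrow> real vec \<Rightarrow> real) \<Rightarrow>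
   (real vec \<Rightarrow> real vec) \<Rightarrow> real vec set \<Rightarrow> bool" where
  "einstein_solvable_extension n br g N br' g' \<iota> \<aa> \<longleftrightarrow>
     solvable_lie_algebra N br' \<and> inner_product N g' \<and>
     linear_vec n N \<iota> \<and> inj_on \<iota> (carrier_vec n) \<and>
     (\<forall>x\<in>carrier_vec n. \<forall>y\<in>carrier_vec n. br' (\<iota> x) (\<iota> y) = \<iota> (br x y)) \<and>
     (\<forall>x\<in>carrier_vec n. \<forall>y\<in>carrier_vec n. g' (\<iota> x) (\<iota> y) = g x y) \<and>
     VectorSpace.subspace class_ring \<aa> (rvec_space N) \<and>
     (\<forall>z\<in>carrier_vec N. \<exists>x\<in>\<aa>. \<exists>y\<in>\<iota> ` carrier_vec n. z = x + y) \<and>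
     (\<forall>x\<in>\<aa>. \<forall>y\<in>\<iota> ` carrier_vec n. g' x y = 0) \<and>
     bracket_span N br' (carrier_vec N) (carrier_vec N) = \<iota> ` carrier_vec n \<and>
     (\<forall>x\<in>\<aa>. \<forall>y\<in>\<aa>. br' x y = 0\<^sub>v N) \<and>
     left_invariant_einstein N br' g'"

definition einstein_nilradical :: "nat \<Rightarrow> (real vec \<Rightarrow> real vec \<Rightarrow> real vec) \<Rightarrow> bool" where
  "einstein_nilradical n br \<longleftrightarrow>
     nilpotent_lie_algebra n br \<and>
     (\<exists>g. inner_product n g \<and>
       (\<exists>N br' g' \<iota> \<aa>. einstein_solvable_extension n br g N br' g' \<iota> \<aa>))"


section \<open>Graphs\<close>

definition simple_graph :: "'a set \<Rightarrow> 'a set set \<Rightarrow> bool" where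
  "simple_graph V E \<longleftrightarrow> finite V \<and> (\<forall>e\<in>E. e \<subseteq> V \<and> card e = 2)"

text \<open>
  The vertices and edges of a graph are enumerated by lists \<open>vs\<close> and \<open>es\<close> without repetitions.
  Indices start at 0, so the basis vectors are \<open>e\<^sub>0, \<dots>, e\<^sub>n\<^sub>-\<^sub>1\<close> with \<open>n = length vs + length es\<close>.
  The definition below is the skew-symmetric bilinear extension of the brackets of basis vectors;
  these are recovered in the two lemmas following it.
\<close>

definition graph_bracket :: "'a list \<Rightarrow> 'a set list \<Rightarrow> real vec \<Rightarrow> real vec \<Rightarrow> real vec" where
  "graph_bracket vs es x y =
     (let p = length vs; q = length es in
      vec (p + q) (\<lambda>r. if r < p then 0
        else (\<Sum>i<p. \<Sum>j<p. if i < j \<and> es ! (r - p) = {vs ! i, vs ! j}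
                             then x $ i * y $ j - x $ j * y $ i else 0)))"

lemma graph_bracket_edge:
  assumes vs: "distinct vs" and es: "distinct es"
    and ij: "i < j" "j < length vs" and k: "k < length es" "es ! k = {vs ! i, vs ! j}"
  defines "n \<equiv> length vs + length es"
  shows "graph_bracket vs es (unit_vec n i) (unit_vec n j) = unit_vec n (length vs + k)"
    and "graph_bracket vs es (unit_vec n j) (unit_vec n i) = - unit_vec n (length vs + k)"
proof -
  have *: "(\<Sum>a<length vs. \<Sum>b<length vs. if a < b \<and> es ! l = {vs ! a, vs ! b}
             then unit_vec n i $ a * unit_vec n j $ b - unit_vec n i $ b * unit_vec n j $ a else 0)
           = (if l = k then 1 else (0 :: real))" if l: "l < length es" for l
  proof -
    have "(\<Sum>a<length vs. \<Sum>b<length vs. if a < b \<and> es ! l = {vs ! a, vs ! b}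
             then unit_vec n i $ a * unit_vec n j $ b - unit_vec n i $ b * unit_vec n j $ a else 0)
          = (\<Sum>a<length vs. \<Sum>b<length vs.
              if b = j then (if a = i then (if l = k then 1 else (0 :: real)) else 0) else 0)"
    proof (intro sum.cong refl)
      fix a b assume "a \<in> {..<length vs}" "b \<in> {..<length vs}"
      then have u: "unit_vec n i $ a = (if a = i then 1 else (0 :: real))"
        "unit_vec n j $ b = (if b = j then 1 else (0 :: real))"
        "unit_vec n i $ b = (if b = i then 1 else (0 :: real))"
        "unit_vec n j $ a = (if a = j then 1 else (0 :: real))"
        using ij by (simp_all add: n_def)
      have lk: "es ! l = {vs ! i, vs ! j} \<longleftrightarrow> l = k"
        using es k l by (metis nth_eq_iff_index_eq)
      show "(if a < b \<and> es ! l = {vs ! a, vs ! b}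
             then unit_vec n i $ a * unit_vec n j $ b - unit_vec n i $ b * unit_vec n j $ a else 0)
          = (if b = j then (if a = i then (if l = k then 1 else (0 :: real)) else 0) else 0)"
        unfolding u using ij(1) lk by (cases "a = i"; cases "b = j") auto
    qed
    also have "\<dots> = (if l = k then 1 else 0)"
      using ij by (simp add: sum.delta)
    finally show ?thesis .
  qed
  show 1: "graph_bracket vs es (unit_vec n i) (unit_vec n j) = unit_vec n (length vs + k)"
    unfolding graph_bracket_def Let_def n_def[symmetric]
  proof (intro eq_vecI)
    fix r assume "r < dim_vec (unit_vec n (length vs + k) :: real vec)"
    then have r: "r < n" by simp
    show "vec n (\<lambda>r. if r < length vs then 0
        else \<Sum>a<length vs. \<Sum>b<length vs. if a < b \<and> es ! (r - length vs) = {vs ! a, vs ! b}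
             then unit_vec n i $ a * unit_vec n j $ b - unit_vec n i $ b * unit_vec n j $ a else 0) $ r
        = (unit_vec n (length vs + k) :: real vec) $ r"
    proof (cases "r < length vs")
      case True
      then show ?thesis using r k by (simp add: n_def)
    next
      case False
      then have "r - length vs < length es" using r by (simp add: n_def)
      from *[OF this] show ?thesis using False r k by (auto simp: n_def)
    qed
  qed simp
  have "graph_bracket vs es y x = - graph_bracket vs es x y" for x y
    unfolding graph_bracket_def Let_def
    by (intro eq_vecI) (auto simp: sum_negf[symmetric] simp del: sum_negf intro!: sum.cong)
  from this[of "unit_vec n j" "unit_vec n i"]
  show "graph_bracket vs es (unit_vec n j) (unit_vec n i) = - unit_vec n (length vs + k)"
    unfolding 1 .
qed

lemma graph_bracket_no_edge:
  assumes ij: "i < length vs + length es" "j < length vs + length es"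
    and no_edge: "\<not> (i < length vs \<and> j < length vs \<and> i \<noteq> j \<and> {vs ! i, vs ! j} \<in> set es)"
  defines "n \<equiv> length vs + length es"
  shows "graph_bracket vs es (unit_vec n i) (unit_vec n j) = 0\<^sub>v n"
proof -
  have "(if a < b \<and> es ! l = {vs ! a, vs ! b}
         then unit_vec n i $ a * unit_vec n j $ b - unit_vec n i $ b * unit_vec n j $ a
         else 0) = (0 :: real)"
    if "l < length es" "a < length vs" "b < length vs" for a b l
  proof -
    have "es ! l \<noteq> {vs ! i, vs ! j}" if "i < length vs" "j < length vs" "i \<noteq> j"
      using no_edge that nth_mem[OF \<open>l < length es\<close>] by auto
    then have "\<not> (a < b \<and> es ! l = {vs ! a, vs ! b} \<and> (a = i \<and> b = j \<or> a = j \<and> b = i))"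
      using that by (auto simp: insert_commute)
    then show ?thesis
      using that ij by (auto simp: n_def)
  qed
  then show ?thesis
    unfolding graph_bracket_def Let_def n_def[symmetric]
    by (intro eq_vecI) (auto simp: n_def intro!: sum.neutral)
qed

definition adjacency_mat :: "'a list \<Rightarrow> 'a set set \<Rightarrow> real mat" where
  "adjacency_mat vs E =
     mat (length vs) (length vs) (\<lambda>(i, j). if {vs ! i, vs ! j} \<in> E then 1 else 0)"

text \<open>The edge set of the line graph of a graph with edge set \<open>E\<close>; its vertex set is \<open>E\<close>.\<close>

definition line_graph_edges :: "'a set set \<Rightarrow> 'a set set set" where
  "line_graph_edges E = {{e, f} | e f. e \<in> E \<and> f \<in> E \<and> e \<noteq> f \<and> e \<inter> f \<noteq> {}}"

text \<open>\<open>B\<close> is the inverse of \<open>3 I + Adj L(G)\<close>, and \<open>es\<close> enumerates the edges.\<close>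

definition positive_graph :: "'a set list \<Rightarrow> bool" where
  "positive_graph es \<longleftrightarrow>
     (let q = length es;
          A = 3 \<cdot>\<^sub>m 1\<^sub>m q + adjacency_mat es (line_graph_edges (set es))
      in \<exists>B\<in>carrier_mat q q. inverts_mat A B \<and> inverts_mat B A \<and>
           (\<forall>k<q. (B *\<^sub>v vec q (\<lambda>_. 1)) $ k > 0))"

end

theory Submission
  imports Defs
begin

text \<open>
  Let \<open>v\<^sub>i\<close> and \<open>z\<^sub>k\<close> be the basis vectors of the Lie algebra belonging to the vertices and to the
  edges. The matrix \<open>3 I + Adj L(G)\<close> is \<open>I + B\<^sup>t B\<close>, where \<open>B\<close> is the vertex-edge incidence matrix.
  So it is invertible, and its system \<open>(3 I + Adj L(G)) y = 1\<close> reads \<open>y\<^sub>k + Y(i) + Y(j) = 1\<close> for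
  every edge \<open>k\<close> with ends \<open>i\<close> and \<open>j\<close>, where \<open>Y(i)\<close> is the sum of \<open>y\<close> over the edges at the
  vertex \<open>i\<close>. The theorem says that this solution is positive exactly for Einstein nilradicals.

  Suppose that \<open>y\<close> is positive. Give the \<open>v\<^sub>i\<close> length 1 and \<open>z\<^sub>k\<close> length \<open>sqrt y\<^sub>k\<close>, all orthogonal.
  Then the Ricci operator is diagonal, with entries \<open>- Y(i) / 2\<close> at \<open>v\<^sub>i\<close> and \<open>y\<^sub>k / 2\<close> at \<open>z\<^sub>k\<close>.
  The system for \<open>y\<close> says precisely that adding \<open>I / 2\<close> makes it a derivation, and this derivation
  is positive. Adjoining one unit vector that acts by a suitable multiple of it gives an Einstein
  solvable Lie algebra with constant \<open>- 1 / 2\<close>.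

  Conversely, let the Lie algebra \<open>n\<close> of the graph be the nilradical of an Einstein solvable Lie
  algebra \<open>a + n\<close>. Along \<open>n\<close> the Einstein equation is
  \<open>Ric\<^sub>n + 1/2 \<Sum> [A\<^sub>i, A\<^sub>i\<^sup>t] - sym (ad H) = \<kappa> I\<close>, where the \<open>A\<^sub>i\<close> are the derivations of \<open>n\<close> given by an
  orthonormal basis of \<open>a\<close>. Its inner product with \<open>\<Sum> [A\<^sub>i, A\<^sub>i\<^sup>t]\<close> is a vanishing sum of squares.
  So the commutators cancel, each \<open>A\<^sub>i\<^sup>t\<close> is a derivation too, and \<open>Ric\<^sub>n = \<kappa> I + S\<close> with a symmetric
  derivation \<open>S\<close> (\<open>nilsoliton_structure_constants\<close>). As \<open>Ric\<^sub>n\<close> is orthogonal to all derivations,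
  \<open>tr (S \<psi>) = - \<kappa> tr \<psi>\<close> for every derivation \<open>\<psi>\<close> (\<open>einstein_extension_nilsoliton\<close>).

  Nothing forces the basis of the graph to be orthogonal or \<open>S\<close> to be diagonal in it, but this trace
  identity suffices. Apply it to the derivations that move \<open>v\<^sub>a\<close> to \<open>v\<^sub>i\<close> and kill the other vertices.
  For \<open>a = i\<close> it shows that the diagonal entries \<open>y\<^sub>k\<close> of \<open>\<kappa> I + S\<close> at the edges satisfy
  \<open>y\<^sub>k + Y(i) + Y(j) = - \<kappa>\<close> (\<open>weight_equation\<close>). For \<open>a \<noteq> i\<close> it shows that \<open>S\<close> is triangular if the
  vertices are ordered by degree (\<open>derivation_offdiag_degree\<close>). On the span of the \<open>z\<^sub>k\<close> the operator
  \<open>\<kappa> I + S = Ric\<^sub>n\<close> is positive definite, and the diagonal entries of a triangular positive definite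
  operator are positive (\<open>weight_positive\<close>). Hence \<open>- \<kappa> > 0\<close>, and \<open>y / - \<kappa>\<close> is the positive solution.
\<close>

section \<open>Linear algebra in coordinates\<close>

lemma sum_lessThan_add:
  "(\<Sum>r<m + k. h r) = (\<Sum>r<m. h r) + (\<Sum>r<k. h (m + r))" for h :: "nat \<Rightarrow> real"
  by (induction k) auto

abbreviation vec_subspace :: "nat \<Rightarrow> real vec set \<Rightarrow> bool" where
  "vec_subspace n W \<equiv> VectorSpace.subspace class_ring W (rvec_space n)"

lemma linear_vec_iff:
  "linear_vec n m f \<longleftrightarrow>
     (\<forall>x\<in>carrier_vec n. f x \<in> carrier_vec m) \<and>
     (\<forall>x\<in>carrier_vec n. \<forall>y\<in>carrier_vec n. f (x + y) = f x + f y) \<and>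
     (\<forall>c. \<forall>x\<in>carrier_vec n. f (c \<cdot>\<^sub>v x) = c \<cdot>\<^sub>v f x)"
  unfolding linear_map_def mod_hom_def mod_hom_axioms_def LinearCombinations.module_hom_def
  using vec_vs[of n, where 'a=real] vec_vs[of m, where 'a=real]
    vec_module[of n, where 'a=real] vec_module[of m, where 'a=real]
  by (auto simp: module_vec_simps class_ring_simps)

lemma linear_vecD:
  assumes "linear_vec n m f"
  shows "x \<in> carrier_vec n \<Longrightarrow> f x \<in> carrier_vec m"
    and "x \<in> carrier_vec n \<Longrightarrow> y \<in> carrier_vec n \<Longrightarrow> f (x + y) = f x + f y"
    and "x \<in> carrier_vec n \<Longrightarrow> f (c \<cdot>\<^sub>v x) = c \<cdot>\<^sub>v f x"
  using assms unfolding linear_vec_iff by auto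

lemma bilinear_vecD:
  assumes "bilinear_vec n b"
  shows "x \<in> carrier_vec n \<Longrightarrow> y \<in> carrier_vec n \<Longrightarrow> b x y \<in> carrier_vec n"
    and "x \<in> carrier_vec n \<Longrightarrow> y \<in> carrier_vec n \<Longrightarrow> z \<in> carrier_vec n \<Longrightarrow> b (x + y) z = b x z + b y z"
    and "x \<in> carrier_vec n \<Longrightarrow> y \<in> carrier_vec n \<Longrightarrow> z \<in> carrier_vec n \<Longrightarrow> b z (x + y) = b z x + b z y"
    and "x \<in> carrier_vec n \<Longrightarrow> y \<in> carrier_vec n \<Longrightarrow> b (c \<cdot>\<^sub>v x) y = c \<cdot>\<^sub>v b x y"
    and "x \<in> carrier_vec n \<Longrightarrow> y \<in> carrier_vec n \<Longrightarrow> b y (c \<cdot>\<^sub>v x) = c \<cdot>\<^sub>v b y x"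
  using assms unfolding bilinear_vec_def linear_vec_iff by auto

lemma subspace_iff:
  "vec_subspace n W \<longleftrightarrow>
     W \<subseteq> carrier_vec n \<and> 0\<^sub>v n \<in> W \<and> (\<forall>x\<in>W. \<forall>y\<in>W. x + y \<in> W) \<and> (\<forall>c. \<forall>x\<in>W. c \<cdot>\<^sub>v x \<in> W)"
  unfolding subspace_def submodule_def
  using vec_vs[of n, where 'a=real] vec_module[of n, where 'a=real]
  by (auto simp: module_vec_simps class_ring_simps)

lemma span_subset_subspace:
  assumes W: "vec_subspace n W" and "G \<subseteq> W"
  shows "LinearCombinations.module.span class_ring (rvec_space n) G \<subseteq> W"
proof -
  interpret vectorspace class_ring "rvec_space n" by (rule vec_vs)
  have "submodule class_ring W (rvec_space n)" using W by (simp add: subspace_def)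
  then show ?thesis using assms(2) by (intro span_is_subset)
qed

lemma subset_span:
  assumes "G \<subseteq> carrier_vec n"
  shows "G \<subseteq> LinearCombinations.module.span class_ring (rvec_space n) G"
proof -
  interpret vectorspace class_ring "rvec_space n" by (rule vec_vs)
  show ?thesis using assms by (intro in_own_span) (simp add: module_vec_simps)
qed

lemma bracket_span_subset:
  assumes "vec_subspace n W"
    and "\<And>x y. x \<in> A \<Longrightarrow> y \<in> B \<Longrightarrow> br x y \<in> W"
  shows "bracket_span n br A B \<subseteq> W"
  unfolding bracket_span_def using assms by (intro span_subset_subspace) auto

lemma bracket_in_bracket_span:
  assumes "bilinear_vec n br" "A \<subseteq> carrier_vec n" "B \<subseteq> carrier_vec n" "x \<in> A" "y \<in> B"
  shows "br x y \<in> bracket_span n br A B"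
proof -
  have "{br x y |x y. x \<in> A \<and> y \<in> B} \<subseteq> carrier_vec n"
    using assms bilinear_vecD(1)[OF assms(1)] by blast
  then show ?thesis
    unfolding bracket_span_def using subset_span assms by blast
qed

lemma bracket_span_subspace:
  assumes "bilinear_vec n br" "A \<subseteq> carrier_vec n" "B \<subseteq> carrier_vec n"
  shows "vec_subspace n (bracket_span n br A B)"
proof -
  interpret vectorspace class_ring "rvec_space n" by (rule vec_vs)
  have "{br x y |x y. x \<in> A \<and> y \<in> B} \<subseteq> carrier (rvec_space n)"
    using assms bilinear_vecD(1)[OF assms(1)] by (auto simp: module_vec_simps)
  then show ?thesis
    unfolding bracket_span_def by (rule span_is_subspace)
qed

definition linear_form :: "nat \<Rightarrow> (real vec \<Rightarrow> real) \<Rightarrow> bool" where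
  "linear_form n \<phi> \<longleftrightarrow>
     (\<forall>x\<in>carrier_vec n. \<forall>y\<in>carrier_vec n. \<phi> (x + y) = \<phi> x + \<phi> y) \<and>
     (\<forall>c. \<forall>x\<in>carrier_vec n. \<phi> (c \<cdot>\<^sub>v x) = c * \<phi> x)"

lemma linear_formI:
  assumes "\<And>x y. x \<in> carrier_vec n \<Longrightarrow> y \<in> carrier_vec n \<Longrightarrow> \<phi> (x + y) = \<phi> x + \<phi> y"
    and "\<And>c x. x \<in> carrier_vec n \<Longrightarrow> \<phi> (c \<cdot>\<^sub>v x) = c * \<phi> x"
  shows "linear_form n \<phi>"
  using assms unfolding linear_form_def by auto

lemma linear_form_zero: "linear_form n \<phi> \<Longrightarrow> \<phi> (0\<^sub>v n) = 0"
proof -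
  assume "linear_form n \<phi>"
  then have "\<phi> (0 \<cdot>\<^sub>v 0\<^sub>v n) = 0 * \<phi> (0\<^sub>v n)" using zero_carrier_vec unfolding linear_form_def by blast
  moreover have "(0::real) \<cdot>\<^sub>v 0\<^sub>v n = 0\<^sub>v n" by (intro eq_vecI) auto
  ultimately show ?thesis by simp
qed

lemma linear_form_add_vec:
  "linear_form n \<phi> \<Longrightarrow> x \<in> carrier_vec n \<Longrightarrow> y \<in> carrier_vec n \<Longrightarrow> \<phi> (x + y) = \<phi> x + \<phi> y"
  unfolding linear_form_def by auto

lemma linear_form_diff: "linear_form n \<phi> \<Longrightarrow> linear_form n \<psi> \<Longrightarrow> linear_form n (\<lambda>x. \<phi> x - \<psi> x)"
  unfolding linear_form_def by (auto simp: algebra_simps)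

lemma linear_form_scale: "linear_form n \<phi> \<Longrightarrow> linear_form n (\<lambda>x. c * \<phi> x)"
  unfolding linear_form_def by (auto simp: algebra_simps)

lemma linear_form_sum:
  assumes "\<And>i. i < m \<Longrightarrow> linear_form n (\<phi> i)"
  shows "linear_form n (\<lambda>x. \<Sum>i<m. \<phi> i x)"
  using assms unfolding linear_form_def by (simp add: sum.distrib sum_distrib_left)

lemma linear_form_coords:
  assumes \<phi>: "linear_form n \<phi>" and x: "x \<in> carrier_vec n"
  shows "\<phi> x = (\<Sum>i<n. x $ i * \<phi> (unit_vec n i))"
proof -
  have "\<phi> (vec n (\<lambda>i. if i < m then x $ i else 0)) = (\<Sum>i<m. x $ i * \<phi> (unit_vec n i))"
    if "m \<le> n" for m
    using that
  proof (induction m)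
    case 0
    have "vec n (\<lambda>i. if i < 0 then x $ i else 0) = 0\<^sub>v n" by auto
    then show ?case using linear_form_zero[OF \<phi>] by simp
  next
    case (Suc m)
    have "vec n (\<lambda>i. if i < Suc m then x $ i else 0)
        = vec n (\<lambda>i. if i < m then x $ i else 0) + x $ m \<cdot>\<^sub>v unit_vec n m"
      using Suc.prems by (intro eq_vecI) (auto simp: less_Suc_eq unit_vec_def)
    then show ?case using Suc \<phi> unfolding linear_form_def by simp
  qed
  from this[of n] have "\<phi> (vec n (\<lambda>i. if i < n then x $ i else 0)) = (\<Sum>i<n. x $ i * \<phi> (unit_vec n i))"
    by simp
  moreover have "vec n (\<lambda>i. if i < n then x $ i else 0) = x" using x by (intro eq_vecI) auto
  ultimately show ?thesis by simp
qed

lemma inner_productD: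
  assumes "inner_product n g"
  shows "x \<in> carrier_vec n \<Longrightarrow> y \<in> carrier_vec n \<Longrightarrow> z \<in> carrier_vec n \<Longrightarrow> g (x + y) z = g x z + g y z"
    and "x \<in> carrier_vec n \<Longrightarrow> y \<in> carrier_vec n \<Longrightarrow> g (c \<cdot>\<^sub>v x) y = c * g x y"
    and "x \<in> carrier_vec n \<Longrightarrow> y \<in> carrier_vec n \<Longrightarrow> g x y = g y x"
    and "x \<in> carrier_vec n \<Longrightarrow> x \<noteq> 0\<^sub>v n \<Longrightarrow> 0 < g x x"
    and "x \<in> carrier_vec n \<Longrightarrow> y \<in> carrier_vec n \<Longrightarrow> z \<in> carrier_vec n \<Longrightarrow> g z (x + y) = g z x + g z y"
    and "x \<in> carrier_vec n \<Longrightarrow> y \<in> carrier_vec n \<Longrightarrow> g y (c \<cdot>\<^sub>v x) = c * g y x"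
  using assms unfolding inner_product_def by auto

lemma linear_form_inner:
  assumes "inner_product n g" "linear_vec m n f" "z \<in> carrier_vec n"
  shows "linear_form m (\<lambda>x. g (f x) z)" "linear_form m (\<lambda>x. g z (f x))"
  by (intro linear_formI; simp add: linear_vecD[OF assms(2)] inner_productD[OF assms(1)] assms(3))+

lemma linear_form_index:
  assumes "linear_vec m n f" "i < n"
  shows "linear_form m (\<lambda>x. f x $ i)"
proof (intro linear_formI)
  fix x y :: "real vec" assume "x \<in> carrier_vec m" "y \<in> carrier_vec m"
  then show "f (x + y) $ i = f x $ i + f y $ i"
    using assms(2) linear_vecD(1)[OF assms(1), of y] linear_vecD(2)[OF assms(1), of x y]
    by (simp del: add_carrier_vec)
next
  fix c and x :: "real vec" assume "x \<in> carrier_vec m"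
  then show "f (c \<cdot>\<^sub>v x) $ i = c * f x $ i"
    using assms(2) linear_vecD(1)[OF assms(1), of x] linear_vecD(3)[OF assms(1), of x c] by simp
qed

lemma linear_vec_id: "linear_vec n n (\<lambda>x. x)"
  unfolding linear_vec_iff by auto

lemma linear_form_inner_vec:
  assumes "inner_product n g" "z \<in> carrier_vec n"
  shows "linear_form n (\<lambda>x. g x z)" "linear_form n (\<lambda>x. g z x)"
  using linear_form_inner[OF assms(1) linear_vec_id assms(2)] by auto

lemma linear_vec_comp:
  "linear_vec n m f \<Longrightarrow> linear_vec m k h \<Longrightarrow> linear_vec n k (\<lambda>x. h (f x))"
  unfolding linear_vec_iff by auto

lemma linear_vec_minus:
  assumes "linear_vec n m f" "linear_vec n m h"
  shows "linear_vec n m (\<lambda>x. f x - h x)"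
  unfolding linear_vec_iff
proof (intro conjI ballI allI)
  note f = linear_vecD[OF assms(1)] and h = linear_vecD[OF assms(2)]
  fix x :: "real vec" assume x: "x \<in> carrier_vec n"
  have c: "f x \<in> carrier_vec m" "h x \<in> carrier_vec m" using f h x by auto
  then show "f x - h x \<in> carrier_vec m" by auto
  show "f (k \<cdot>\<^sub>v x) - h (k \<cdot>\<^sub>v x) = k \<cdot>\<^sub>v (f x - h x)" for k
    using c x by (intro eq_vecI) (auto simp: f(3) h(3) algebra_simps)
  fix y :: "real vec" assume y: "y \<in> carrier_vec n"
  have c': "f y \<in> carrier_vec m" "h y \<in> carrier_vec m" using f h y by auto
  show "f (x + y) - h (x + y) = f x - h x + (f y - h y)"
    using c c' x y by (intro eq_vecI) (auto simp: f(2) h(2))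
qed

lemma linear_vec_bracket:
  assumes "bilinear_vec n b" "x \<in> carrier_vec n"
  shows "linear_vec n n (\<lambda>y. b x y)" "linear_vec n n (\<lambda>y. b y x)"
  using assms unfolding bilinear_vec_def by auto

lemma inner_zero:
  assumes "inner_product n g" "x \<in> carrier_vec n"
  shows "g (0\<^sub>v n) x = 0" "g x (0\<^sub>v n) = 0"
  using linear_form_zero[OF linear_form_inner(1)[OF assms(1) linear_vec_id assms(2)]]
    linear_form_zero[OF linear_form_inner(2)[OF assms(1) linear_vec_id assms(2)]] by auto

lemma inner_minus:
  assumes g: "inner_product n g" and c: "x \<in> carrier_vec n" "y \<in> carrier_vec n" "z \<in> carrier_vec n"
  shows "g (x - y) z = g x z - g y z" "g z (x - y) = g z x - g z y"
proof -
  have "x - y = x + (-1) \<cdot>\<^sub>v y" using c by (intro eq_vecI) auto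
  then show "g (x - y) z = g x z - g y z" "g z (x - y) = g z x - g z y"
    using c by (simp_all add: inner_productD[OF g])
qed

subsection \<open>Orthonormal frames\<close>

definition orthonormal_system :: "nat \<Rightarrow> (real vec \<Rightarrow> real vec \<Rightarrow> real) \<Rightarrow> nat \<Rightarrow> (nat \<Rightarrow> real vec) \<Rightarrow> bool" where
  "orthonormal_system n g m F \<longleftrightarrow>
     (\<forall>a<m. F a \<in> carrier_vec n) \<and> (\<forall>a<m. \<forall>b<m. g (F a) (F b) = (if a = b then 1 else 0))"

text \<open>
  The equation \<open>x = \<Sum>\<^sub>a g x (F a) F a\<close>, tested against all linear forms. In this form it can be used
  inside inner products and brackets without finite sums of vectors.
\<close>

definition expands :: "nat \<Rightarrow> (real vec \<Rightarrow> real vec \<Rightarrow> real) \<Rightarrow> nat \<Rightarrow> (nat \<Rightarrow> real vec) \<Rightarrow> real vec \<Rightarrow> bool" where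
  "expands n g m F x \<longleftrightarrow> (\<forall>\<phi>. linear_form n \<phi> \<longrightarrow> \<phi> x = (\<Sum>a<m. g x (F a) * \<phi> (F a)))"

definition orthonormal_frame :: "nat \<Rightarrow> (real vec \<Rightarrow> real vec \<Rightarrow> real) \<Rightarrow> (nat \<Rightarrow> real vec) \<Rightarrow> bool" where
  "orthonormal_frame n g F \<longleftrightarrow>
     orthonormal_system n g n F \<and> (\<forall>x\<in>carrier_vec n. expands n g n F x)"

lemma vec_eq_by_linear_forms:
  assumes "x \<in> carrier_vec n" "y \<in> carrier_vec n" "\<And>\<phi>. linear_form n \<phi> \<Longrightarrow> \<phi> x = \<phi> y"
  shows "x = y"
  using assms linear_form_index[OF linear_vec_id, of _ n] by (intro eq_vecI) auto

definition vec_comb :: "nat \<Rightarrow> nat \<Rightarrow> (nat \<Rightarrow> real) \<Rightarrow> (nat \<Rightarrow> real vec) \<Rightarrow> real vec" where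
  "vec_comb n m t F = vec n (\<lambda>i. \<Sum>a<m. t a * F a $ i)"

lemma vec_comb_carrier [simp]: "vec_comb n m t F \<in> carrier_vec n"
  unfolding vec_comb_def by simp

lemma linear_form_vec_comb:
  assumes \<phi>: "linear_form n \<phi>" and F: "\<And>a. a < m \<Longrightarrow> F a \<in> carrier_vec n"
  shows "\<phi> (vec_comb n m t F) = (\<Sum>a<m. t a * \<phi> (F a))"
proof -
  have "\<phi> (vec_comb n m t F) = (\<Sum>i<n. \<Sum>a<m. t a * (F a $ i * \<phi> (unit_vec n i)))"
    unfolding linear_form_coords[OF \<phi> vec_comb_carrier]
    by (simp add: vec_comb_def sum_distrib_right mult.assoc)
  also have "\<dots> = (\<Sum>a<m. t a * (\<Sum>i<n. F a $ i * \<phi> (unit_vec n i)))"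
    by (subst sum.swap) (simp add: sum_distrib_left)
  also have "\<dots> = (\<Sum>a<m. t a * \<phi> (F a))"
    using linear_form_coords[OF \<phi> F] by simp
  finally show ?thesis .
qed

lemma vec_comb_in_subspace:
  assumes W: "vec_subspace n W"
    and F: "\<And>a. a < m \<Longrightarrow> F a \<in> W"
  shows "vec_comb n m t F \<in> W"
  using F
proof (induction m)
  case 0
  have "vec_comb n 0 t F = 0\<^sub>v n" unfolding vec_comb_def by auto
  then show ?case using W unfolding subspace_iff by simp
next
  case (Suc m)
  have Fm: "F m \<in> W" "F m \<in> carrier_vec n" using Suc.prems W unfolding subspace_iff by auto
  have "vec_comb n (Suc m) t F = vec_comb n m t F + t m \<cdot>\<^sub>v F m"
    using Fm unfolding vec_comb_def by (intro eq_vecI) auto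
  then show ?case using Suc Fm W unfolding subspace_iff by auto
qed

lemma expands_linear:
  assumes g: "inner_product n g" and F: "orthonormal_system n g m F"
    and "x \<in> carrier_vec n" "y \<in> carrier_vec n" "expands n g m F x" "expands n g m F y"
  shows "expands n g m F (x + c \<cdot>\<^sub>v y)"
  unfolding expands_def
proof (intro allI impI)
  fix \<phi> assume \<phi>: "linear_form n \<phi>"
  have "(\<Sum>a<m. g (x + c \<cdot>\<^sub>v y) (F a) * \<phi> (F a)) = (\<Sum>a<m. g x (F a) * \<phi> (F a) + c * (g y (F a) * \<phi> (F a)))"
    using F assms unfolding orthonormal_system_def
    by (intro sum.cong) (auto simp: inner_productD[OF g] algebra_simps)
  also have "\<dots> = \<phi> x + c * \<phi> y"
    using assms \<phi> unfolding expands_def by (simp add: sum.distrib flip: sum_distrib_left)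
  finally show "\<phi> (x + c \<cdot>\<^sub>v y) = (\<Sum>a<m. g (x + c \<cdot>\<^sub>v y) (F a) * \<phi> (F a))"
    using \<phi> assms unfolding linear_form_def by simp
qed

lemma projection_orthogonal:
  assumes g: "inner_product n g" and F: "orthonormal_system n g m F" and x: "x \<in> carrier_vec n" and a: "a < m"
  shows "g (F a) (x - vec_comb n m (\<lambda>a. g x (F a)) F) = 0"
proof -
  have Fc: "F a \<in> carrier_vec n" if "a < m" for a using F that unfolding orthonormal_system_def by auto
  have "g (F a) (vec_comb n m (\<lambda>a. g x (F a)) F) = (\<Sum>b<m. g x (F b) * g (F a) (F b))"
    by (rule linear_form_vec_comb[OF linear_form_inner(2)[OF g linear_vec_id Fc[OF a]] Fc])
  also have "\<dots> = (\<Sum>b<m. if b = a then g x (F b) else 0)"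
    using F a unfolding orthonormal_system_def by (intro sum.cong) auto
  also have "\<dots> = g (F a) x" using a inner_productD(3)[OF g x Fc[OF a]] by simp
  finally show ?thesis using inner_minus(2)[OF g x vec_comb_carrier Fc[OF a]] by simp
qed

text \<open>
  Keeping the system inside a given subspace serves two purposes: it yields frames adapted to an
  orthogonal decomposition, and orthogonal projections onto subspaces.
\<close>

lemma gram_schmidt_system:
  assumes g: "inner_product n g"
    and W: "vec_subspace n W" and xs: "set xs \<subseteq> W"
  shows "\<exists>m F. orthonormal_system n g m F \<and> (\<forall>a<m. F a \<in> W) \<and> (\<forall>x\<in>set xs. expands n g m F x)"
  using xs
proof (induction xs)
  case Nil
  then show ?case by (intro exI[of _ 0]) (simp add: orthonormal_system_def)
next
  case (Cons x xs)
  then obtain m F where F: "orthonormal_system n g m F" "\<And>a. a < m \<Longrightarrow> F a \<in> W"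
    and xs: "\<And>u. u \<in> set xs \<Longrightarrow> expands n g m F u" by auto
  have Wc: "W \<subseteq> carrier_vec n" "\<And>x y. x \<in> W \<Longrightarrow> y \<in> W \<Longrightarrow> x + y \<in> W" "\<And>c x. x \<in> W \<Longrightarrow> c \<cdot>\<^sub>v x \<in> W"
    using W unfolding subspace_iff by auto
  have x: "x \<in> carrier_vec n" "x \<in> W" using Cons.prems Wc by auto
  define z where "z = vec_comb n m (\<lambda>a. g x (F a)) F"
  define r where "r = x - z"
  have z: "z \<in> W" "z \<in> carrier_vec n" unfolding z_def using vec_comb_in_subspace[OF W F(2)] by auto
  have "r = x + (-1) \<cdot>\<^sub>v z" unfolding r_def using x z by (intro eq_vecI) auto
  then have r: "r \<in> W" "r \<in> carrier_vec n" using Wc x z by auto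
  have "x = r + z" unfolding r_def using x z by (intro eq_vecI) auto
  then have \<phi>x: "\<phi> x = \<phi> r + (\<Sum>a<m. g x (F a) * \<phi> (F a))" if "linear_form n \<phi>" for \<phi>
    using linear_form_add_vec[OF that r(2) z(2)] linear_form_vec_comb[OF that, of m F] F(2) Wc(1)
    unfolding z_def by auto
  show ?case
  proof (cases "r = 0\<^sub>v n")
    case True
    have "\<phi> x = (\<Sum>a<m. g x (F a) * \<phi> (F a))" if "linear_form n \<phi>" for \<phi>
      using \<phi>x[OF that] linear_form_zero[OF that] True by simp
    then have "expands n g m F x" unfolding expands_def by blast
    then show ?thesis using F xs by (intro exI[of _ m] exI[of _ F]) auto
  next
    case False
    define c where "c = sqrt (g r r)"
    have c: "c > 0" "c * c = g r r" using inner_productD(4)[OF g r(2) False] unfolding c_def by auto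
    define y where "y = (1/c) \<cdot>\<^sub>v r"
    have y: "y \<in> W" "y \<in> carrier_vec n" unfolding y_def using r Wc by auto
    have ry: "r = c \<cdot>\<^sub>v y" unfolding y_def using c by (intro eq_vecI) auto
    have yy: "g y y = 1" using r c(1) by (simp add: y_def inner_productD[OF g] c(2)[symmetric])
    have Fy: "g (F a) y = 0" if a: "a < m" for a
    proof -
      have "F a \<in> carrier_vec n" using F(2)[OF a] Wc by auto
      then show ?thesis using projection_orthogonal[OF g F(1) x(1) a] r
        unfolding y_def r_def z_def by (simp add: inner_productD(6)[OF g])
    qed
    define F' where "F' = F(m := y)"
    have sys: "orthonormal_system n g (Suc m) F'"
      using F(1) y yy Fy inner_productD(3)[OF g] unfolding orthonormal_system_def F'_def
      by (auto simp: less_Suc_eq)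
    have gy: "linear_form n (\<lambda>x. g x y)" by (rule linear_form_inner_vec(1)[OF g y(2)])
    have "expands n g (Suc m) F' u" if u: "u \<in> set xs" for u
    proof -
      have "g u y = (\<Sum>a<m. g u (F a) * g (F a) y)" using xs[OF u] gy unfolding expands_def by blast
      then show ?thesis using xs[OF u] Fy unfolding expands_def F'_def by simp
    qed
    moreover have "expands n g (Suc m) F' x"
    proof -
      have "g x y = c" unfolding \<phi>x[OF gy] using Fy yy y by (simp add: ry inner_productD(2)[OF g])
      then have "\<phi> x = (\<Sum>a<Suc m. g x (F' a) * \<phi> (F' a))" if "linear_form n \<phi>" for \<phi>
        using \<phi>x[OF that] that y(2) unfolding F'_def ry linear_form_def by simp
      then show ?thesis unfolding expands_def by blast
    qed
    moreover have "\<forall>a<Suc m. F' a \<in> W" using F(2) y unfolding F'_def by (auto simp: less_Suc_eq)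
    ultimately show ?thesis using sys by (intro exI[of _ "Suc m"] exI[of _ F']) auto
  qed
qed

text \<open>
  The trace is taken in the standard basis, which need not be orthonormal. Expanding each standard
  basis vector in the system and interchanging the two sums gives the trace in the system.
\<close>

lemma trace_expand:
  assumes g: "inner_product n g" and F: "orthonormal_system n g m F"
    and ex: "\<And>x. x \<in> carrier_vec n \<Longrightarrow> expands n g m F x"
    and T: "linear_vec n n T"
  shows "(\<Sum>i<n. T (unit_vec n i) $ i) = (\<Sum>a<m. g (T (F a)) (F a))"
proof -
  have Fc: "F a \<in> carrier_vec n" if "a < m" for a using F that unfolding orthonormal_system_def by auto
  have "(\<Sum>i<n. T (unit_vec n i) $ i) = (\<Sum>i<n. \<Sum>a<m. g (unit_vec n i) (F a) * T (F a) $ i)"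
  proof (intro sum.cong refl)
    fix i assume "i \<in> {..<n}"
    then show "T (unit_vec n i) $ i = (\<Sum>a<m. g (unit_vec n i) (F a) * T (F a) $ i)"
      using ex[of "unit_vec n i"] linear_form_index[OF T, of i] unfolding expands_def by auto
  qed
  also have "\<dots> = (\<Sum>a<m. \<Sum>i<n. T (F a) $ i * g (unit_vec n i) (F a))"
    by (subst sum.swap) (simp add: mult.commute)
  also have "\<dots> = (\<Sum>a<m. g (T (F a)) (F a))"
    using Fc linear_form_inner(1)[OF g linear_vec_id] linear_vecD(1)[OF T]
    by (intro sum.cong refl linear_form_coords[symmetric]) auto
  finally show ?thesis .
qed

text \<open>
  The trace of the identity, computed in the standard basis and in the system, is \<open>n\<close> and \<open>m\<close>.
\<close>

lemma orthonormal_frameI: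
  assumes g: "inner_product n g" and F: "orthonormal_system n g m F"
    and ex: "\<And>x. x \<in> carrier_vec n \<Longrightarrow> expands n g m F x"
  shows "m = n" "orthonormal_frame n g F"
proof -
  have "(\<Sum>i<n. unit_vec n i $ i) = (\<Sum>a<m. g (F a) (F a))"
    by (rule trace_expand[OF g F ex linear_vec_id])
  then have "real n = real m" using F unfolding orthonormal_system_def by simp
  then show "m = n" by simp
  then show "orthonormal_frame n g F" using assms unfolding orthonormal_frame_def by simp
qed

lemma expands_all:
  assumes g: "inner_product n g" and F: "orthonormal_system n g m F"
    and e: "\<And>i. i < n \<Longrightarrow> expands n g m F (unit_vec n i)" and x: "x \<in> carrier_vec n"
  shows "expands n g m F x"
  unfolding expands_def
proof (intro allI impI)
  fix \<phi> assume \<phi>: "linear_form n \<phi>"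
  have Fc: "F a \<in> carrier_vec n" if "a < m" for a using F that unfolding orthonormal_system_def by auto
  have "\<phi> x = (\<Sum>i<n. x $ i * (\<Sum>a<m. g (unit_vec n i) (F a) * \<phi> (F a)))"
    unfolding linear_form_coords[OF \<phi> x] using e \<phi> unfolding expands_def by simp
  also have "\<dots> = (\<Sum>a<m. (\<Sum>i<n. x $ i * g (unit_vec n i) (F a)) * \<phi> (F a))"
    unfolding sum_distrib_left sum_distrib_right by (subst sum.swap) (simp add: mult.assoc)
  also have "\<dots> = (\<Sum>a<m. g x (F a) * \<phi> (F a))"
    using linear_form_coords[OF linear_form_inner(1)[OF g linear_vec_id Fc] x] by simp
  finally show "\<phi> x = (\<Sum>a<m. g x (F a) * \<phi> (F a))" .
qed

lemma subspace_carrier: "vec_subspace n (carrier_vec n)"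
  unfolding subspace_iff by auto

lemma orthonormal_frame_exists:
  assumes g: "inner_product n g"
  obtains F where "orthonormal_frame n g F"
proof -
  have "set (map (unit_vec n) [0..<n]) \<subseteq> (carrier_vec n :: real vec set)" by auto
  from gram_schmidt_system[OF g subspace_carrier this]
  obtain m F where F: "orthonormal_system n g m F" "\<forall>x\<in>set (map (unit_vec n) [0..<n]). expands n g m F x" by blast
  then show thesis using that orthonormal_frameI(2)[OF g F(1) expands_all[OF g F(1)]] by auto
qed

lemma orthonormal_frameD:
  assumes "orthonormal_frame n g F"
  shows "a < n \<Longrightarrow> F a \<in> carrier_vec n"
    and "a < n \<Longrightarrow> b < n \<Longrightarrow> g (F a) (F b) = (if a = b then 1 else 0)"
    and "x \<in> carrier_vec n \<Longrightarrow> linear_form n \<phi> \<Longrightarrow> \<phi> x = (\<Sum>a<n. g x (F a) * \<phi> (F a))"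
  using assms unfolding orthonormal_frame_def orthonormal_system_def expands_def by auto

lemma trace_frame:
  assumes "inner_product n g" "orthonormal_frame n g F" "linear_vec n n T"
  shows "(\<Sum>i<n. T (unit_vec n i) $ i) = (\<Sum>a<n. g (T (F a)) (F a))"
  using assms trace_expand[of n g n F T] unfolding orthonormal_frame_def by auto

lemma frame_vec_eqI:
  assumes g: "inner_product n g" and F: "orthonormal_frame n g F"
    and x: "x \<in> carrier_vec n" and y: "y \<in> carrier_vec n"
    and eq: "\<And>a. a < n \<Longrightarrow> g x (F a) = g y (F a)"
  shows "x = y"
  using x y
proof (rule vec_eq_by_linear_forms)
  fix \<phi> assume "linear_form n \<phi>"
  then show "\<phi> x = \<phi> y"
    using orthonormal_frameD(3)[OF F x, of \<phi>] orthonormal_frameD(3)[OF F y, of \<phi>] eq by simp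
qed

lemma linear_form_vanishes:
  assumes "orthonormal_frame n g F" "linear_form n \<phi>" "\<And>a. a < n \<Longrightarrow> \<phi> (F a) = 0" "x \<in> carrier_vec n"
  shows "\<phi> x = 0"
  unfolding orthonormal_frameD(3)[OF assms(1,4,2)] using assms(3) by simp

lemma inner_linear_frame:
  assumes "inner_product n g" "orthonormal_frame n g F" "linear_vec n n T" "x \<in> carrier_vec n" "z \<in> carrier_vec n"
  shows "g (T x) z = (\<Sum>m<n. g x (F m) * g (T (F m)) z)"
  by (rule orthonormal_frameD(3)[OF assms(2,4) linear_form_inner(1)[OF assms(1,3,5)]])

text \<open>
  The frame of the Einstein solvable algebra used throughout: its first \<open>n\<close> members come from the
  nilradical, and the others span the orthogonal abelian complement.
\<close>

lemma adapted_frame: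
  assumes g: "inner_product n g" and g': "inner_product N g'"
    and \<iota>: "linear_vec n N \<iota>" and iso: "\<And>x y. x \<in> carrier_vec n \<Longrightarrow> y \<in> carrier_vec n \<Longrightarrow> g' (\<iota> x) (\<iota> y) = g x y"
    and W: "vec_subspace N W"
    and decomp: "\<And>z. z \<in> carrier_vec N \<Longrightarrow> \<exists>x\<in>W. \<exists>y\<in>\<iota> ` carrier_vec n. z = x + y"
    and orth: "\<And>x y. x \<in> W \<Longrightarrow> y \<in> \<iota> ` carrier_vec n \<Longrightarrow> g' x y = 0"
  obtains f F where "orthonormal_frame n g f" "orthonormal_frame N g' F" "n \<le> N"
    "\<And>a. a < n \<Longrightarrow> F a = \<iota> (f a)" "\<And>a. n \<le> a \<Longrightarrow> a < N \<Longrightarrow> F a \<in> W"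
proof -
  obtain f where f: "orthonormal_frame n g f" using orthonormal_frame_exists[OF g] .
  have "\<forall>i. \<exists>x y. i < N \<longrightarrow> x \<in> W \<and> y \<in> carrier_vec n \<and> unit_vec N i = x + \<iota> y"
    using decomp[OF unit_vec_carrier] by blast
  then obtain X Y where XY: "\<And>i. i < N \<Longrightarrow> X i \<in> W \<and> Y i \<in> carrier_vec n \<and> unit_vec N i = X i + \<iota> (Y i)"
    by metis
  have Wc: "W \<subseteq> carrier_vec N" using W unfolding subspace_iff by auto
  have "set (map X [0..<N]) \<subseteq> W" using XY by auto
  from gram_schmidt_system[OF g' W this] obtain r A where
    A: "orthonormal_system N g' r A" "\<And>a. a < r \<Longrightarrow> A a \<in> W" and
    eA: "\<And>i. i < N \<Longrightarrow> expands N g' r A (X i)" by auto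
  define F where "F a = (if a < n then \<iota> (f a) else A (a - n))" for a
  have fc: "f a \<in> carrier_vec n" if "a < n" for a using orthonormal_frameD(1)[OF f that] .
  have orth2: "g' y x = 0" if "x \<in> W" "y \<in> \<iota> ` carrier_vec n" for x y
    using orth[OF that] that inner_productD(3)[OF g', of x y] Wc linear_vecD(1)[OF \<iota>] by auto
  have sys: "orthonormal_system N g' (n + r) F"
    unfolding orthonormal_system_def
  proof (intro conjI allI impI)
    fix a assume "a < n + r"
    then show "F a \<in> carrier_vec N" unfolding F_def using fc linear_vecD(1)[OF \<iota>] A Wc
      by (auto simp: subset_iff)
  next
    fix a b assume ab: "a < n + r" "b < n + r"
    have Aab: "g' (A u) (A v) = (if u = v then 1 else 0)" if "u < r" "v < r" for u v
      using A(1) that unfolding orthonormal_system_def by auto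
    show "g' (F a) (F b) = (if a = b then 1 else 0)"
      unfolding F_def using ab fc A(2) iso orthonormal_frameD(2)[OF f] Aab orth orth2 by auto
  qed
  have ext: "expands N g' (n + r) F (unit_vec N i)" if i: "i < N" for i
  proof -
    have XW: "X i \<in> W" "X i \<in> carrier_vec N" "\<iota> (Y i) \<in> carrier_vec N" "Y i \<in> carrier_vec n"
      "unit_vec N i = X i + \<iota> (Y i)"
      using XY[OF i] Wc linear_vecD(1)[OF \<iota>] by auto
    note split = sum_lessThan_add[of _ n r]
    have "expands N g' (n + r) F (X i)"
      unfolding expands_def split using XW eA[OF i] orth fc
      by (auto simp: F_def expands_def intro!: sum.neutral)
    moreover have "expands N g' (n + r) F (\<iota> (Y i))"
      unfolding expands_def split
    proof (intro allI impI)
      fix \<phi> assume \<phi>: "linear_form N \<phi>"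
      have "linear_form n (\<lambda>x. \<phi> (\<iota> x))"
        using \<phi> linear_vecD[OF \<iota>] unfolding linear_form_def by auto
      then have "\<phi> (\<iota> (Y i)) = (\<Sum>a<n. g (Y i) (f a) * \<phi> (\<iota> (f a)))"
        by (rule orthonormal_frameD(3)[OF f XW(4)])
      moreover have "(\<Sum>a<r. g' (\<iota> (Y i)) (F (n + a)) * \<phi> (F (n + a))) = 0"
        using orth2 A XW by (intro sum.neutral) (auto simp: F_def)
      ultimately show "\<phi> (\<iota> (Y i)) = (\<Sum>a<n. g' (\<iota> (Y i)) (F a) * \<phi> (F a))
          + (\<Sum>a<r. g' (\<iota> (Y i)) (F (n + a)) * \<phi> (F (n + a)))"
        using iso fc XW by (simp add: F_def)
    qed
    ultimately have "expands N g' (n + r) F (X i + 1 \<cdot>\<^sub>v \<iota> (Y i))"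
      using expands_linear[OF g' sys XW(2,3)] by blast
    then show ?thesis using XW by simp
  qed
  from orthonormal_frameI[OF g' sys expands_all[OF g' sys ext]]
  have "n + r = N" "orthonormal_frame N g' F" by auto
  then show thesis using that[OF f, of F] A(2) unfolding F_def by auto
qed

lemma inner_product_scalar_prod: "inner_product m (\<lambda>x y. x \<bullet> y)"
  unfolding inner_product_def
proof (intro conjI ballI allI impI)
  fix x y z :: "real vec" and c :: real
  assume x: "x \<in> carrier_vec m"
  show "0 < x \<bullet> x" if "x \<noteq> 0\<^sub>v m"
  proof -
    have "x \<bullet> x \<ge> 0" using x unfolding scalar_prod_def by (auto intro!: sum_nonneg)
    moreover have "x \<bullet> x \<noteq> 0"
    proof
      assume "x \<bullet> x = 0"
      then have "\<forall>i\<in>{0..<m}. x $ i * x $ i = 0"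
        using x unfolding scalar_prod_def by (subst (asm) sum_nonneg_eq_0_iff) auto
      then have "x = 0\<^sub>v m" using x by (intro eq_vecI) auto
      then show False using that by simp
    qed
    ultimately show ?thesis by simp
  qed
  assume y: "y \<in> carrier_vec m"
  show "x \<bullet> y = y \<bullet> x" by (rule comm_scalar_prod[OF x y])
  show "(c \<cdot>\<^sub>v x) \<bullet> y = c * (x \<bullet> y)" using x y by simp
  assume z: "z \<in> carrier_vec m"
  show "(x + y) \<bullet> z = x \<bullet> z + y \<bullet> z" by (rule add_scalar_prod_distrib[OF x y z])
qed

lemma scalar_prod_unit:
  "x \<in> carrier_vec m \<Longrightarrow> i < m \<Longrightarrow> x \<bullet> unit_vec m i = (x $ i :: real)"
  by simp

lemma orthonormal_frame_unit: "orthonormal_frame m (\<lambda>x y. x \<bullet> y) (unit_vec m)"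
  unfolding orthonormal_frame_def orthonormal_system_def expands_def
proof (intro conjI allI impI ballI)
  fix x :: "real vec" and \<phi> assume x: "x \<in> carrier_vec m" and \<phi>: "linear_form m \<phi>"
  show "\<phi> x = (\<Sum>a<m. (x \<bullet> unit_vec m a) * \<phi> (unit_vec m a))"
    unfolding linear_form_coords[OF \<phi> x] using x by simp
qed auto

section \<open>The Ricci curvature of a left invariant metric\<close>

lemma lie_algebraD:
  assumes "lie_algebra n br"
  shows "bilinear_vec n br"
    and "x \<in> carrier_vec n \<Longrightarrow> br x x = 0\<^sub>v n"
    and "x \<in> carrier_vec n \<Longrightarrow> y \<in> carrier_vec n \<Longrightarrow> z \<in> carrier_vec n \<Longrightarrow>
      br x (br y z) + br y (br z x) + br z (br x y) = 0\<^sub>v n"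
  using assms unfolding lie_algebra_def by auto

lemma lie_antisym:
  assumes L: "lie_algebra n br" and x: "x \<in> carrier_vec n" and y: "y \<in> carrier_vec n"
  shows "br y x = (-1) \<cdot>\<^sub>v br x y"
proof -
  note b = bilinear_vecD[OF lie_algebraD(1)[OF L]]
  have c: "br x y \<in> carrier_vec n" "br y x \<in> carrier_vec n" using b x y by auto
  have "0\<^sub>v n = br (x + y) (x + y)" using lie_algebraD(2)[OF L] x y by simp
  also have "\<dots> = br x x + br y x + (br x y + br y y)" using b x y by simp
  also have "\<dots> = 0\<^sub>v n + br y x + (br x y + 0\<^sub>v n)" using lie_algebraD(2)[OF L] x y by simp
  also have "\<dots> = br y x + br x y" using c by simp
  finally have eq: "br y x + br x y = 0\<^sub>v n" by simp
  show ?thesis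
  proof (intro eq_vecI)
    fix i assume "i < dim_vec ((-1) \<cdot>\<^sub>v br x y)"
    then have i: "i < n" using c by simp
    have "(br y x + br x y) $ i = 0" unfolding eq using i by simp
    then show "br y x $ i = ((-1) \<cdot>\<^sub>v br x y) $ i" using c i by simp
  qed (use c in simp)
qed

lemma linear_form_neg:
  assumes "linear_form n \<phi>" "lie_algebra n br" "x \<in> carrier_vec n" "y \<in> carrier_vec n"
  shows "\<phi> (br y x) = - \<phi> (br x y)"
  using assms bilinear_vecD(1)[OF lie_algebraD(1)[OF assms(2)]] lie_antisym[OF assms(2-4)]
  unfolding linear_form_def by simp

lemma inner_bracket_neg:
  assumes "inner_product n g" "lie_algebra n br" "x \<in> carrier_vec n" "y \<in> carrier_vec n" "z \<in> carrier_vec n"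
  shows "g (br y x) z = - g (br x y) z"
  using linear_form_neg[OF linear_form_inner_vec(1)[OF assms(1,5)] assms(2-4)] .

subsection \<open>Existence and coefficients of the Levi-Civita connection\<close>

text \<open>
  The right-hand side of the Koszul formula for left invariant fields, where derivatives of inner
  products vanish.
\<close>

definition koszul ::
  "(real vec \<Rightarrow> real vec \<Rightarrow> real vec) \<Rightarrow> (real vec \<Rightarrow> real vec \<Rightarrow> real) \<Rightarrow>
   real vec \<Rightarrow> real vec \<Rightarrow> real vec \<Rightarrow> real" where
  "koszul br g x y z = (g (br x y) z - g (br y z) x + g (br z x) y) / 2"

lemma koszul_linear:
  assumes g: "inner_product n g" and L: "lie_algebra n br"
    and c: "x \<in> carrier_vec n" "y \<in> carrier_vec n"
  shows "linear_form n (koszul br g x y)"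
    and "linear_form n (\<lambda>z. koszul br g x z y)"
    and "linear_form n (\<lambda>z. koszul br g z x y)"
  using c unfolding linear_form_def koszul_def
  by (simp_all add: bilinear_vecD[OF lie_algebraD(1)[OF L]] inner_productD(1,2,5,6)[OF g] field_simps)

text \<open>
  The vector \<open>D x y\<close> is assembled from the inner products prescribed by the Koszul formula.
\<close>

lemma levi_civita_exists:
  assumes g: "inner_product n g" and L: "lie_algebra n br"
  obtains D where "levi_civita n br g D"
proof -
  obtain F where F: "orthonormal_frame n g F" using orthonormal_frame_exists[OF g] .
  note Fc = orthonormal_frameD(1)[OF F]
  define D where "D x y = vec_comb n n (\<lambda>k. koszul br g x y (F k)) F" for x y
  have Dc: "D x y \<in> carrier_vec n" for x y unfolding D_def by simp
  have D\<phi>: "\<phi> (D x y) = (\<Sum>k<n. koszul br g x y (F k) * \<phi> (F k))" if "linear_form n \<phi>" for \<phi> x y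
    unfolding D_def using linear_form_vec_comb[OF that] Fc by blast
  have gD: "g (D x y) z = koszul br g x y z"
    if c: "x \<in> carrier_vec n" "y \<in> carrier_vec n" "z \<in> carrier_vec n" for x y z
  proof -
    have "g (D x y) z = (\<Sum>k<n. koszul br g x y (F k) * g (F k) z)"
      by (rule D\<phi>[OF linear_form_inner_vec(1)[OF g c(3)]])
    also have "\<dots> = (\<Sum>k<n. g z (F k) * koszul br g x y (F k))"
      using c Fc by (intro sum.cong) (auto simp: inner_productD(3)[OF g])
    also have "\<dots> = koszul br g x y z"
      by (rule orthonormal_frameD(3)[OF F c(3) koszul_linear(1)[OF g L c(1,2)], symmetric])
    finally show ?thesis .
  qed
  note b = bilinear_vecD(1)[OF lie_algebraD(1)[OF L]]
  have lin: "linear_vec n n T"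
    if T: "\<And>x. T x \<in> carrier_vec n" "\<And>z. z \<in> carrier_vec n \<Longrightarrow> linear_form n (\<lambda>x. g (T x) z)" for T
    unfolding linear_vec_iff
  proof (intro conjI ballI allI)
    fix x :: "real vec" assume x: "x \<in> carrier_vec n"
    show "T x \<in> carrier_vec n" by fact
    show "T (k \<cdot>\<^sub>v x) = k \<cdot>\<^sub>v T x" for k
      using T(1) T(2)[OF Fc] x Fc
      by (intro frame_vec_eqI[OF g F]) (auto simp: inner_productD(1,2)[OF g] linear_form_def)
    fix y :: "real vec" assume y: "y \<in> carrier_vec n"
    show "T (x + y) = T x + T y"
      using T(1) T(2)[OF Fc] x y Fc
      by (intro frame_vec_eqI[OF g F]) (auto simp: inner_productD(1,2)[OF g] linear_form_def)
  qed
  have "bilinear_vec n D"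
    unfolding bilinear_vec_def
  proof (intro conjI ballI)
    fix x :: "real vec" assume x: "x \<in> carrier_vec n"
    show "linear_vec n n (D x)"
    proof (rule lin[OF Dc])
      fix z :: "real vec" assume z: "z \<in> carrier_vec n"
      show "linear_form n (\<lambda>y. g (D x y) z)"
        using koszul_linear(2)[OF g L x z] gD[OF x _ z] unfolding linear_form_def by simp
    qed
    show "linear_vec n n (\<lambda>y. D y x)"
    proof (rule lin[OF Dc])
      fix z :: "real vec" assume z: "z \<in> carrier_vec n"
      show "linear_form n (\<lambda>y. g (D y x) z)"
        using koszul_linear(3)[OF g L x z] gD[OF _ x z] unfolding linear_form_def by simp
    qed
  qed
  moreover have "D x y - D y x = br x y" if c: "x \<in> carrier_vec n" "y \<in> carrier_vec n" for x y
  proof (rule frame_vec_eqI[OF g F])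
    fix a assume "a < n"
    then have a: "F a \<in> carrier_vec n" using Fc by simp
    have "g (D x y - D y x) (F a) = koszul br g x y (F a) - koszul br g y x (F a)"
      using c a Dc by (simp add: inner_minus[OF g] gD)
    also have "\<dots> = g (br x y) (F a)"
      using inner_bracket_neg[OF g L c a] inner_bracket_neg[OF g L c(1) a c(2)]
        inner_bracket_neg[OF g L c(2) a c(1)]
      unfolding koszul_def add_divide_distrib diff_divide_distrib by linarith
    finally show "g (D x y - D y x) (F a) = g (br x y) (F a)" .
  qed (use c b Dc in auto)
  moreover have "g (D x y) z + g y (D x z) = 0"
    if c: "x \<in> carrier_vec n" "y \<in> carrier_vec n" "z \<in> carrier_vec n" for x y z
  proof -
    have "g y (D x z) = koszul br g x z y"
      using gD[OF c(1,3,2)] inner_productD(3)[OF g c(2) Dc] by simp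
    then show ?thesis
      using gD[OF c] inner_bracket_neg[OF g L c] inner_bracket_neg[OF g L c(1,3,2)]
        inner_bracket_neg[OF g L c(2,3,1)]
      unfolding koszul_def add_divide_distrib diff_divide_distrib by linarith
  qed
  ultimately have "levi_civita n br g D" unfolding levi_civita_def by auto
  then show thesis by (rule that)
qed

text \<open>
  The usual cyclic combination: add the torsion and metric equations over the cyclic permutations of
  the three arguments.
\<close>

lemma levi_civita_koszul:
  assumes g: "inner_product n g" and L: "lie_algebra n br" and D: "levi_civita n br g D"
    and c: "x \<in> carrier_vec n" "y \<in> carrier_vec n" "z \<in> carrier_vec n"
  shows "g (D x y) z = koszul br g x y z"
proof -
  have B: "bilinear_vec n D" using D unfolding levi_civita_def by auto
  have T: "g (br u v) w = g (D u v) w - g (D v u) w"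
    if "u \<in> carrier_vec n" "v \<in> carrier_vec n" "w \<in> carrier_vec n" for u v w
  proof -
    have "br u v = D u v - D v u" using D that unfolding levi_civita_def by auto
    then show ?thesis using that bilinear_vecD(1)[OF B] by (simp add: inner_minus[OF g])
  qed
  have M: "g (D u v) w + g (D u w) v = 0"
    if "u \<in> carrier_vec n" "v \<in> carrier_vec n" "w \<in> carrier_vec n" for u v w
  proof -
    have "g (D u v) w + g v (D u w) = 0" using D that unfolding levi_civita_def by auto
    then show ?thesis using that bilinear_vecD(1)[OF B] inner_productD(3)[OF g, of v "D u w"] by simp
  qed
  show ?thesis
    unfolding koszul_def add_divide_distrib diff_divide_distrib
    using T[OF c] T[OF c(2,3,1)] T[OF c(3,1,2)] M[OF c] M[OF c(2,3,1)] M[OF c(3,1,2)] by linarith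
qed

subsection \<open>The Ricci curvature in terms of structure constants\<close>

lemma sum_antisym:
  fixes Q :: "nat \<Rightarrow> nat \<Rightarrow> real"
  assumes "\<And>a m. a < N \<Longrightarrow> m < N \<Longrightarrow> Q m a = - Q a m"
  shows "(\<Sum>a<N. \<Sum>m<N. Q a m) = 0"
proof -
  have "(\<Sum>a<N. \<Sum>m<N. Q a m) = (\<Sum>a<N. \<Sum>m<N. Q m a)" by (rule sum.swap)
  also have "\<dots> = (\<Sum>a<N. \<Sum>m<N. - Q a m)" by (intro sum.cong refl) (rule assms; simp)
  also have "\<dots> = - (\<Sum>a<N. \<Sum>m<N. Q a m)" by (simp add: sum_negf)
  finally show ?thesis by simp
qed

definition christoffel :: "(nat \<Rightarrow> nat \<Rightarrow> nat \<Rightarrow> real) \<Rightarrow> nat \<Rightarrow> nat \<Rightarrow> nat \<Rightarrow> real" where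
  "christoffel c a b k = (c a b k - c b k a + c k a b) / 2"

text \<open>
  The classical formula for the Ricci tensor in structure constants: a term from the mean curvature
  vector, two terms from \<open>ad\<close> (the second is the Killing form), and one from the image of the bracket.
\<close>

definition ricci_coeff :: "nat \<Rightarrow> (nat \<Rightarrow> nat \<Rightarrow> nat \<Rightarrow> real) \<Rightarrow> nat \<Rightarrow> nat \<Rightarrow> real" where
  "ricci_coeff N c b d =
     - (\<Sum>m<N. (\<Sum>a<N. c m a a) * christoffel c b d m)
     - (\<Sum>a<N. \<Sum>m<N. c b a m * c d a m) / 2
     - (\<Sum>a<N. \<Sum>m<N. c b a m * c d m a) / 2
     + (\<Sum>a<N. \<Sum>m<N. c a m b * c a m d) / 4"

text \<open>
  Eliminating \<open>c = \<Gamma> - \<Gamma>\<^sup>T\<close> from the curvature leaves \<open>- \<Sum> \<Gamma> a b m * \<Gamma> m d a\<close> besides the trace term.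
  In each factor the part symmetric in \<open>a\<close>, \<open>m\<close> comes from \<open>ad\<close> and the antisymmetric part from the
  image of the bracket; the mixed products cancel.
\<close>

lemma christoffel_ricci:
  assumes anti: "\<And>a b k. a < N \<Longrightarrow> b < N \<Longrightarrow> k < N \<Longrightarrow> c b a k = - c a b k"
    and b: "b < N" and d: "d < N"
  defines "\<Gamma> \<equiv> christoffel c"
  shows "(\<Sum>a<N. (\<Sum>m<N. \<Gamma> b d m * \<Gamma> a m a) - (\<Sum>m<N. \<Gamma> a d m * \<Gamma> b m a) - (\<Sum>m<N. c a b m * \<Gamma> m d a))
    = ricci_coeff N c b d"
proof -
  have 1: "(\<Sum>a<N. \<Sum>m<N. \<Gamma> b d m * \<Gamma> a m a) = - (\<Sum>m<N. (\<Sum>a<N. c m a a) * \<Gamma> b d m)"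
  proof -
    have "\<Gamma> a m a = - c m a a" if "a < N" "m < N" for a m
    proof -
      have "c a a m = 0" using anti[OF that(1,1,2)] by linarith
      moreover have "c a m a = - c m a a" using anti[OF that(2,1,1)] .
      ultimately show ?thesis unfolding \<Gamma>_def christoffel_def by simp
    qed
    then have "(\<Sum>a<N. \<Sum>m<N. \<Gamma> b d m * \<Gamma> a m a) = (\<Sum>a<N. \<Sum>m<N. - (c m a a * \<Gamma> b d m))"
      by (intro sum.cong) auto
    also have "\<dots> = - (\<Sum>m<N. (\<Sum>a<N. c m a a) * \<Gamma> b d m)"
      by (subst sum.swap) (simp add: sum_negf sum_distrib_right)
    finally show ?thesis .
  qed
  have 2: "(\<Sum>a<N. \<Sum>m<N. \<Gamma> a d m * \<Gamma> b m a) + (\<Sum>a<N. \<Sum>m<N. c a b m * \<Gamma> m d a)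
      = (\<Sum>a<N. \<Sum>m<N. \<Gamma> a b m * \<Gamma> m d a)"
  proof -
    have "(\<Sum>a<N. \<Sum>m<N. \<Gamma> a d m * \<Gamma> b m a) = (\<Sum>a<N. \<Sum>m<N. \<Gamma> m d a * \<Gamma> b a m)"
      by (rule sum.swap)
    moreover have "c a b m = \<Gamma> a b m - \<Gamma> b a m" if "a < N" "m < N" for a m
      using anti[OF b that] anti[OF that(1,2) b] anti[OF that(2) b that(1)]
      unfolding \<Gamma>_def christoffel_def add_divide_distrib diff_divide_distrib by linarith
    then have "c a b m * \<Gamma> m d a = \<Gamma> a b m * \<Gamma> m d a - \<Gamma> m d a * \<Gamma> b a m" if "a < N" "m < N" for a m
      using that by (simp only: left_diff_distrib) (simp only: mult.commute)
    then have "(\<Sum>a<N. \<Sum>m<N. c a b m * \<Gamma> m d a) = (\<Sum>a<N. \<Sum>m<N. \<Gamma> a b m * \<Gamma> m d a - \<Gamma> m d a * \<Gamma> b a m)"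
      by (intro sum.cong) auto
    ultimately show ?thesis by (simp add: sum_subtractf)
  qed
  define X where "X e a m = c e a m + c e m a" for e a m
  have 3: "(\<Sum>a<N. \<Sum>m<N. \<Gamma> a b m * \<Gamma> m d a)
    = (\<Sum>a<N. \<Sum>m<N. c b a m * c d a m) / 2 + (\<Sum>a<N. \<Sum>m<N. c b a m * c d m a) / 2
      - (\<Sum>a<N. \<Sum>m<N. c a m b * c a m d) / 4"
  proof -
    have prod: "4 * (\<Gamma> a b m * \<Gamma> m d a)
      = X b a m * X d a m + (X d a m * c a m b - X b a m * c a m d) - c a m b * c a m d"
      if am: "a < N" "m < N" for a m
    proof -
      have \<Gamma>2: "2 * \<Gamma> i j k = c i j k - c j k i + c k i j" for i j k
        unfolding \<Gamma>_def christoffel_def by simp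
      have e1: "2 * \<Gamma> a b m = - X b a m - c a m b"
        using anti[OF b am] anti[OF am b] unfolding \<Gamma>2 X_def by linarith
      have e2: "2 * \<Gamma> m d a = - X d a m + c a m d"
        using anti[OF d am(2,1)] unfolding \<Gamma>2 X_def by linarith
      have "4 * (\<Gamma> a b m * \<Gamma> m d a) = (2 * \<Gamma> a b m) * (2 * \<Gamma> m d a)" by simp
      also have "\<dots> = (- X b a m - c a m b) * (- X d a m + c a m d)" by (simp only: e1 e2)
      finally show ?thesis by (simp add: algebra_simps)
    qed
    \<comment> \<open>The mixed products are antisymmetric in \<open>a\<close> and \<open>m\<close>.\<close>
    have zero: "(\<Sum>a<N. \<Sum>m<N. X d a m * c a m b - X b a m * c a m d) = 0"
    proof (rule sum_antisym)
      fix a m assume am: "a < N" "m < N"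
      have "X e m a = X e a m" for e unfolding X_def by simp
      then show "X d m a * c m a b - X b m a * c m a d = - (X d a m * c a m b - X b a m * c a m d)"
        using anti[OF am b] anti[OF am d] by simp
    qed
    have XX: "(\<Sum>a<N. \<Sum>m<N. X b a m * X d a m)
      = 2 * (\<Sum>a<N. \<Sum>m<N. c b a m * c d a m) + 2 * (\<Sum>a<N. \<Sum>m<N. c b a m * c d m a)"
    proof -
      have "(\<Sum>a<N. \<Sum>m<N. X b a m * X d a m)
        = (\<Sum>a<N. \<Sum>m<N. c b a m * c d a m) + (\<Sum>a<N. \<Sum>m<N. c b a m * c d m a)
        + (\<Sum>a<N. \<Sum>m<N. c b m a * c d a m) + (\<Sum>a<N. \<Sum>m<N. c b m a * c d m a)"
        unfolding X_def by (simp add: algebra_simps sum.distrib)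
      moreover have "(\<Sum>a<N. \<Sum>m<N. c b m a * c d a m) = (\<Sum>a<N. \<Sum>m<N. c b a m * c d m a)"
        "(\<Sum>a<N. \<Sum>m<N. c b m a * c d m a) = (\<Sum>a<N. \<Sum>m<N. c b a m * c d a m)"
        by (rule sum.swap)+
      ultimately show ?thesis by simp
    qed
    have "4 * (\<Sum>a<N. \<Sum>m<N. \<Gamma> a b m * \<Gamma> m d a)
      = (\<Sum>a<N. \<Sum>m<N. X b a m * X d a m + (X d a m * c a m b - X b a m * c a m d) - c a m b * c a m d)"
      unfolding sum_distrib_left using prod by (intro sum.cong) auto
    also have "\<dots> = (\<Sum>a<N. \<Sum>m<N. X b a m * X d a m) - (\<Sum>a<N. \<Sum>m<N. c a m b * c a m d)"
      using zero by (simp add: sum.distrib sum_subtractf)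
    finally show ?thesis unfolding XX by simp
  qed
  show ?thesis
    unfolding ricci_coeff_def \<Gamma>_def[symmetric] sum_subtractf
    using 1 2 3 by simp
qed

definition structure_constants ::
  "(real vec \<Rightarrow> real vec \<Rightarrow> real vec) \<Rightarrow> (real vec \<Rightarrow> real vec \<Rightarrow> real) \<Rightarrow> (nat \<Rightarrow> real vec) \<Rightarrow>
   nat \<Rightarrow> nat \<Rightarrow> nat \<Rightarrow> real" where
  "structure_constants br g F a b k = g (br (F a) (F b)) (F k)"

lemma structure_constants_antisym:
  assumes "inner_product n g" "lie_algebra n br" "orthonormal_frame n g F"
    and "a < n" "b < n" "k < n"
  shows "structure_constants br g F b a k = - structure_constants br g F a b k"
  unfolding structure_constants_def
  by (rule inner_bracket_neg[OF assms(1,2)]; rule orthonormal_frameD(1)[OF assms(3)]; fact)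

lemma ricci_curvature_frame:
  assumes g: "inner_product n g" and L: "lie_algebra n br" and D: "levi_civita n br g D"
    and F: "orthonormal_frame n g F" and b: "b < n" and d: "d < n"
  shows "ricci_curvature n br D (F b) (F d) = ricci_coeff n (structure_constants br g F) b d"
proof -
  let ?c = "structure_constants br g F" and ?\<Gamma> = "christoffel (structure_constants br g F)"
  have B: "bilinear_vec n D" using D unfolding levi_civita_def by auto
  note Fc = orthonormal_frameD(1)[OF F]
  note Dc = bilinear_vecD(1)[OF B] and bc = bilinear_vecD(1)[OF lie_algebraD(1)[OF L]]
  have \<Gamma>: "g (D (F a) (F m)) (F k) = ?\<Gamma> a m k" if "a < n" "m < n" "k < n" for a m k
    using levi_civita_koszul[OF g L D] Fc that
    unfolding koszul_def christoffel_def structure_constants_def by simp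
  note lD = linear_vec_bracket[OF B] and lb = linear_vec_bracket[OF lie_algebraD(1)[OF L]]
  have lin: "linear_vec n n (\<lambda>x. riemann_curvature br D x (F b) (F d))"
    unfolding riemann_curvature_def
    by (intro linear_vec_minus
        lD(2)[OF Dc[OF Fc[OF b] Fc[OF d]]]
        linear_vec_comp[OF lD(2)[OF Fc[OF d]] lD(1)[OF Fc[OF b]]]
        linear_vec_comp[OF lb(2)[OF Fc[OF b]] lD(2)[OF Fc[OF d]]])
  have "ricci_curvature n br D (F b) (F d) = (\<Sum>a<n. g (riemann_curvature br D (F a) (F b) (F d)) (F a))"
    unfolding ricci_curvature_def by (rule trace_frame[OF g F lin])
  also have "\<dots> = (\<Sum>a<n. (\<Sum>m<n. ?\<Gamma> b d m * ?\<Gamma> a m a) - (\<Sum>m<n. ?\<Gamma> a d m * ?\<Gamma> b m a) - (\<Sum>m<n. ?c a b m * ?\<Gamma> m d a))"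
  proof (intro sum.cong refl)
    fix a assume "a \<in> {..<n}"
    then have a: "a < n" by simp
    have ex: "g (f u) (F a) = (\<Sum>m<n. g u (F m) * g (f (F m)) (F a))"
      if "linear_vec n n f" "u \<in> carrier_vec n" for f u
      by (rule orthonormal_frameD(3)[OF F that(2) linear_form_inner(1)[OF g that(1) Fc[OF a]]])
    have "g (D (F a) (D (F b) (F d))) (F a) = (\<Sum>m<n. ?\<Gamma> b d m * ?\<Gamma> a m a)"
      using ex[of "D (F a)"] linear_vec_bracket[OF B] Fc Dc a b d by (simp add: \<Gamma>)
    moreover have "g (D (F b) (D (F a) (F d))) (F a) = (\<Sum>m<n. ?\<Gamma> a d m * ?\<Gamma> b m a)"
      using ex[of "D (F b)"] linear_vec_bracket[OF B] Fc Dc a b d by (simp add: \<Gamma>)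
    moreover have "g (D (br (F a) (F b)) (F d)) (F a) = (\<Sum>m<n. ?c a b m * ?\<Gamma> m d a)"
      using ex[of "\<lambda>x. D x (F d)" "br (F a) (F b)"] linear_vec_bracket[OF B] Fc bc a b d
      by (simp add: \<Gamma> structure_constants_def)
    ultimately show "g (riemann_curvature br D (F a) (F b) (F d)) (F a)
      = (\<Sum>m<n. ?\<Gamma> b d m * ?\<Gamma> a m a) - (\<Sum>m<n. ?\<Gamma> a d m * ?\<Gamma> b m a) - (\<Sum>m<n. ?c a b m * ?\<Gamma> m d a)"
      unfolding riemann_curvature_def using Fc Dc bc a b d by (simp add: inner_minus[OF g])
  qed
  also have "\<dots> = ricci_coeff n ?c b d"
    by (rule christoffel_ricci[OF structure_constants_antisym[OF g L F] b d])
  finally show ?thesis .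
qed

lemma ricci_curvature_linear:
  assumes B: "bilinear_vec n br" and D: "bilinear_vec n D" and c: "z \<in> carrier_vec n"
  shows "linear_form n (\<lambda>x. ricci_curvature n br D x z)"
    and "linear_form n (\<lambda>x. ricci_curvature n br D z x)"
proof -
  note lD = linear_vec_bracket[OF D] and lb = linear_vec_bracket[OF B]
  note Dc = bilinear_vecD(1)[OF D] and bc = bilinear_vecD(1)[OF B]
  have e: "unit_vec n i \<in> carrier_vec n" for i by simp
  show "linear_form n (\<lambda>x. ricci_curvature n br D x z)"
    unfolding ricci_curvature_def riemann_curvature_def
    by (rule linear_form_sum, rule linear_form_index[OF _ _], rule linear_vec_minus, rule linear_vec_minus,
        rule linear_vec_comp[OF lD(2)[OF c] lD(1)[OF e]], rule lD(2)[OF Dc[OF e c]],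
        rule linear_vec_comp[OF lb(1)[OF e] lD(2)[OF c]])
  show "linear_form n (\<lambda>x. ricci_curvature n br D z x)"
    unfolding ricci_curvature_def riemann_curvature_def
    by (rule linear_form_sum, rule linear_form_index[OF _ _], rule linear_vec_minus, rule linear_vec_minus,
        rule linear_vec_comp[OF lD(1)[OF c] lD(1)[OF e]], rule linear_vec_comp[OF lD(1)[OF e] lD(1)[OF c]],
        rule lD(1)[OF bc[OF e c]])
qed

text \<open>
  Both sides of the Einstein equation are bilinear, so it suffices to check it on a frame.
\<close>

lemma left_invariant_einsteinI:
  assumes g: "inner_product n g" and L: "lie_algebra n br" and F: "orthonormal_frame n g F"
    and ric: "\<And>b d. b < n \<Longrightarrow> d < n \<Longrightarrow>
      ricci_coeff n (structure_constants br g F) b d = (if b = d then \<kappa> else 0)"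
  shows "left_invariant_einstein n br g"
proof -
  obtain D where D: "levi_civita n br g D" using levi_civita_exists[OF g L] .
  have B: "bilinear_vec n D" using D unfolding levi_civita_def by auto
  note Fc = orthonormal_frameD(1)[OF F]
  define \<Phi> where "\<Phi> x z = ricci_curvature n br D x z - \<kappa> * g x z" for x z
  have lin1: "linear_form n (\<lambda>x. \<Phi> x z)" if "z \<in> carrier_vec n" for z
    unfolding \<Phi>_def
    by (rule linear_form_diff[OF ricci_curvature_linear(1)[OF lie_algebraD(1)[OF L] B that]
          linear_form_scale[OF linear_form_inner_vec(1)[OF g that]]])
  have lin2: "linear_form n (\<lambda>z. \<Phi> x z)" if "x \<in> carrier_vec n" for x
    unfolding \<Phi>_def
    by (rule linear_form_diff[OF ricci_curvature_linear(2)[OF lie_algebraD(1)[OF L] B that]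
          linear_form_scale[OF linear_form_inner_vec(2)[OF g that]]])
  have "\<Phi> (F b) (F d) = 0" if "b < n" "d < n" for b d
    unfolding \<Phi>_def ricci_curvature_frame[OF g L D F that] ric[OF that] orthonormal_frameD(2)[OF F that] by simp
  then have "\<Phi> (F b) z = 0" if "b < n" "z \<in> carrier_vec n" for b z
    using linear_form_vanishes[OF F lin2[OF Fc[OF that(1)]] _ that(2)] that by blast
  then have "\<Phi> x z = 0" if "x \<in> carrier_vec n" "z \<in> carrier_vec n" for x z
    using linear_form_vanishes[OF F lin1[OF that(2)] _ that(1)] that by blast
  then have "\<forall>x\<in>carrier_vec n. \<forall>z\<in>carrier_vec n. ricci_curvature n br D x z = \<kappa> * g x z"
    unfolding \<Phi>_def by simp
  then show ?thesis unfolding left_invariant_einstein_def using D by blast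
qed

section \<open>Einstein solvmanifolds and nilsolitons\<close>

subsection \<open>The Ricci curvature along the nilradical\<close>

text \<open>
  The Ricci tensor of a nilpotent Lie algebra, for which the mean curvature vector and the Killing form
  vanish.
\<close>

definition nil_ricci :: "nat \<Rightarrow> (nat \<Rightarrow> nat \<Rightarrow> nat \<Rightarrow> real) \<Rightarrow> nat \<Rightarrow> nat \<Rightarrow> real" where
  "nil_ricci n c b d =
     (\<Sum>i<n. \<Sum>j<n. c i j b * c i j d) / 4 - (\<Sum>i<n. \<Sum>j<n. c b i j * c d i j) / 2"

text \<open>
  Write \<open>A i\<close> for the matrix of \<open>ad (F i)\<close> on the nilradical, \<open>n \<le> i < N\<close>. The two sums are
  \<open>1/2 \<Sum> [A i, (A i)\<^sup>t]\<close> and the symmetric part of \<open>ad H\<close>, where \<open>H\<close> is the mean curvature vector. They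
  collect the terms of the Ricci formula in which one summation index leaves the nilradical.
\<close>

lemma ricci_coeff_nilradical:
  assumes nN: "n \<le> N"
    and anti: "\<And>a b k. a < N \<Longrightarrow> b < N \<Longrightarrow> k < N \<Longrightarrow> c b a k = - c a b k"
    and im: "\<And>a b k. a < N \<Longrightarrow> b < N \<Longrightarrow> n \<le> k \<Longrightarrow> k < N \<Longrightarrow> c a b k = 0"
    and abelian: "\<And>a b k. n \<le> a \<Longrightarrow> a < N \<Longrightarrow> n \<le> b \<Longrightarrow> b < N \<Longrightarrow> k < N \<Longrightarrow> c a b k = 0"
    and killing: "\<And>b d. b < n \<Longrightarrow> d < n \<Longrightarrow> (\<Sum>a<n. \<Sum>m<n. c b a m * c d m a) = 0"
    and unimod: "\<And>m. m < n \<Longrightarrow> (\<Sum>a<n. c m a a) = 0"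
    and b: "b < n" and d: "d < n"
  shows "ricci_coeff N c b d = nil_ricci n c b d
      + (\<Sum>i\<in>{n..<N}. \<Sum>m<n. c i m b * c i m d - c i b m * c i d m) / 2
      - (\<Sum>i\<in>{n..<N}. (\<Sum>a<n. c i a a) * (c i b d + c i d b)) / 2"
proof -
  have split: "(\<Sum>a<N. h a) = (\<Sum>a<n. h a) + (\<Sum>a\<in>{n..<N}. h a)" for h :: "nat \<Rightarrow> real"
    using nN by (metis ivl_disj_un_one(2) ivl_disj_int_one(2) finite_lessThan finite_atLeastLessThan sum.union_disjoint)
  have split0: "(\<Sum>a<N. h a) = (\<Sum>a<n. h a)" if "\<And>a. n \<le> a \<Longrightarrow> a < N \<Longrightarrow> h a = 0" for h :: "nat \<Rightarrow> real"
    unfolding split using that by (simp add: sum.neutral)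
  have bN: "b < N" and dN: "d < N" using b d nN by auto
  have 1: "(\<Sum>m<N. (\<Sum>a<N. c m a a) * christoffel c b d m)
      = (\<Sum>i\<in>{n..<N}. (\<Sum>a<n. c i a a) * (c i b d + c i d b)) / 2"
  proof -
    have tr: "(\<Sum>a<N. c m a a) = (\<Sum>a<n. c m a a)" if "m < N" for m
      using im that by (intro split0) auto
    have \<Gamma>: "christoffel c b d i = (c i b d + c i d b) / 2" if i: "n \<le> i" "i < N" for i
      using im[OF bN dN i] anti[OF i(2) dN bN] unfolding christoffel_def by simp
    have "(\<Sum>m<N. (\<Sum>a<N. c m a a) * christoffel c b d m)
        = (\<Sum>m<N. (\<Sum>a<n. c m a a) * christoffel c b d m)"
      using tr by (intro sum.cong) auto
    also have "\<dots> = (\<Sum>m\<in>{n..<N}. (\<Sum>a<n. c m a a) * christoffel c b d m)"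
      unfolding split using unimod by (simp add: sum.neutral)
    also have "\<dots> = (\<Sum>i\<in>{n..<N}. (\<Sum>a<n. c i a a) * (c i b d + c i d b) / 2)"
      using \<Gamma> by (intro sum.cong) auto
    finally show ?thesis by (simp add: sum_divide_distrib)
  qed
  have 2: "(\<Sum>a<N. \<Sum>m<N. c b a m * c d a m)
      = (\<Sum>i<n. \<Sum>j<n. c b i j * c d i j) + (\<Sum>i\<in>{n..<N}. \<Sum>m<n. c i b m * c i d m)"
  proof -
    have "(\<Sum>a<N. \<Sum>m<N. c b a m * c d a m) = (\<Sum>a<N. \<Sum>m<n. c b a m * c d a m)"
      using im bN by (intro sum.cong refl split0) auto
    also have "\<dots> = (\<Sum>i<n. \<Sum>j<n. c b i j * c d i j) + (\<Sum>i\<in>{n..<N}. \<Sum>m<n. c b i m * c d i m)"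
      by (rule split)
    also have "(\<Sum>i\<in>{n..<N}. \<Sum>m<n. c b i m * c d i m) = (\<Sum>i\<in>{n..<N}. \<Sum>m<n. c i b m * c i d m)"
    proof (intro sum.cong refl)
      fix i m assume "i \<in> {n..<N}" "m \<in> {..<n}"
      then have im: "i < N" "m < N" using nN by auto
      show "c b i m * c d i m = c i b m * c i d m"
        unfolding anti[OF im(1) bN im(2)] anti[OF im(1) dN im(2)] by simp
    qed
    finally show ?thesis .
  qed
  have 3: "(\<Sum>a<N. \<Sum>m<N. c b a m * c d m a) = 0"
  proof -
    have "(\<Sum>a<N. \<Sum>m<N. c b a m * c d m a) = (\<Sum>a<N. \<Sum>m<n. c b a m * c d m a)"
      using im bN by (intro sum.cong refl split0) auto
    also have "\<dots> = (\<Sum>a<n. \<Sum>m<n. c b a m * c d m a)"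
      using im dN nN by (intro split0 sum.neutral) auto
    finally show ?thesis using killing[OF b d] by simp
  qed
  have 4: "(\<Sum>a<N. \<Sum>m<N. c a m b * c a m d)
      = (\<Sum>i<n. \<Sum>j<n. c i j b * c i j d) + 2 * (\<Sum>i\<in>{n..<N}. \<Sum>m<n. c i m b * c i m d)"
  proof -
    have "(\<Sum>i\<in>{n..<N}. \<Sum>j\<in>{n..<N}. c i j b * c i j d) = 0"
      using abelian bN by (intro sum.neutral ballI) simp
    moreover
    have "(\<Sum>a<n. \<Sum>m\<in>{n..<N}. c a m b * c a m d) = (\<Sum>m\<in>{n..<N}. \<Sum>a<n. c a m b * c a m d)"
      by (rule sum.swap)
    moreover have "\<dots> = (\<Sum>m\<in>{n..<N}. \<Sum>a<n. c m a b * c m a d)"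
    proof (intro sum.cong refl)
      fix m a assume "m \<in> {n..<N}" "a \<in> {..<n}"
      then have ma: "m < N" "a < N" using nN by auto
      show "c a m b * c a m d = c m a b * c m a d"
        unfolding anti[OF ma bN] anti[OF ma dN] by simp
    qed
    ultimately show ?thesis unfolding split by (simp add: sum.distrib)
  qed
  show ?thesis
    unfolding ricci_coeff_def 1 2 3 4 nil_ricci_def sum_subtractf
    by (simp add: add_divide_distrib diff_divide_distrib)
qed

subsection \<open>The derivation action on structure constants\<close>

text \<open>
  The derivative at the identity of the action of the general linear group on brackets:
  \<open>T [x, y] - [T x, y] - [x, T y]\<close> in coordinates. It vanishes exactly if \<open>T\<close> is a derivation.
\<close>

definition act :: "nat \<Rightarrow> (nat \<Rightarrow> nat \<Rightarrow> real) \<Rightarrow> (nat \<Rightarrow> nat \<Rightarrow> nat \<Rightarrow> real) \<Rightarrow> nat \<Rightarrow> nat \<Rightarrow> nat \<Rightarrow> real" where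
  "act n T u i j k =
     (\<Sum>m<n. T k m * u i j m) - (\<Sum>m<n. T m i * u m j k) - (\<Sum>m<n. T m j * u i m k)"

definition tensor_inner :: "nat \<Rightarrow> (nat \<Rightarrow> nat \<Rightarrow> nat \<Rightarrow> real) \<Rightarrow> (nat \<Rightarrow> nat \<Rightarrow> nat \<Rightarrow> real) \<Rightarrow> real" where
  "tensor_inner n u v = (\<Sum>i<n. \<Sum>j<n. \<Sum>k<n. u i j k * v i j k)"

definition commutator :: "nat \<Rightarrow> (nat \<Rightarrow> nat \<Rightarrow> real) \<Rightarrow> (nat \<Rightarrow> nat \<Rightarrow> real) \<Rightarrow> nat \<Rightarrow> nat \<Rightarrow> real" where
  "commutator n T U a b = (\<Sum>m<n. T a m * U m b) - (\<Sum>m<n. U a m * T m b)"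

abbreviation (input) transposed :: "(nat \<Rightarrow> nat \<Rightarrow> real) \<Rightarrow> nat \<Rightarrow> nat \<Rightarrow> real" where
  "transposed T \<equiv> \<lambda>a b. T b a"

lemma sum_rotate:
  fixes h :: "nat \<Rightarrow> nat \<Rightarrow> nat \<Rightarrow> real"
  shows "(\<Sum>i<n. \<Sum>j<n. \<Sum>k<n. h i j k) = (\<Sum>j<n. \<Sum>k<n. \<Sum>i<n. h i j k)"
proof -
  have "(\<Sum>i<n. \<Sum>j<n. \<Sum>k<n. h i j k) = (\<Sum>j<n. \<Sum>i<n. \<Sum>k<n. h i j k)" by (rule sum.swap)
  also have "\<dots> = (\<Sum>j<n. \<Sum>k<n. \<Sum>i<n. h i j k)" by (rule sum.cong[OF refl]) (rule sum.swap)
  finally show ?thesis .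
qed

lemma sum_move:
  fixes f v :: "nat \<Rightarrow> real" and T :: "nat \<Rightarrow> nat \<Rightarrow> real"
  shows "(\<Sum>k<n. (\<Sum>m<n. T k m * f m) * v k) = (\<Sum>k<n. f k * (\<Sum>m<n. T m k * v m))"
proof -
  have "(\<Sum>k<n. (\<Sum>m<n. T k m * f m) * v k) = (\<Sum>k<n. \<Sum>m<n. f m * (T k m * v k))"
    unfolding sum_distrib_right by (intro sum.cong refl) (simp only: ac_simps)
  also have "\<dots> = (\<Sum>m<n. \<Sum>k<n. f m * (T k m * v k))" by (rule sum.swap)
  finally show ?thesis by (simp add: sum_distrib_left)
qed

text \<open>
  Each of the three terms moves one index by \<open>T\<close>, and moving that index in the other factor instead
  transposes \<open>T\<close>.
\<close>

lemma act_adjoint: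
  "tensor_inner n (act n T u) v = tensor_inner n u (act n (transposed T) v)"
proof -
  have 1: "(\<Sum>i<n. \<Sum>j<n. \<Sum>k<n. (\<Sum>m<n. T k m * u i j m) * v i j k)
      = (\<Sum>i<n. \<Sum>j<n. \<Sum>k<n. u i j k * (\<Sum>m<n. T m k * v i j m))"
    by (rule sum.cong[OF refl], rule sum.cong[OF refl]) (rule sum_move)
  have "(\<Sum>i<n. \<Sum>j<n. \<Sum>k<n. (\<Sum>m<n. T m i * u m j k) * v i j k)
      = (\<Sum>j<n. \<Sum>k<n. \<Sum>i<n. (\<Sum>m<n. T m i * u m j k) * v i j k)" by (rule sum_rotate)
  also have "\<dots> = (\<Sum>j<n. \<Sum>k<n. \<Sum>i<n. u i j k * (\<Sum>m<n. T i m * v m j k))"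
    by (rule sum.cong[OF refl], rule sum.cong[OF refl]) (rule sum_move)
  also have "\<dots> = (\<Sum>i<n. \<Sum>j<n. \<Sum>k<n. u i j k * (\<Sum>m<n. T i m * v m j k))"
    by (rule sum_rotate[symmetric])
  finally have 2: "(\<Sum>i<n. \<Sum>j<n. \<Sum>k<n. (\<Sum>m<n. T m i * u m j k) * v i j k)
      = (\<Sum>i<n. \<Sum>j<n. \<Sum>k<n. u i j k * (\<Sum>m<n. T i m * v m j k))" .
  have 3: "(\<Sum>i<n. \<Sum>j<n. \<Sum>k<n. (\<Sum>m<n. T m j * u i m k) * v i j k)
      = (\<Sum>i<n. \<Sum>j<n. \<Sum>k<n. u i j k * (\<Sum>m<n. T j m * v i m k))"
  proof (rule sum.cong[OF refl])
    fix i
    have "(\<Sum>j<n. \<Sum>k<n. (\<Sum>m<n. T m j * u i m k) * v i j k)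
      = (\<Sum>k<n. \<Sum>j<n. (\<Sum>m<n. T m j * u i m k) * v i j k)" by (rule sum.swap)
    also have "\<dots> = (\<Sum>k<n. \<Sum>j<n. u i j k * (\<Sum>m<n. T j m * v i m k))"
      by (rule sum.cong[OF refl]) (rule sum_move)
    also have "\<dots> = (\<Sum>j<n. \<Sum>k<n. u i j k * (\<Sum>m<n. T j m * v i m k))" by (rule sum.swap)
    finally show "(\<Sum>j<n. \<Sum>k<n. (\<Sum>m<n. T m j * u i m k) * v i j k)
      = (\<Sum>j<n. \<Sum>k<n. u i j k * (\<Sum>m<n. T j m * v i m k))" .
  qed
  show ?thesis
    unfolding tensor_inner_def act_def left_diff_distrib right_diff_distrib sum_subtractf 1 2 3 ..
qed

text \<open>
  The actions on different indices commute, so only the three products on equal indices survive.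
\<close>

lemma act_commutator:
  "act n (commutator n T U) u i j k = act n T (act n U u) i j k - act n U (act n T u) i j k"
proof -
  define a1 where "a1 T u i j k = (\<Sum>m<n. T k m * u i j m)"
    for T :: "nat \<Rightarrow> nat \<Rightarrow> real" and u :: "nat \<Rightarrow> nat \<Rightarrow> nat \<Rightarrow> real" and i j k
  define a2 where "a2 T u i j k = (\<Sum>m<n. T m i * u m j k)"
    for T :: "nat \<Rightarrow> nat \<Rightarrow> real" and u :: "nat \<Rightarrow> nat \<Rightarrow> nat \<Rightarrow> real" and i j k
  define a3 where "a3 T u i j k = (\<Sum>m<n. T m j * u i m k)"
    for T :: "nat \<Rightarrow> nat \<Rightarrow> real" and u :: "nat \<Rightarrow> nat \<Rightarrow> nat \<Rightarrow> real" and i j k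
  have act: "act n T u i j k = a1 T u i j k - a2 T u i j k - a3 T u i j k" for T u i j k
    unfolding act_def a1_def a2_def a3_def ..
  have swap: "(\<Sum>m<n. x m * (\<Sum>l<n. y l * f m l)) = (\<Sum>l<n. y l * (\<Sum>m<n. x m * f m l))"
    for x y :: "nat \<Rightarrow> real" and f :: "nat \<Rightarrow> nat \<Rightarrow> real"
    unfolding sum_distrib_left by (subst sum.swap) (simp only: ac_simps)
  have comm: "a1 T (a2 U u) i j k = a2 U (a1 T u) i j k" "a1 T (a3 U u) i j k = a3 U (a1 T u) i j k"
    "a2 T (a3 U u) i j k = a3 U (a2 T u) i j k" for T U u i j k
    unfolding a1_def a2_def a3_def by (rule swap)+
  have expand: "act n T (act n U u) i j k =
      a1 T (a1 U u) i j k - a1 T (a2 U u) i j k - a1 T (a3 U u) i j k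
    - (a2 T (a1 U u) i j k - a2 T (a2 U u) i j k - a2 T (a3 U u) i j k)
    - (a3 T (a1 U u) i j k - a3 T (a2 U u) i j k - a3 T (a3 U u) i j k)" for T U
    unfolding act[of T] unfolding a1_def[of T] a2_def[of T] a3_def[of T]
    unfolding act right_diff_distrib sum_subtractf ..
  have prod: "(\<Sum>m<n. (\<Sum>l<n. P l * Q l m) * f m) = (\<Sum>l<n. P l * (\<Sum>m<n. Q l m * f m))"
    for P f :: "nat \<Rightarrow> real" and Q :: "nat \<Rightarrow> nat \<Rightarrow> real"
    unfolding sum_distrib_left sum_distrib_right by (subst sum.swap) (simp only: mult.assoc)
  have prod': "(\<Sum>m<n. (\<Sum>l<n. Q m l * P l) * f m) = (\<Sum>l<n. P l * (\<Sum>m<n. Q m l * f m))"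
    for P f :: "nat \<Rightarrow> real" and Q :: "nat \<Rightarrow> nat \<Rightarrow> real"
    using prod[where P = P and Q = "\<lambda>l m. Q m l" and f = f] by (simp only: mult.commute)
  have "a1 (commutator n T U) u i j k = a1 T (a1 U u) i j k - a1 U (a1 T u) i j k"
    unfolding commutator_def a1_def left_diff_distrib sum_subtractf
    by (intro arg_cong2[where f = minus]; rule prod)
  moreover have "a2 (commutator n T U) u i j k = a2 U (a2 T u) i j k - a2 T (a2 U u) i j k"
    unfolding commutator_def a2_def left_diff_distrib sum_subtractf
    by (intro arg_cong2[where f = minus]; rule prod')
  moreover have "a3 (commutator n T U) u i j k = a3 U (a3 T u) i j k - a3 T (a3 U u) i j k"
    unfolding commutator_def a3_def left_diff_distrib sum_subtractf
    by (intro arg_cong2[where f = minus]; rule prod')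
  ultimately show ?thesis unfolding act[of "commutator n T U"] expand comm by simp
qed

lemma act_zero:
  assumes "\<And>i j k. i < n \<Longrightarrow> j < n \<Longrightarrow> k < n \<Longrightarrow> u i j k = 0" "i < n" "j < n" "k < n"
  shows "act n T u i j k = 0"
  unfolding act_def using assms by (simp add: sum.neutral)

text \<open>
  The Ricci tensor is the moment map of the action on brackets. In particular it is orthogonal to all
  derivations.
\<close>

lemma nil_ricci_act:
  assumes anti: "\<And>a b k. a < n \<Longrightarrow> b < n \<Longrightarrow> k < n \<Longrightarrow> c b a k = - c a b k"
  shows "(\<Sum>a<n. \<Sum>b<n. nil_ricci n c a b * T a b) = tensor_inner n c (act n T c) / 4"
proof -
  have 1: "(\<Sum>i<n. \<Sum>j<n. \<Sum>k<n. c i j k * (\<Sum>m<n. T k m * c i j m))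
      = (\<Sum>a<n. \<Sum>b<n. (\<Sum>i<n. \<Sum>j<n. c i j a * c i j b) * T a b)"
  proof -
    have "(\<Sum>i<n. \<Sum>j<n. \<Sum>k<n. c i j k * (\<Sum>m<n. T k m * c i j m))
        = (\<Sum>k<n. \<Sum>i<n. \<Sum>j<n. \<Sum>m<n. c i j k * (T k m * c i j m))"
      unfolding sum_distrib_left by (rule sum_rotate[symmetric])
    also have "\<dots> = (\<Sum>k<n. \<Sum>m<n. \<Sum>i<n. \<Sum>j<n. c i j k * (T k m * c i j m))"
      by (rule sum.cong[OF refl]) (rule sum_rotate[symmetric])
    finally show ?thesis unfolding sum_distrib_right by (simp only: ac_simps)
  qed
  have 2: "(\<Sum>i<n. \<Sum>j<n. \<Sum>k<n. c i j k * (\<Sum>m<n. T m i * c m j k))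
      = (\<Sum>a<n. \<Sum>b<n. (\<Sum>i<n. \<Sum>j<n. c a i j * c b i j) * T a b)"
  proof -
    have "(\<Sum>i<n. \<Sum>j<n. \<Sum>k<n. c i j k * (\<Sum>m<n. T m i * c m j k))
        = (\<Sum>i<n. \<Sum>m<n. \<Sum>j<n. \<Sum>k<n. c i j k * (T m i * c m j k))"
      unfolding sum_distrib_left by (rule sum.cong[OF refl]) (rule sum_rotate[symmetric])
    also have "\<dots> = (\<Sum>m<n. \<Sum>i<n. \<Sum>j<n. \<Sum>k<n. c i j k * (T m i * c m j k))" by (rule sum.swap)
    finally show ?thesis unfolding sum_distrib_right by (simp only: ac_simps)
  qed
  have 3: "(\<Sum>i<n. \<Sum>j<n. \<Sum>k<n. c i j k * (\<Sum>m<n. T m j * c i m k))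
      = (\<Sum>i<n. \<Sum>j<n. \<Sum>k<n. c i j k * (\<Sum>m<n. T m i * c m j k))"
  proof -
    have "(\<Sum>i<n. \<Sum>j<n. \<Sum>k<n. c i j k * (\<Sum>m<n. T m j * c i m k))
        = (\<Sum>j<n. \<Sum>i<n. \<Sum>k<n. c i j k * (\<Sum>m<n. T m j * c i m k))" by (rule sum.swap)
    also have "\<dots> = (\<Sum>j<n. \<Sum>i<n. \<Sum>k<n. c j i k * (\<Sum>m<n. T m j * c m i k))"
    proof (intro sum.cong refl)
      fix i j k assume "i \<in> {..<n}" "j \<in> {..<n}" "k \<in> {..<n}"
      then have r: "i < n" "j < n" "k < n" by auto
      have "(\<Sum>m<n. T m j * c i m k) = (\<Sum>m<n. - (T m j * c m i k))"
      proof (intro sum.cong refl)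
        fix m assume "m \<in> {..<n}"
        then have "c i m k = - c m i k" using anti r by blast
        then show "T m j * c i m k = - (T m j * c m i k)" by simp
      qed
      then show "c i j k * (\<Sum>m<n. T m j * c i m k) = c j i k * (\<Sum>m<n. T m j * c m i k)"
        using anti[OF r(2,1,3)] by (simp add: sum_negf)
    qed
    finally show ?thesis .
  qed
  show ?thesis
    unfolding tensor_inner_def act_def right_diff_distrib sum_subtractf 3 1 2
    unfolding nil_ricci_def left_diff_distrib sum_subtractf
    by (simp add: sum_divide_distrib[symmetric] diff_divide_distrib)
qed

subsection \<open>From the Einstein equation to the nilsoliton equation\<close>

text \<open>
  Let \<open>R i\<close> be the action of \<open>(A i)\<^sup>t\<close> on the bracket. Since \<open>A i\<close> is a derivation, the inner product of
  the Ricci tensor with \<open>[A i, (A i)\<^sup>t]\<close> is \<open>1/4\<close> of the square of the norm of \<open>R i\<close>. The symmetric part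
  of \<open>ad H\<close> is orthogonal to these commutators because the \<open>A i\<close> commute, and the identity is so because
  commutators have trace 0. So the inner product of the Einstein equation with the sum of the
  commutators says that a sum of squares is 0.
\<close>

lemma nilsoliton_structure_constants:
  fixes A :: "'i \<Rightarrow> nat \<Rightarrow> nat \<Rightarrow> real"
  assumes I: "finite I"
    and anti: "\<And>a b k. a < n \<Longrightarrow> b < n \<Longrightarrow> k < n \<Longrightarrow> c b a k = - c a b k"
    and der: "\<And>i a b k. i \<in> I \<Longrightarrow> a < n \<Longrightarrow> b < n \<Longrightarrow> k < n \<Longrightarrow> act n (A i) c a b k = 0"
    and comm: "\<And>i j a b. i \<in> I \<Longrightarrow> j \<in> I \<Longrightarrow> a < n \<Longrightarrow> b < n \<Longrightarrow>
      (\<Sum>m<n. A i a m * A j m b) = (\<Sum>m<n. A j a m * A i m b)"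
    and S: "\<And>a b. S a b = (\<Sum>i\<in>I. h i * (A i a b + A i b a)) / 2"
    and einstein: "\<And>a b. a < n \<Longrightarrow> b < n \<Longrightarrow>
      nil_ricci n c a b + (\<Sum>i\<in>I. commutator n (A i) (transposed (A i)) a b) / 2 - S a b
      = (if a = b then \<kappa> else 0)"
    and r: "a < n" "b < n"
  shows "nil_ricci n c a b = (if a = b then \<kappa> else 0) + S a b"
    and "k < n \<Longrightarrow> act n S c a b k = 0"
proof -
  define E where "E i = commutator n (A i) (transposed (A i))" for i
  define R where "R i = act n (transposed (A i)) c" for i
  define Es where "Es a b = (\<Sum>i\<in>I. E i a b)" for a b
  have ricci_E: "(\<Sum>a<n. \<Sum>b<n. nil_ricci n c a b * E i a b) = tensor_inner n (R i) (R i) / 4"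
    if i: "i \<in> I" for i
  proof -
    have "act n (E i) c a b k = act n (A i) (R i) a b k" if "a < n" "b < n" "k < n" for a b k
      unfolding E_def act_commutator R_def using act_zero[OF der[OF i]] that by simp
    then have "tensor_inner n c (act n (E i) c) = tensor_inner n c (act n (A i) (R i))"
      unfolding tensor_inner_def by (intro sum.cong) auto
    also have "\<dots> = tensor_inner n (R i) (R i)"
      using act_adjoint[of n "transposed (A i)" c "R i"] unfolding R_def by simp
    finally show ?thesis using nil_ricci_act[of n c "E i", OF anti] by simp
  qed
  have E_sym: "E i a b = E i b a" for i a b
    unfolding E_def commutator_def by (simp add: mult.commute)
  \<comment> \<open>Cyclicity of the trace and \<open>[A i, A j] = 0\<close>.\<close>
  have A_E: "(\<Sum>a<n. \<Sum>b<n. A i a b * E j a b) = 0" if ij: "i \<in> I" "j \<in> I" for i j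
  proof -
    have "(\<Sum>a<n. \<Sum>b<n. A i a b * (\<Sum>m<n. A j a m * A j b m))
        = (\<Sum>a<n. \<Sum>m<n. A j a m * (\<Sum>b<n. A i a b * A j b m))"
      unfolding sum_distrib_left
      by (rule sum.cong[OF refl], subst sum.swap) (simp only: ac_simps)
    also have "\<dots> = (\<Sum>a<n. \<Sum>m<n. A j a m * (\<Sum>b<n. A j a b * A i b m))"
      using comm[OF ij] by (intro sum.cong refl) simp
    also have "\<dots> = (\<Sum>b<n. \<Sum>m<n. A i b m * (\<Sum>a<n. A j a b * A j a m))"
      unfolding sum_distrib_left
      by (subst sum_rotate, subst sum.swap) (simp only: ac_simps)
    finally show ?thesis
      unfolding E_def commutator_def right_diff_distrib sum_subtractf by simp
  qed
  have S_Es: "(\<Sum>a<n. \<Sum>b<n. S a b * Es a b) = 0"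
  proof -
    have A_Es: "(\<Sum>a<n. \<Sum>b<n. A i a b * Es a b) = 0" if "i \<in> I" for i
    proof -
      have "(\<Sum>a<n. \<Sum>b<n. A i a b * Es a b) = (\<Sum>j\<in>I. \<Sum>a<n. \<Sum>b<n. A i a b * E j a b)"
        unfolding Es_def sum_distrib_left
        by (simp only: sum.swap[of _ I])
      then show ?thesis using A_E[OF that] by simp
    qed
    have A_Es': "(\<Sum>a<n. \<Sum>b<n. A i b a * Es a b) = 0" if "i \<in> I" for i
    proof -
      have "(\<Sum>a<n. \<Sum>b<n. A i b a * Es a b) = (\<Sum>b<n. \<Sum>a<n. A i b a * Es a b)" by (rule sum.swap)
      also have "\<dots> = (\<Sum>b<n. \<Sum>a<n. A i b a * Es b a)"
        unfolding Es_def using E_sym by (intro sum.cong refl) (metis (mono_tags, lifting) sum.cong)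
      finally show ?thesis using A_Es[OF that] by simp
    qed
    have "(\<Sum>a<n. \<Sum>b<n. S a b * Es a b)
        = (\<Sum>a<n. \<Sum>b<n. \<Sum>i\<in>I. h i / 2 * (A i a b * Es a b + A i b a * Es a b))"
      unfolding S sum_divide_distrib sum_distrib_right by (intro sum.cong refl) (simp add: field_simps)
    also have "\<dots> = (\<Sum>i\<in>I. \<Sum>a<n. \<Sum>b<n. h i / 2 * (A i a b * Es a b + A i b a * Es a b))"
      by (simp only: sum.swap[of _ I])
    also have "\<dots> = 0"
    proof (rule sum.neutral, rule ballI)
      fix i assume i: "i \<in> I"
      show "(\<Sum>a<n. \<Sum>b<n. h i / 2 * (A i a b * Es a b + A i b a * Es a b)) = 0"
        unfolding sum_distrib_left[symmetric] sum.distrib A_Es[OF i] A_Es'[OF i] by simp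
    qed
    finally show ?thesis .
  qed
  have tr_Es: "(\<Sum>a<n. Es a a) = 0"
  proof -
    have "(\<Sum>a<n. E i a a) = 0" for i
      unfolding E_def commutator_def sum_subtractf using sum.swap[of "\<lambda>a m. A i a m * A i a m" "{..<n}" "{..<n}"]
      by simp
    then show ?thesis unfolding Es_def by (subst sum.swap) simp
  qed
  have ricci_Es: "(\<Sum>a<n. \<Sum>b<n. nil_ricci n c a b * Es a b) = (\<Sum>i\<in>I. tensor_inner n (R i) (R i)) / 4"
  proof -
    have "(\<Sum>a<n. \<Sum>b<n. nil_ricci n c a b * Es a b) = (\<Sum>i\<in>I. \<Sum>a<n. \<Sum>b<n. nil_ricci n c a b * E i a b)"
      unfolding Es_def sum_distrib_left by (simp only: sum.swap[of _ I])
    then show ?thesis using ricci_E by (simp add: sum_divide_distrib)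
  qed
  have "(\<Sum>a<n. \<Sum>b<n. (nil_ricci n c a b + Es a b / 2 - S a b) * Es a b)
      = (\<Sum>a<n. \<Sum>b<n. if a = b then \<kappa> * Es a b else 0)"
    using einstein unfolding Es_def E_def by (intro sum.cong refl) simp
  also have "\<dots> = \<kappa> * (\<Sum>a<n. Es a a)" by (simp add: sum_distrib_left)
  finally have "(\<Sum>i\<in>I. tensor_inner n (R i) (R i)) / 4 + (\<Sum>a<n. \<Sum>b<n. Es a b * Es a b) / 2 = 0"
    using ricci_Es S_Es tr_Es
    by (simp add: left_diff_distrib distrib_right sum_subtractf sum.distrib sum_divide_distrib)
  moreover have nn: "tensor_inner n (R i) (R i) \<ge> 0" for i
    unfolding tensor_inner_def by (intro sum_nonneg) simp
  moreover have "(\<Sum>a<n. \<Sum>b<n. Es a b * Es a b) \<ge> 0" by (intro sum_nonneg) simp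
  moreover have "(\<Sum>i\<in>I. tensor_inner n (R i) (R i)) \<ge> 0" using nn by (intro sum_nonneg)
  ultimately have sq: "(\<Sum>i\<in>I. tensor_inner n (R i) (R i)) = 0" "(\<Sum>a<n. \<Sum>b<n. Es a b * Es a b) = 0"
    by linarith+
  have Es0: "Es a b = 0" if "a < n" "b < n" for a b
  proof -
    have "(\<Sum>b<n. Es a b * Es a b) = 0"
      by (rule sum_nonneg_0[OF _ _ sq(2)]) (use that in \<open>auto intro: sum_nonneg\<close>)
    from sum_nonneg_0[OF _ _ this, of b] show ?thesis using that by simp
  qed
  then show "nil_ricci n c a b = (if a = b then \<kappa> else 0) + S a b"
    using einstein[OF r] r unfolding Es_def E_def by simp
  have R0: "R i a b k = 0" if "i \<in> I" "a < n" "b < n" "k < n" for i a b k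
  proof -
    have "tensor_inner n (R i) (R i) = 0" by (rule sum_nonneg_0[OF I nn sq(1) that(1)])
    then have 1: "(\<Sum>a<n. \<Sum>b<n. \<Sum>k<n. R i a b k * R i a b k) = 0" unfolding tensor_inner_def .
    have 2: "(\<Sum>b<n. \<Sum>k<n. R i a b k * R i a b k) = 0"
      by (rule sum_nonneg_0[OF _ _ 1]) (use that in \<open>auto intro!: sum_nonneg\<close>)
    have 3: "(\<Sum>k<n. R i a b k * R i a b k) = 0"
      by (rule sum_nonneg_0[OF _ _ 2]) (use that in \<open>auto intro!: sum_nonneg\<close>)
    from sum_nonneg_0[OF _ _ 3, of k] show ?thesis using that by simp
  qed
  show "act n S c a b k = 0" if "k < n"
  proof -
    have lin: "(\<Sum>m<n. S (f m) (g m) * u m)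
        = (\<Sum>i\<in>I. h i / 2 * ((\<Sum>m<n. A i (f m) (g m) * u m) + (\<Sum>m<n. A i (g m) (f m) * u m)))" for f g u
    proof -
      have "(\<Sum>m<n. S (f m) (g m) * u m)
          = (\<Sum>m<n. \<Sum>i\<in>I. h i / 2 * (A i (f m) (g m) * u m + A i (g m) (f m) * u m))"
        unfolding S sum_divide_distrib sum_distrib_right by (intro sum.cong refl) (simp add: field_simps)
      also have "\<dots> = (\<Sum>i\<in>I. \<Sum>m<n. h i / 2 * (A i (f m) (g m) * u m + A i (g m) (f m) * u m))"
        by (rule sum.swap)
      finally show ?thesis unfolding sum_distrib_left[symmetric] sum.distrib .
    qed
    have "act n S c a b k = (\<Sum>i\<in>I. h i / 2 * (act n (A i) c a b k + R i a b k))"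
      unfolding act_def R_def
        lin[of "\<lambda>m. k" "\<lambda>m. m"] lin[of "\<lambda>m. m" "\<lambda>m. a"] lin[of "\<lambda>m. m" "\<lambda>m. b"]
        right_diff_distrib distrib_left sum_subtractf sum.distrib
      by simp
    also have "\<dots> = 0" using der R0 r that by (intro sum.neutral) simp
    finally show ?thesis .
  qed
qed

subsection \<open>Derivations in an orthonormal frame\<close>

definition derivation :: "nat \<Rightarrow> (real vec \<Rightarrow> real vec \<Rightarrow> real vec) \<Rightarrow> (real vec \<Rightarrow> real vec) \<Rightarrow> bool" where
  "derivation n br T \<longleftrightarrow> linear_vec n n T \<and>
     (\<forall>x\<in>carrier_vec n. \<forall>y\<in>carrier_vec n. T (br x y) = br (T x) y + br x (T y))"

lemma act_frame:
  assumes g: "inner_product n g" and L: "lie_algebra n br" and F: "orthonormal_frame n g F"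
    and T: "linear_vec n n T" and r: "i < n" "j < n" "k < n"
  shows "act n (\<lambda>a b. g (T (F b)) (F a)) (structure_constants br g F) i j k =
    g (T (br (F i) (F j))) (F k) - g (br (T (F i)) (F j)) (F k) - g (br (F i) (T (F j))) (F k)"
proof -
  note Fc = orthonormal_frameD(1)[OF F] and B = lie_algebraD(1)[OF L]
  note b = bilinear_vecD(1)[OF B] and ex = inner_linear_frame[OF g F]
  show ?thesis
    unfolding act_def structure_constants_def
    using ex[OF T b[OF Fc[OF r(1)] Fc[OF r(2)]] Fc[OF r(3)]]
      ex[OF linear_vec_bracket(2)[OF B Fc[OF r(2)]] linear_vecD(1)[OF T Fc[OF r(1)]] Fc[OF r(3)]]
      ex[OF linear_vec_bracket(1)[OF B Fc[OF r(1)]] linear_vecD(1)[OF T Fc[OF r(2)]] Fc[OF r(3)]]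
    by (simp add: mult.commute)
qed

text \<open>
  Links the coordinate-free notion, which can be evaluated in the basis of the graph, with the action on
  structure constants in an orthonormal frame.
\<close>

lemma derivation_iff_act:
  assumes g: "inner_product n g" and L: "lie_algebra n br" and F: "orthonormal_frame n g F"
    and T: "linear_vec n n T"
  shows "derivation n br T \<longleftrightarrow>
    (\<forall>i<n. \<forall>j<n. \<forall>k<n. act n (\<lambda>a b. g (T (F b)) (F a)) (structure_constants br g F) i j k = 0)"
proof
  note Fc = orthonormal_frameD(1)[OF F] and B = lie_algebraD(1)[OF L]
  note b = bilinear_vecD(1)[OF B] and Tc = linear_vecD(1)[OF T]
  show "derivation n br T \<Longrightarrow>
    \<forall>i<n. \<forall>j<n. \<forall>k<n. act n (\<lambda>a b. g (T (F b)) (F a)) (structure_constants br g F) i j k = 0"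
    using act_frame[OF g L F T] Fc b Tc unfolding derivation_def by (simp add: inner_productD(1)[OF g])
  assume z: "\<forall>i<n. \<forall>j<n. \<forall>k<n. act n (\<lambda>a b. g (T (F b)) (F a)) (structure_constants br g F) i j k = 0"
  define \<Phi> where "\<Phi> z x y = g (T (br x y)) z - g (br (T x) y) z - g (br x (T y)) z" for x y z
  have lin1: "linear_form n (\<lambda>x. \<Phi> z x y)" if "y \<in> carrier_vec n" "z \<in> carrier_vec n" for y z
    unfolding \<Phi>_def
    by (intro linear_form_diff linear_form_inner(1)[OF g _ that(2)]
        linear_vec_comp[OF linear_vec_bracket(2)[OF B that(1)] T]
        linear_vec_comp[OF T linear_vec_bracket(2)[OF B that(1)]]
        linear_vec_bracket(2)[OF B Tc[OF that(1)]])
  have lin2: "linear_form n (\<lambda>y. \<Phi> z x y)" if "x \<in> carrier_vec n" "z \<in> carrier_vec n" for x z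
    unfolding \<Phi>_def
    by (intro linear_form_diff linear_form_inner(1)[OF g _ that(2)]
        linear_vec_comp[OF linear_vec_bracket(1)[OF B that(1)] T]
        linear_vec_comp[OF T linear_vec_bracket(1)[OF B that(1)]]
        linear_vec_bracket(1)[OF B Tc[OF that(1)]])
  have "\<Phi> (F k) (F i) (F j) = 0" if "i < n" "j < n" "k < n" for i j k
    using act_frame[OF g L F T that] z that unfolding \<Phi>_def by simp
  then have "\<Phi> (F k) (F i) y = 0" if "i < n" "k < n" "y \<in> carrier_vec n" for i k y
    using linear_form_vanishes[OF F lin2[OF Fc[OF that(1)] Fc[OF that(2)]] _ that(3)] that by blast
  then have \<Phi>0: "\<Phi> (F k) x y = 0" if "k < n" "x \<in> carrier_vec n" "y \<in> carrier_vec n" for k x y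
    using linear_form_vanishes[OF F lin1[OF that(3) Fc[OF that(1)]] _ that(2)] that by blast
  have "T (br x y) = br (T x) y + br x (T y)" if c: "x \<in> carrier_vec n" "y \<in> carrier_vec n" for x y
  proof (rule frame_vec_eqI[OF g F])
    show "T (br x y) \<in> carrier_vec n" "br (T x) y + br x (T y) \<in> carrier_vec n"
      using c b Tc by auto
    fix a assume a: "a < n"
    show "g (T (br x y)) (F a) = g (br (T x) y + br x (T y)) (F a)"
      using \<Phi>0[OF a c] c b Tc Fc[OF a] unfolding \<Phi>_def by (simp add: inner_productD(1)[OF g])
  qed
  then show "derivation n br T" unfolding derivation_def using T by blast
qed

lemma linear_vec_of_matrix:
  fixes S :: "nat \<Rightarrow> nat \<Rightarrow> real"
  assumes g: "inner_product n g" and F: "orthonormal_frame n g F"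
  defines "T \<equiv> \<lambda>x. vec_comb n n (\<lambda>a. \<Sum>b<n. S a b * g x (F b)) F"
  shows "linear_vec n n T" and "x \<in> carrier_vec n \<Longrightarrow> a < n \<Longrightarrow> g (T x) (F a) = (\<Sum>b<n. S a b * g x (F b))"
proof -
  note Fc = orthonormal_frameD(1)[OF F]
  have Tc: "T x \<in> carrier_vec n" for x unfolding T_def by simp
  show gT: "g (T x) (F a) = (\<Sum>b<n. S a b * g x (F b))" if "x \<in> carrier_vec n" "a < n" for x a
  proof -
    have "g (T x) (F a) = (\<Sum>m<n. (\<Sum>b<n. S m b * g x (F b)) * g (F m) (F a))"
      unfolding T_def by (rule linear_form_vec_comb[OF linear_form_inner_vec(1)[OF g Fc[OF that(2)]] Fc])
    also have "\<dots> = (\<Sum>m<n. if m = a then \<Sum>b<n. S m b * g x (F b) else 0)"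
      using orthonormal_frameD(2)[OF F] that by (intro sum.cong refl) auto
    finally show ?thesis using that by simp
  qed
  show "linear_vec n n T"
    unfolding linear_vec_iff
  proof (intro conjI ballI allI)
    fix x :: "real vec" assume x: "x \<in> carrier_vec n"
    show "T x \<in> carrier_vec n" by fact
    show "T (k \<cdot>\<^sub>v x) = k \<cdot>\<^sub>v T x" for k
      using Tc x Fc
      by (intro frame_vec_eqI[OF g F])
        (auto simp: inner_productD(1,2)[OF g] gT sum_distrib_left ac_simps)
    fix y :: "real vec" assume y: "y \<in> carrier_vec n"
    show "T (x + y) = T x + T y"
      using Tc x y Fc
      by (intro frame_vec_eqI[OF g F])
        (auto simp: inner_productD(1,2)[OF g] gT sum.distrib distrib_left)
  qed
qed

lemma jacobi_form:
  assumes L: "lie_algebra n br" and \<phi>: "linear_form n \<phi>"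
    and c: "x \<in> carrier_vec n" "y \<in> carrier_vec n" "z \<in> carrier_vec n"
  shows "\<phi> (br x (br y z)) = \<phi> (br (br x y) z) + \<phi> (br y (br x z))"
proof -
  note B = lie_algebraD(1)[OF L]
  note b = bilinear_vecD[OF B]
  have "\<phi> (br x (br y z) + br y (br z x) + br z (br x y)) = 0"
    using lie_algebraD(3)[OF L c] linear_form_zero[OF \<phi>] by simp
  then have "\<phi> (br x (br y z)) + \<phi> (br y (br z x)) + \<phi> (br z (br x y)) = 0"
    using \<phi> b(1) c by (simp add: linear_form_add_vec)
  moreover have "\<phi> (br z (br x y)) = - \<phi> (br (br x y) z)"
    using linear_form_neg[OF \<phi> L b(1)[OF c(1,2)] c(3)] .
  moreover have "\<phi> (br y (br z x)) = - \<phi> (br y (br x z))"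
    using lie_antisym[OF L c(1,3)] b(1,5) c \<phi> unfolding linear_form_def by simp
  ultimately show ?thesis by linarith
qed

text \<open>
  On a central vector \<open>z\<close> the second sum vanishes. So the Ricci tensor is positive at central vectors
  that are not orthogonal to the derived algebra.
\<close>

lemma nil_ricci_quadratic:
  "(\<Sum>a<n. \<Sum>b<n. nil_ricci n c a b * (z a * z b)) =
    (\<Sum>i<n. \<Sum>j<n. (\<Sum>a<n. z a * c i j a)\<^sup>2) / 4 - (\<Sum>i<n. \<Sum>j<n. (\<Sum>a<n. z a * c a i j)\<^sup>2) / 2"
proof -
  have sq: "(\<Sum>a<n. \<Sum>b<n. (\<Sum>i<n. \<Sum>j<n. f i j a * f i j b) * (z a * z b))
      = (\<Sum>i<n. \<Sum>j<n. (\<Sum>a<n. z a * f i j a)\<^sup>2)" for f :: "nat \<Rightarrow> nat \<Rightarrow> nat \<Rightarrow> real"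
  proof -
    have "(\<Sum>i<n. \<Sum>j<n. (\<Sum>a<n. z a * f i j a)\<^sup>2)
        = (\<Sum>i<n. \<Sum>j<n. \<Sum>a<n. \<Sum>b<n. (z a * f i j a) * (z b * f i j b))"
      unfolding power2_eq_square sum_product ..
    also have "\<dots> = (\<Sum>j<n. \<Sum>a<n. \<Sum>i<n. \<Sum>b<n. (z a * f i j a) * (z b * f i j b))"
      by (rule sum_rotate)
    also have "\<dots> = (\<Sum>a<n. \<Sum>j<n. \<Sum>i<n. \<Sum>b<n. (z a * f i j a) * (z b * f i j b))"
      by (rule sum.swap)
    also have "\<dots> = (\<Sum>a<n. \<Sum>b<n. \<Sum>j<n. \<Sum>i<n. (z a * f i j a) * (z b * f i j b))"
      by (rule sum.cong[OF refl]) (rule sum_rotate[symmetric])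
    also have "\<dots> = (\<Sum>a<n. \<Sum>b<n. \<Sum>i<n. \<Sum>j<n. (z a * f i j a) * (z b * f i j b))"
      by (rule sum.cong[OF refl], rule sum.cong[OF refl]) (rule sum.swap)
    finally show ?thesis unfolding sum_distrib_right by (simp only: ac_simps)
  qed
  show ?thesis
    unfolding nil_ricci_def left_diff_distrib sum_subtractf
    using sq[of c] sq[of "\<lambda>i j a. c a i j"] by (simp add: sum_divide_distrib[symmetric])
qed

text \<open>
  What the combinatorial argument draws from the Einstein extension. The two hypotheses on the bracket make the
  Killing form and the mean curvature vector along the nilradical vanish. The conclusion no longer
  mentions frames: its traces are taken in the standard basis.
\<close>

theorem einstein_extension_nilsoliton:
  assumes L: "lie_algebra n br" and g: "inner_product n g"
    and ext: "einstein_solvable_extension n br g N br' g' \<iota> \<aa>"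
    and two_step: "\<And>x y z. x \<in> carrier_vec n \<Longrightarrow> y \<in> carrier_vec n \<Longrightarrow> z \<in> carrier_vec n \<Longrightarrow> br x (br y z) = 0\<^sub>v n"
    and unimodular: "\<And>x. x \<in> carrier_vec n \<Longrightarrow> (\<Sum>r<n. br x (unit_vec n r) $ r) = 0"
  obtains \<kappa> S where "derivation n br S"
    "\<And>\<psi>. derivation n br \<psi> \<Longrightarrow> (\<Sum>r<n. S (\<psi> (unit_vec n r)) $ r) = - \<kappa> * (\<Sum>r<n. \<psi> (unit_vec n r) $ r)"
    "\<And>x y z. x \<in> carrier_vec n \<Longrightarrow> y \<in> carrier_vec n \<Longrightarrow> z \<in> carrier_vec n \<Longrightarrow> g (br x y) z \<noteq> 0 \<Longrightarrow>
      (\<And>u. u \<in> carrier_vec n \<Longrightarrow> br z u = 0\<^sub>v n) \<Longrightarrow> g (S z + \<kappa> \<cdot>\<^sub>v z) z > 0"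
proof -
  note E = ext[unfolded einstein_solvable_extension_def solvable_lie_algebra_def]
  have L': "lie_algebra N br'" and g': "inner_product N g'" and \<iota>: "linear_vec n N \<iota>" using E by auto
  have \<iota>br: "br' (\<iota> x) (\<iota> y) = \<iota> (br x y)" if "x \<in> carrier_vec n" "y \<in> carrier_vec n" for x y using E that by auto
  have \<iota>g: "g' (\<iota> x) (\<iota> y) = g x y" if "x \<in> carrier_vec n" "y \<in> carrier_vec n" for x y using E that by auto
  have A: "vec_subspace N \<aa>"
    and dec: "\<And>z. z \<in> carrier_vec N \<Longrightarrow> \<exists>x\<in>\<aa>. \<exists>y\<in>\<iota> ` carrier_vec n. z = x + y"
    and orth: "\<And>x y. x \<in> \<aa> \<Longrightarrow> y \<in> \<iota> ` carrier_vec n \<Longrightarrow> g' x y = 0"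
    and der_alg: "bracket_span N br' (carrier_vec N) (carrier_vec N) = \<iota> ` carrier_vec n"
    and abel: "\<And>x y. x \<in> \<aa> \<Longrightarrow> y \<in> \<aa> \<Longrightarrow> br' x y = 0\<^sub>v N"
    using E by auto
  have "left_invariant_einstein N br' g'" using E by simp
  then obtain D \<kappa> where D: "levi_civita N br' g' D"
    and ric: "\<And>X Y. X \<in> carrier_vec N \<Longrightarrow> Y \<in> carrier_vec N \<Longrightarrow> ricci_curvature N br' D X Y = \<kappa> * g' X Y"
    unfolding left_invariant_einstein_def by blast
  obtain f F where f: "orthonormal_frame n g f" and F: "orthonormal_frame N g' F" and nN: "n \<le> N"
    and Ff: "\<And>a. a < n \<Longrightarrow> F a = \<iota> (f a)" and FA: "\<And>a. n \<le> a \<Longrightarrow> a < N \<Longrightarrow> F a \<in> \<aa>"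
    using adapted_frame[OF g g' \<iota> \<iota>g A dec orth] by blast
  note fc = orthonormal_frameD(1)[OF f] and Fc = orthonormal_frameD(1)[OF F]
  note B = lie_algebraD(1)[OF L] and B' = lie_algebraD(1)[OF L']
  note b = bilinear_vecD(1)[OF B] and b' = bilinear_vecD(1)[OF B']
  define c where "c = structure_constants br g f"
  define c' where "c' = structure_constants br' g' F"
  have cc: "c' a b k = c a b k" if "a < n" "b < n" "k < n" for a b k
    unfolding c_def c'_def structure_constants_def using that Ff \<iota>br \<iota>g fc b by simp
  have anti': "c' b a k = - c' a b k" if "a < N" "b < N" "k < N" for a b k
    unfolding c'_def using structure_constants_antisym[OF g' L' F that] .
  have anti: "c b a k = - c a b k" if "a < n" "b < n" "k < n" for a b k
    unfolding c_def using structure_constants_antisym[OF g L f that] .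
  have im: "c' a b k = 0" if "a < N" "b < N" "n \<le> k" "k < N" for a b k
  proof -
    have "br' (F a) (F b) \<in> bracket_span N br' (carrier_vec N) (carrier_vec N)"
      using bracket_in_bracket_span[OF B'] Fc that by simp
    then have "br' (F a) (F b) \<in> \<iota> ` carrier_vec n" using der_alg by simp
    then have "g' (F k) (br' (F a) (F b)) = 0" using orth FA that by simp
    then show ?thesis unfolding c'_def structure_constants_def
      using inner_productD(3)[OF g' b'[OF Fc[OF that(1)] Fc[OF that(2)]] Fc[OF that(4)]] by simp
  qed
  have abelian: "c' a b k = 0" if "n \<le> a" "a < N" "n \<le> b" "b < N" "k < N" for a b k
    unfolding c'_def structure_constants_def
    using abel[OF FA[OF that(1,2)] FA[OF that(3,4)]] inner_zero(1)[OF g' Fc[OF that(5)]] by simp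
  have killing: "(\<Sum>a<n. \<Sum>m<n. c' b a m * c' d m a) = 0" if "b < n" "d < n" for b d
  proof (rule sum.neutral, rule ballI)
    fix a assume "a \<in> {..<n}"
    then have a: "a < n" by simp
    have "g (br (f d) (br (f b) (f a))) (f a) = (\<Sum>m<n. g (br (f b) (f a)) (f m) * g (br (f d) (f m)) (f a))"
      using inner_linear_frame[OF g f linear_vec_bracket(1)[OF B fc[OF that(2)]] b[OF fc[OF that(1)] fc[OF a]] fc[OF a]] .
    moreover have "g (br (f d) (br (f b) (f a))) (f a) = 0"
      using two_step fc that a inner_zero(1)[OF g fc[OF a]] by simp
    ultimately show "(\<Sum>m<n. c' b a m * c' d m a) = 0"
      using a that cc unfolding c_def structure_constants_def by simp
  qed
  have unimod: "(\<Sum>a<n. c' m a a) = 0" if "m < n" for m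
  proof -
    have "(\<Sum>a<n. c' m a a) = (\<Sum>a<n. g (br (f m) (f a)) (f a))"
      using that cc unfolding c_def structure_constants_def by simp
    also have "\<dots> = (\<Sum>r<n. br (f m) (unit_vec n r) $ r)"
      by (rule trace_frame[OF g f linear_vec_bracket(1)[OF B fc[OF that]], symmetric])
    finally show ?thesis using unimodular fc that by simp
  qed
  have split0: "(\<Sum>a<N. h a) = (\<Sum>a<n. h a)" if "\<And>a. n \<le> a \<Longrightarrow> a < N \<Longrightarrow> h a = 0" for h :: "nat \<Rightarrow> real"
    using nN that by (intro sum.mono_neutral_right) auto
  have c'_eq: "c' a b k = g' (br' (F a) (F b)) (F k)" for a b k
    unfolding c'_def structure_constants_def ..
  have ex: "g' (T (br' (F a) (F b))) (F k) = (\<Sum>m<n. c' a b m * g' (T (F m)) (F k))"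
    if "linear_vec N N T" "a < N" "b < N" "k < N" for T a b k
  proof -
    have "g' (T (br' (F a) (F b))) (F k) = (\<Sum>m<N. c' a b m * g' (T (F m)) (F k))"
      unfolding c'_eq by (rule inner_linear_frame[OF g' F that(1) b'[OF Fc[OF that(2)] Fc[OF that(3)]] Fc[OF that(4)]])
    also have "\<dots> = (\<Sum>m<n. c' a b m * g' (T (F m)) (F k))" using im that by (intro split0) simp
    finally show ?thesis .
  qed
  define A where "A i a b = c' i b a" for i a b
  have der: "act n (A i) c x y k = 0" if i: "i \<in> {n..<N}" and xyk: "x < n" "y < n" "k < n" for i x y k
  proof -
    have N: "i < N" "x < N" "y < N" "k < N" using i xyk nN by auto
    have 1: "g' (br' (F i) (br' (F x) (F y))) (F k) = (\<Sum>m<n. A i k m * c x y m)"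
      using ex[OF linear_vec_bracket(1)[OF B' Fc[OF N(1)]] N(2,3,4)] xyk by (simp add: A_def cc c'_eq[symmetric] mult.commute)
    have 2: "g' (br' (br' (F i) (F x)) (F y)) (F k) = (\<Sum>m<n. A i m x * c m y k)"
      using ex[OF linear_vec_bracket(2)[OF B' Fc[OF N(3)]] N(1,2,4)] xyk by (simp add: A_def cc c'_eq[symmetric])
    have 3: "g' (br' (F x) (br' (F i) (F y))) (F k) = (\<Sum>m<n. A i m y * c x m k)"
      using ex[OF linear_vec_bracket(1)[OF B' Fc[OF N(2)]] N(1,3,4)] xyk by (simp add: A_def cc c'_eq[symmetric])
    show ?thesis
      unfolding act_def
      using jacobi_form[OF L' linear_form_inner_vec(1)[OF g' Fc[OF N(4)]] Fc[OF N(1)] Fc[OF N(2)] Fc[OF N(3)]] 1 2 3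
      by simp
  qed
  have comm: "(\<Sum>m<n. A i x m * A j m y) = (\<Sum>m<n. A j x m * A i m y)"
    if i: "i \<in> {n..<N}" and j: "j \<in> {n..<N}" and xy: "x < n" "y < n" for i j x y
  proof -
    have "(\<Sum>m<n. A i x m * A j m y) = g' (br' (F i) (br' (F j) (F y))) (F x)"
      if N: "i < N" "j < N" "y < N" "x < N" for i j
      using ex[OF linear_vec_bracket(1)[OF B' Fc[OF N(1)]] N(2,3,4)] by (simp add: A_def c'_eq[symmetric] mult.commute)
    moreover have N: "i < N" "j < N" "y < N" "x < N" using i j xy nN by auto
    moreover have "g' (br' (F i) (br' (F j) (F y))) (F x)
      = g' (br' (br' (F i) (F j)) (F y)) (F x) + g' (br' (F j) (br' (F i) (F y))) (F x)"
      by (rule jacobi_form[OF L' linear_form_inner_vec(1)[OF g' Fc[OF N(4)]] Fc[OF N(1)] Fc[OF N(2)] Fc[OF N(3)]])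
    moreover have "g' (br' (br' (F i) (F j)) (F y)) (F x) = 0"
    proof -
      have "br' (F i) (F j) = 0\<^sub>v N" using abel FA i j by simp
      then show ?thesis
        using linear_form_zero[OF linear_form_inner(1)[OF g' linear_vec_bracket(2)[OF B' Fc[OF N(3)]] Fc[OF N(4)]]] by simp
    qed
    ultimately show ?thesis by simp
  qed
  define h where "h i = (\<Sum>a<n. c' i a a)" for i
  define S where "S a b = (\<Sum>i\<in>{n..<N}. h i * (A i a b + A i b a)) / 2" for a b
  have einstein: "nil_ricci n c x y + (\<Sum>i\<in>{n..<N}. commutator n (A i) (transposed (A i)) x y) / 2 - S x y
      = (if x = y then \<kappa> else 0)" if xy: "x < n" "y < n" for x y
  proof -
    have N: "x < N" "y < N" using xy nN by auto
    have "ricci_coeff N c' x y = \<kappa> * g' (F x) (F y)"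
      using ricci_curvature_frame[OF g' L' D F N] ric Fc N unfolding c'_def by simp
    then have "ricci_coeff N c' x y = (if x = y then \<kappa> else 0)"
      using orthonormal_frameD(2)[OF F N] by simp
    moreover have "nil_ricci n c' x y = nil_ricci n c x y"
      unfolding nil_ricci_def using cc xy by simp
    moreover have "commutator n (A i) (transposed (A i)) x y = (\<Sum>m<n. c' i m x * c' i m y - c' i x m * c' i y m)" for i
      unfolding commutator_def A_def by (simp add: sum_subtractf)
    moreover have "S x y = (\<Sum>i\<in>{n..<N}. (\<Sum>a<n. c' i a a) * (c' i x y + c' i y x)) / 2"
      unfolding S_def h_def A_def by (simp add: add.commute)
    ultimately show ?thesis
      using ricci_coeff_nilradical[of n N c', OF nN anti' im abelian killing unimod xy] by simp
  qed
  have nil: "nil_ricci n c x y = (if x = y then \<kappa> else 0) + S x y" if "x < n" "y < n" for x y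
    using nilsoliton_structure_constants(1)[of "{n..<N}" n c A S h \<kappa>, OF _ anti der comm S_def einstein that] by simp
  have actS: "act n S c x y k = 0" if "x < n" "y < n" "k < n" for x y k
    using nilsoliton_structure_constants(2)[of "{n..<N}" n c A S h \<kappa>, OF _ anti der comm S_def einstein that] by simp
  have S_sym: "S x y = S y x" for x y unfolding S_def by (simp add: add.commute)
  define T where "T = (\<lambda>x. vec_comb n n (\<lambda>a. \<Sum>b<n. S a b * g x (f b)) f)"
  have T: "linear_vec n n T" unfolding T_def by (rule linear_vec_of_matrix(1)[OF g f])
  have gT: "g (T x) (f a) = (\<Sum>b<n. S a b * g x (f b))" if "x \<in> carrier_vec n" "a < n" for x a
    unfolding T_def by (rule linear_vec_of_matrix(2)[OF g f that])
  have Tf: "g (T (f j)) (f a) = S a j" if "a < n" "j < n" for a j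
  proof -
    have "g (T (f j)) (f a) = (\<Sum>b<n. if b = j then S a b else 0)"
      unfolding gT[OF fc[OF that(2)] that(1)] using orthonormal_frameD(2)[OF f] that by (intro sum.cong refl) auto
    then show ?thesis using that by simp
  qed
  have "act n (\<lambda>a b. g (T (f b)) (f a)) c x y k = act n S c x y k" if "x < n" "y < n" "k < n" for x y k
    unfolding act_def using Tf that by simp
  then have derT: "derivation n br T"
    using derivation_iff_act[OF g L f T] actS unfolding c_def by simp
  have tr: "(\<Sum>r<n. T (\<psi> (unit_vec n r)) $ r) = - \<kappa> * (\<Sum>r<n. \<psi> (unit_vec n r) $ r)"
    if \<psi>: "derivation n br \<psi>" for \<psi>
  proof -
    have lin: "linear_vec n n \<psi>" using \<psi> unfolding derivation_def by simp
    define P where "P a b = g (\<psi> (f b)) (f a)" for a b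
    have "act n P c x y k = 0" if "x < n" "y < n" "k < n" for x y k
      using derivation_iff_act[OF g L f lin] \<psi> that unfolding P_def c_def by simp
    then have "tensor_inner n c (act n P c) = 0" unfolding tensor_inner_def by simp
    then have "0 = (\<Sum>a<n. \<Sum>b<n. nil_ricci n c a b * P a b)" using nil_ricci_act[of n c P, OF anti] by simp
    also have "\<dots> = (\<Sum>a<n. \<Sum>b<n. (if a = b then \<kappa> * P a b else 0) + S a b * P a b)"
      using nil by (intro sum.cong refl) (auto simp: distrib_right)
    also have "\<dots> = \<kappa> * (\<Sum>a<n. P a a) + (\<Sum>a<n. \<Sum>b<n. S a b * P a b)"
      by (simp add: sum.distrib sum_distrib_left)
    also have "(\<Sum>a<n. \<Sum>b<n. S a b * P a b) = (\<Sum>b<n. \<Sum>a<n. S b a * P a b)"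
      by (subst sum.swap) (simp add: S_sym)
    also have "\<dots> = (\<Sum>b<n. g (T (\<psi> (f b))) (f b))"
      using gT linear_vecD(1)[OF lin] fc unfolding P_def by (intro sum.cong refl) simp
    also have "\<dots> = (\<Sum>r<n. T (\<psi> (unit_vec n r)) $ r)"
      by (rule trace_frame[OF g f linear_vec_comp[OF lin T], symmetric])
    also have "(\<Sum>a<n. P a a) = (\<Sum>r<n. \<psi> (unit_vec n r) $ r)"
      unfolding P_def by (rule trace_frame[OF g f lin, symmetric])
    finally show ?thesis by simp
  qed
  have pos: "g (T z + \<kappa> \<cdot>\<^sub>v z) z > 0"
    if xyz: "x \<in> carrier_vec n" "y \<in> carrier_vec n" and z: "z \<in> carrier_vec n" and ne: "g (br x y) z \<noteq> 0"
      and central: "\<And>u. u \<in> carrier_vec n \<Longrightarrow> br z u = 0\<^sub>v n" for x y z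
  proof -
    define w where "w a = g z (f a)" for a
    have Tz: "T z \<in> carrier_vec n" using linear_vecD(1)[OF T z] .
    have expz: "g u z = (\<Sum>a<n. w a * g u (f a))" if "u \<in> carrier_vec n" for u
      unfolding w_def by (rule orthonormal_frameD(3)[OF f z linear_form_inner_vec(2)[OF g that]])
    have "g (T z + \<kappa> \<cdot>\<^sub>v z) z = (\<Sum>a<n. w a * (g (T z) (f a) + \<kappa> * w a))"
      using expz[of "T z + \<kappa> \<cdot>\<^sub>v z"] Tz z fc unfolding w_def by (simp add: inner_productD(1,2)[OF g])
    also have "\<dots> = (\<Sum>a<n. \<Sum>b<n. nil_ricci n c a b * (w a * w b))"
    proof (rule sum.cong[OF refl])
      fix a assume "a \<in> {..<n}"
      then have a: "a < n" by simp
      have "(\<Sum>b<n. nil_ricci n c a b * (w a * w b)) = (\<Sum>b<n. (if a = b then \<kappa> * (w a * w b) else 0) + w a * (S a b * w b))"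
        using nil a by (intro sum.cong refl) (auto simp: algebra_simps)
      also have "\<dots> = w a * (g (T z) (f a) + \<kappa> * w a)"
        unfolding gT[OF z a] sum.distrib sum_distrib_left[symmetric]
        using a by (simp add: w_def distrib_left mult.left_commute)
      finally show "w a * (g (T z) (f a) + \<kappa> * w a) = (\<Sum>b<n. nil_ricci n c a b * (w a * w b))" by simp
    qed
    also have "\<dots> = (\<Sum>i<n. \<Sum>j<n. (g (br (f i) (f j)) z)\<^sup>2) / 4"
    proof -
      have 1: "(\<Sum>a<n. w a * c i j a) = g (br (f i) (f j)) z" if "i < n" "j < n" for i j
        using expz[OF b[OF fc[OF that(1)] fc[OF that(2)]]] unfolding c_def structure_constants_def by simp
      have 2: "(\<Sum>a<n. w a * c a i j) = 0" if "i < n" "j < n" for i j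
      proof -
        have "g (br z (f i)) (f j) = (\<Sum>a<n. w a * c a i j)"
          using inner_linear_frame[OF g f linear_vec_bracket(2)[OF B fc[OF that(1)]] z fc[OF that(2)]]
          unfolding w_def c_def structure_constants_def .
        then show ?thesis using central[OF fc[OF that(1)]] inner_zero(1)[OF g fc[OF that(2)]] by simp
      qed
      show ?thesis unfolding nil_ricci_quadratic using 1 2 by simp
    qed
    finally have eq: "g (T z + \<kappa> \<cdot>\<^sub>v z) z = (\<Sum>i<n. \<Sum>j<n. (g (br (f i) (f j)) z)\<^sup>2) / 4" .
    have "(\<Sum>i<n. \<Sum>j<n. (g (br (f i) (f j)) z)\<^sup>2) \<noteq> 0"
    proof
      assume "(\<Sum>i<n. \<Sum>j<n. (g (br (f i) (f j)) z)\<^sup>2) = 0"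
      then have "\<forall>i\<in>{..<n}. (\<Sum>j<n. (g (br (f i) (f j)) z)\<^sup>2) = 0"
        by (subst (asm) sum_nonneg_eq_0_iff) (auto intro: sum_nonneg)
      then have 0: "g (br (f i) (f j)) z = 0" if "i < n" "j < n" for i j
        using that by (auto simp: sum_nonneg_eq_0_iff)
      then have "g (br (f i) y) z = 0" if "i < n" for i
        using linear_form_vanishes[OF f linear_form_inner(1)[OF g linear_vec_bracket(1)[OF B fc[OF that]] z] _ xyz(2)] that by blast
      then have "g (br x y) z = 0"
        using linear_form_vanishes[OF f linear_form_inner(1)[OF g linear_vec_bracket(2)[OF B xyz(2)] z] _ xyz(1)] by blast
      then show False using ne by simp
    qed
    moreover have "(\<Sum>i<n. \<Sum>j<n. (g (br (f i) (f j)) z)\<^sup>2) \<ge> 0" by (intro sum_nonneg) simp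
    ultimately show ?thesis unfolding eq by simp
  qed
  show thesis by (rule that[OF derT tr pos])
qed

section \<open>The Lie algebra of a graph\<close>

locale graph_enumeration =
  fixes vs :: "'a list" and es :: "'a set list"
  assumes distinct_vs: "distinct vs" and distinct_es: "distinct es"
    and edges: "\<And>e. e \<in> set es \<Longrightarrow> e \<subseteq> set vs \<and> card e = 2"
begin

abbreviation p :: nat where "p \<equiv> length vs"
abbreviation q :: nat where "q \<equiv> length es"
abbreviation n :: nat where "n \<equiv> length vs + length es"
abbreviation bv :: "nat \<Rightarrow> real vec" where "bv \<equiv> unit_vec n"
abbreviation br :: "real vec \<Rightarrow> real vec \<Rightarrow> real vec" where "br \<equiv> graph_bracket vs es"

text \<open>
  The ends are ordered by index, so that \<open>[e\<^sub>l\<^sub>o, e\<^sub>h\<^sub>i]\<close> is the basis vector of the edge with sign 1.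
\<close>

definition endpoints :: "nat \<Rightarrow> nat \<times> nat" where
  "endpoints k = (SOME (i, j). i < j \<and> j < p \<and> es ! k = {vs ! i, vs ! j})"

definition lo :: "nat \<Rightarrow> nat" where "lo k = fst (endpoints k)"
definition hi :: "nat \<Rightarrow> nat" where "hi k = snd (endpoints k)"

lemma endpoints:
  assumes "k < q"
  shows "lo k < hi k" "hi k < p" "lo k < p" "es ! k = {vs ! lo k, vs ! hi k}"
proof -
  have e: "es ! k \<subseteq> set vs" "card (es ! k) = 2" using edges nth_mem[OF assms] by auto
  then obtain a b where ab: "es ! k = {a, b}" "a \<noteq> b" by (meson card_2_iff)
  then obtain i j where ij: "i < p" "j < p" "vs ! i = a" "vs ! j = b"
    using e(1) by (metis in_set_conv_nth insert_subset)
  have "i \<noteq> j" using ij ab by auto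
  then have "\<exists>x. case x of (i, j) \<Rightarrow> i < j \<and> j < p \<and> es ! k = {vs ! i, vs ! j}"
  proof (cases "i < j")
    case True
    then show ?thesis using ij ab by (intro exI[of _ "(i, j)"]) simp
  next
    case False
    then show ?thesis using ij ab \<open>i \<noteq> j\<close> by (intro exI[of _ "(j, i)"]) (simp add: insert_commute)
  qed
  from someI_ex[OF this] have "case endpoints k of (i, j) \<Rightarrow> i < j \<and> j < p \<and> es ! k = {vs ! i, vs ! j}"
    unfolding endpoints_def .
  then have *: "lo k < hi k \<and> hi k < p \<and> es ! k = {vs ! lo k, vs ! hi k}"
    unfolding lo_def hi_def case_prod_beta .
  show "lo k < hi k" "hi k < p" "es ! k = {vs ! lo k, vs ! hi k}" using * by blast+
  show "lo k < p" using * by linarith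
qed

lemma endpoints_less [simp]:
  assumes "k < q"
  shows "lo k < p" "hi k < p" "lo k < n" "hi k < n" "lo k \<noteq> hi k" "hi k \<noteq> lo k"
    "lo k \<noteq> p + m" "hi k \<noteq> p + m" "p + m \<noteq> lo k" "p + m \<noteq> hi k"
  using endpoints(1-3)[OF assms] by simp_all

lemma vs_eq_iff: "i < p \<Longrightarrow> j < p \<Longrightarrow> vs ! i = vs ! j \<longleftrightarrow> i = j"
  using distinct_vs by (rule nth_eq_iff_index_eq)

lemma edge_eq_iff:
  assumes "k < q" "i < j" "j < p"
  shows "es ! k = {vs ! i, vs ! j} \<longleftrightarrow> i = lo k \<and> j = hi k"
  using endpoints[OF assms(1)] assms(2,3) vs_eq_iff by (auto simp: doubleton_eq_iff)

lemma edge_index_unique: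
  assumes "k < q" "l < q" "lo k = lo l" "hi k = hi l"
  shows "k = l"
  using endpoints(4)[OF assms(1)] endpoints(4)[OF assms(2)] assms distinct_es nth_eq_iff_index_eq by fastforce

lemma bracket_carrier [simp]: "br x y \<in> carrier_vec n"
  unfolding graph_bracket_def by (simp add: Let_def)

lemma bracket_dim [simp]: "dim_vec (br x y) = n"
  using bracket_carrier by (rule carrier_vecD)

lemma bracket_vertex: "r < p \<Longrightarrow> br x y $ r = 0"
  unfolding graph_bracket_def by (simp add: Let_def)

lemma bracket_edge:
  assumes k: "k < q"
  shows "br x y $ (p + k) = x $ lo k * y $ hi k - x $ hi k * y $ lo k"
proof -
  note e = endpoints[OF k]
  have "br x y $ (p + k) = (\<Sum>i<p. \<Sum>j<p. if i < j \<and> es ! k = {vs ! i, vs ! j}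
      then x $ i * y $ j - x $ j * y $ i else 0)"
    unfolding graph_bracket_def using k by (simp add: Let_def)
  also have "\<dots> = (\<Sum>i<p. \<Sum>j<p. if j = hi k then (if i = lo k then x $ i * y $ j - x $ j * y $ i else 0) else 0)"
  proof (intro sum.cong refl)
    fix i j assume "i \<in> {..<p}" "j \<in> {..<p}"
    then show "(if i < j \<and> es ! k = {vs ! i, vs ! j} then x $ i * y $ j - x $ j * y $ i else 0)
      = (if j = hi k then (if i = lo k then x $ i * y $ j - x $ j * y $ i else 0) else 0)"
      using edge_eq_iff[OF k, of i j] e(1) by (cases "i < j") auto
  qed
  also have "\<dots> = x $ lo k * y $ hi k - x $ hi k * y $ lo k"
    using e by simp
  finally show ?thesis .
qed

lemma index_cases:
  assumes "r < n"
  obtains "r < p" | k where "k < q" "r = p + k"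
proof (cases "r < p")
  case False
  then show thesis using that(2)[of "r - p"] assms by simp
qed (use that in blast)

lemma sum_n: "(\<Sum>r<n. h r) = (\<Sum>i<p. h i) + (\<Sum>k<q. h (p + k))" for h :: "nat \<Rightarrow> real"
  by (rule sum_lessThan_add)

lemma vec_eq_cases:
  assumes "x \<in> carrier_vec n" "y \<in> carrier_vec n" "\<And>i. i < p \<Longrightarrow> x $ i = y $ i"
    "\<And>k. k < q \<Longrightarrow> x $ (p + k) = y $ (p + k)"
  shows "x = y"
proof (rule eq_vecI)
  fix r assume "r < dim_vec y"
  then have "r < n" using assms(2) by simp
  then show "x $ r = y $ r" using assms(3,4) by (cases rule: index_cases) auto
qed (use assms in auto)

lemma bracket_bilinear: "bilinear_vec n br"
  unfolding bilinear_vec_def linear_vec_iff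
proof (intro conjI ballI allI; (rule bracket_carrier)?)
  fix x y z :: "real vec" and c :: real
  assume x: "x \<in> carrier_vec n" and y: "y \<in> carrier_vec n"
  have d: "lo k < dim_vec y" "hi k < dim_vec y" if "k < q" for k
    using endpoints[OF that] y by auto
  have d': "dim_vec (br u v) = n" for u v using bracket_carrier[of u v] by (rule carrier_vecD)
  show "br x (c \<cdot>\<^sub>v y) = c \<cdot>\<^sub>v br x y"
    by (rule vec_eq_cases; simp add: bracket_vertex bracket_edge d d'; simp add: algebra_simps)
  show "br (c \<cdot>\<^sub>v y) x = c \<cdot>\<^sub>v br y x"
    by (rule vec_eq_cases; simp add: bracket_vertex bracket_edge d d'; simp add: algebra_simps)
  assume z: "z \<in> carrier_vec n"
  have e: "lo k < dim_vec z" "hi k < dim_vec z" if "k < q" for k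
    using endpoints[OF that] z by auto
  show "br x (y + z) = br x y + br x z"
    by (rule vec_eq_cases; simp add: bracket_vertex bracket_edge d e d'; simp add: algebra_simps)
  show "br (y + z) x = br y x + br z x"
    by (rule vec_eq_cases; simp add: bracket_vertex bracket_edge d e d'; simp add: algebra_simps)
qed

lemma bracket_central: "(\<And>i. i < p \<Longrightarrow> z $ i = 0) \<Longrightarrow> br x z = 0\<^sub>v n \<and> br z x = 0\<^sub>v n"
  using endpoints by (auto intro!: vec_eq_cases simp: bracket_vertex bracket_edge)

lemma bracket_two_step: "br x (br y z) = 0\<^sub>v n"
  using bracket_central bracket_vertex by blast

lemma lie_algebra_graph: "lie_algebra n br"
  unfolding lie_algebra_def using bracket_bilinear
  by (auto simp: bracket_two_step bracket_vertex bracket_edge intro!: vec_eq_cases)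

lemma bracket_unimodular: "(\<Sum>r<n. br x (bv r) $ r) = 0"
  unfolding sum_n by (auto simp: bracket_vertex bracket_edge intro!: sum.neutral)

subsection \<open>The matrix of the line graph\<close>

definition inc :: "nat \<Rightarrow> nat \<Rightarrow> real" where
  "inc i k = (if i = lo k \<or> i = hi k then 1 else 0)"

definition star_sum :: "(nat \<Rightarrow> real) \<Rightarrow> nat \<Rightarrow> real" where
  "star_sum y i = (\<Sum>k<q. inc i k * y k)"

definition line_mat :: "real mat" where
  "line_mat = 3 \<cdot>\<^sub>m 1\<^sub>m q + adjacency_mat es (line_graph_edges (set es))"

lemma sum_inc:
  assumes "k < q"
  shows "(\<Sum>i<p. inc i k * f i) = f (lo k) + f (hi k)"
proof -
  have "(\<Sum>i<p. inc i k * f i) = (\<Sum>i<p. (if i = lo k then f i else 0) + (if i = hi k then f i else 0))"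
    using endpoints(1)[OF assms] unfolding inc_def by (intro sum.cong refl) auto
  then show ?thesis using endpoints[OF assms] by (simp add: sum.distrib)
qed

lemma line_graph_edge_iff:
  "{e, f} \<in> line_graph_edges G \<longleftrightarrow> e \<in> G \<and> f \<in> G \<and> e \<noteq> f \<and> e \<inter> f \<noteq> {}"
  unfolding line_graph_edges_def by (auto simp: doubleton_eq_iff)

text \<open>
  This is \<open>I + B\<^sup>t B\<close> for the incidence matrix \<open>B\<close>: each edge has two ends, and distinct edges share at
  most one.
\<close>

lemma line_mat_index:
  assumes k: "k < q" and l: "l < q"
  shows "line_mat $$ (k, l) = (if k = l then 1 else 0) + (\<Sum>i<p. inc i k * inc i l)"
proof -
  note ek = endpoints[OF k] and el = endpoints[OF l]
  have adj: "{es ! k, es ! l} \<in> line_graph_edges (set es) \<longleftrightarrow> k \<noteq> l \<and> es ! k \<inter> es ! l \<noteq> {}"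
    unfolding line_graph_edge_iff using nth_eq_iff_index_eq[OF distinct_es k l] nth_mem[OF k] nth_mem[OF l] by simp
  have "es ! k \<inter> es ! l \<noteq> {} \<longleftrightarrow> (lo k = lo l \<or> lo k = hi l \<or> hi k = lo l \<or> hi k = hi l)"
    unfolding ek(4) el(4) using vs_eq_iff ek(2,3) el(2,3) by auto
  moreover have "line_mat $$ (k, l) = (if k = l then 3 else 0)
      + (if {es ! k, es ! l} \<in> line_graph_edges (set es) then 1 else 0)"
    unfolding line_mat_def adjacency_mat_def using k l by simp
  ultimately show ?thesis
    unfolding adj sum_inc[OF k] using ek(1) el(1) edge_index_unique[OF k l] by (auto simp: inc_def)
qed

lemma line_mat_carrier: "line_mat \<in> carrier_mat q q"
  unfolding line_mat_def adjacency_mat_def by simp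

lemma line_mat_mult:
  assumes k: "k < q" and y: "y \<in> carrier_vec q"
  shows "(line_mat *\<^sub>v y) $ k = y $ k + star_sum (($) y) (lo k) + star_sum (($) y) (hi k)"
proof -
  have "(line_mat *\<^sub>v y) $ k = (\<Sum>l<q. line_mat $$ (k, l) * y $ l)"
    using k y line_mat_carrier by (simp add: scalar_prod_def atLeast0LessThan)
  also have "\<dots> = (\<Sum>l<q. (if k = l then y $ l else 0) + (\<Sum>i<p. inc i k * (inc i l * y $ l)))"
    using line_mat_index[OF k] by (intro sum.cong refl) (auto simp: distrib_right sum_distrib_right mult.assoc)
  also have "\<dots> = y $ k + (\<Sum>i<p. inc i k * star_sum (($) y) i)"
    using k unfolding sum.distrib star_sum_def sum_distrib_left by (subst (2) sum.swap) simp
  finally show ?thesis unfolding sum_inc[OF k] by simp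
qed

text \<open>
  The quadratic form of \<open>I + B\<^sup>t B\<close> is the square of the norm of \<open>x\<close> plus that of \<open>B x\<close>, so the kernel
  is 0.
\<close>

lemma line_mat_inverse:
  obtains B where "B \<in> carrier_mat q q" "line_mat * B = 1\<^sub>m q" "B * line_mat = 1\<^sub>m q"
proof -
  have "det line_mat \<noteq> 0"
  proof
    assume "det line_mat = 0"
    then obtain x where x: "x \<in> carrier_vec q" "x \<noteq> 0\<^sub>v q" "line_mat *\<^sub>v x = 0\<^sub>v q"
      using det_0_iff_vec_prod_zero[OF line_mat_carrier] by auto
    define Y where "Y = star_sum (($) x)"
    \<comment> \<open>The quadratic form of the matrix at \<open>x\<close>.\<close>
    have "(\<Sum>k<q. x $ k * (line_mat *\<^sub>v x) $ k) = (\<Sum>k<q. x $ k * x $ k + (\<Sum>i<p. x $ k * (inc i k * Y i)))"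
      unfolding Y_def using line_mat_mult[OF _ x(1)]
      by (intro sum.cong refl) (simp add: sum_distrib_left[symmetric] sum_inc algebra_simps)
    also have "\<dots> = (\<Sum>k<q. x $ k * x $ k) + (\<Sum>i<p. \<Sum>k<q. x $ k * (inc i k * Y i))"
      unfolding sum.distrib by (subst (2) sum.swap) simp
    also have "(\<Sum>i<p. \<Sum>k<q. x $ k * (inc i k * Y i)) = (\<Sum>i<p. Y i * Y i)"
      unfolding Y_def star_sum_def sum_distrib_right by (intro sum.cong refl) (simp add: ac_simps)
    finally have "(\<Sum>k<q. x $ k * x $ k) + (\<Sum>i<p. Y i * Y i) = 0" using x(3) by simp
    moreover have "(\<Sum>k<q. x $ k * x $ k) \<ge> 0" "(\<Sum>i<p. Y i * Y i) \<ge> 0" by (auto intro: sum_nonneg)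
    ultimately have "(\<Sum>k<q. x $ k * x $ k) = 0" by linarith
    then have "\<forall>k\<in>{..<q}. x $ k * x $ k = 0" by (subst (asm) sum_nonneg_eq_0_iff) auto
    then have "x = 0\<^sub>v q" using x(1) by (intro eq_vecI) auto
    then show False using x(2) by simp
  qed
  from det_non_zero_imp_unit[OF line_mat_carrier this]
  show thesis using that unfolding Units_def by (auto simp: ring_mat_simps)
qed

lemma positive_graph_iff:
  "positive_graph es \<longleftrightarrow>
    (\<exists>y. (\<forall>k<q. y k > 0) \<and> (\<forall>k<q. y k + star_sum y (lo k) + star_sum y (hi k) = 1))"
proof
  have cong: "star_sum y i = star_sum z i" if "\<And>k. k < q \<Longrightarrow> y k = z k" for y z i
    unfolding star_sum_def using that by simp
  let ?one = "vec q (\<lambda>_. 1) :: real vec"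
  {
    assume "positive_graph es"
    then obtain B where B: "B \<in> carrier_mat q q" "line_mat * B = 1\<^sub>m q" "\<forall>k<q. (B *\<^sub>v ?one) $ k > 0"
      unfolding positive_graph_def line_mat_def[symmetric] Let_def inverts_mat_def
      using line_mat_carrier by auto
    have c: "B *\<^sub>v ?one \<in> carrier_vec q" using B(1) by simp
    have "line_mat *\<^sub>v (B *\<^sub>v ?one) = ?one"
      using assoc_mult_mat_vec[OF line_mat_carrier B(1), of ?one] B(2) by simp
    then have "(B *\<^sub>v ?one) $ k + star_sum (($) (B *\<^sub>v ?one)) (lo k) + star_sum (($) (B *\<^sub>v ?one)) (hi k) = 1"
      if "k < q" for k
      using line_mat_mult[OF that c] that by simp
    then show "\<exists>y. (\<forall>k<q. y k > 0) \<and> (\<forall>k<q. y k + star_sum y (lo k) + star_sum y (hi k) = 1)"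
      using B(3) by (intro exI[of _ "($) (B *\<^sub>v ?one)"]) auto
  }
  assume "\<exists>y. (\<forall>k<q. y k > 0) \<and> (\<forall>k<q. y k + star_sum y (lo k) + star_sum y (hi k) = 1)"
  then obtain y where y: "\<And>k. k < q \<Longrightarrow> y k > 0" "\<And>k. k < q \<Longrightarrow> y k + star_sum y (lo k) + star_sum y (hi k) = 1"
    by blast
  obtain B where B: "B \<in> carrier_mat q q" "line_mat * B = 1\<^sub>m q" "B * line_mat = 1\<^sub>m q"
    using line_mat_inverse .
  have "line_mat *\<^sub>v vec q y = ?one"
    using y(2) cong[of "($) (vec q y)" y] line_mat_carrier
    by (intro eq_vecI) (auto simp: line_mat_mult simp del: index_mult_mat_vec)
  then have "B *\<^sub>v ?one = vec q y"
    using assoc_mult_mat_vec[OF B(1) line_mat_carrier, of "vec q y"] B(3) by simp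
  then show "positive_graph es"
    unfolding positive_graph_def line_mat_def[symmetric] Let_def inverts_mat_def
    using B y(1) line_mat_carrier by (intro bexI[of _ B]) auto
qed

end

section \<open>Einstein nilradicals come from positive graphs\<close>

context graph_enumeration
begin

definition adjacent :: "nat \<Rightarrow> nat \<Rightarrow> bool" where
  "adjacent u w \<longleftrightarrow> (\<exists>k<q. lo k = u \<and> hi k = w \<or> lo k = w \<and> hi k = u)"

definition nbrs :: "nat \<Rightarrow> nat set" where
  "nbrs u = {w. adjacent u w}"

lemma adjacent_sym: "adjacent u w \<longleftrightarrow> adjacent w u"
  unfolding adjacent_def by blast

lemma adjacent_less: "adjacent u w \<Longrightarrow> u < p \<and> w < p \<and> u \<noteq> w"
  unfolding adjacent_def by auto

lemma finite_nbrs: "finite (nbrs u)"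
  unfolding nbrs_def by (rule finite_subset[of _ "{..<p}"]) (auto dest: adjacent_less)

lemma adjacent_ends: "k < q \<Longrightarrow> adjacent (lo k) (hi k)"
  unfolding adjacent_def by blast

lemma edge_not_reversed: "k < q \<Longrightarrow> l < q \<Longrightarrow> \<not> (lo l = hi k \<and> hi l = lo k)"
  by (metis endpoints(1) less_asym)

lemma edge_index_iff: "k < q \<Longrightarrow> l < q \<Longrightarrow> lo l = lo k \<and> hi l = hi k \<longleftrightarrow> l = k"
  using edge_index_unique by blast

text \<open>
  The coordinate of \<open>x\<close> at the edge joining \<open>u\<close> and \<open>w\<close>, with the sign of this orientation, and 0 if there
  is no such edge. It absorbs the signs of the bracket.
\<close>

definition pair_coord :: "real vec \<Rightarrow> nat \<Rightarrow> nat \<Rightarrow> real" where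
  "pair_coord x u w = (\<Sum>k<q. x $ (p + k) * ((if lo k = u \<and> hi k = w then 1 else 0) - (if lo k = w \<and> hi k = u then 1 else 0)))"

lemma pair_coord_ends:
  assumes k: "k < q"
  shows "pair_coord x (lo k) (hi k) = x $ (p + k)"
proof -
  have "pair_coord x (lo k) (hi k) = (\<Sum>l<q. if l = k then x $ (p + l) else 0)"
    unfolding pair_coord_def
  proof (rule sum.cong[OF refl])
    fix l assume "l \<in> {..<q}"
    then have l: "l < q" by simp
    show "x $ (p + l) * ((if lo l = lo k \<and> hi l = hi k then 1 else 0) - (if lo l = hi k \<and> hi l = lo k then 1 else 0))
        = (if l = k then x $ (p + l) else 0)"
      unfolding edge_index_iff[OF k l] if_not_P[OF edge_not_reversed[OF k l]] by simp
  qed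
  then show ?thesis using k by simp
qed

lemma pair_coord_sym: "pair_coord x w u = - pair_coord x u w"
  unfolding pair_coord_def sum_negf[symmetric]
  by (rule sum.cong[OF refl]) (simp only: mult_minus_right[symmetric] minus_diff_eq)

lemma pair_coord_same: "pair_coord x u u = 0"
  using pair_coord_sym[of x u u] by linarith

lemma pair_coord_bracket:
  assumes "u = w \<or> adjacent u w"
  shows "pair_coord (br x y) u w = x $ u * y $ w - x $ w * y $ u"
  using assms
proof
  assume "adjacent u w"
  then obtain k where k: "k < q" "lo k = u \<and> hi k = w \<or> lo k = w \<and> hi k = u"
    unfolding adjacent_def by blast
  then show ?thesis
    using pair_coord_ends[OF k(1), of "br x y"] pair_coord_sym[of "br x y" w u] bracket_edge[OF k(1), of x y]
    by auto
qed (simp add: pair_coord_same)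

lemma pair_coord_unit:
  assumes k: "k < q"
  shows "pair_coord (bv (p + k)) u w
    = (if lo k = u \<and> hi k = w then 1 else 0) - (if lo k = w \<and> hi k = u then 1 else 0)"
proof -
  have "pair_coord (bv (p + k)) u w = (\<Sum>l<q. if l = k then
      (if lo l = u \<and> hi l = w then 1 else 0) - (if lo l = w \<and> hi l = u then 1 else 0) else 0)"
    unfolding pair_coord_def using k by (intro sum.cong refl) auto
  then show ?thesis using k by simp
qed

text \<open>
  The map sending the vertex vector \<open>e\<^sub>a\<close> to \<open>e\<^sub>i\<close> and the other vertex vectors to 0, extended to the
  edges by the Leibniz rule: \<open>[e\<^sub>a, e\<^sub>w]\<close> goes to \<open>[e\<^sub>i, e\<^sub>w]\<close>.
\<close>

definition vertex_shift :: "nat \<Rightarrow> nat \<Rightarrow> real vec \<Rightarrow> real vec" where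
  "vertex_shift i a x = vec n (\<lambda>r. if r < p then (if r = i then x $ a else 0)
     else (if lo (r - p) = i then pair_coord x a (hi (r - p)) else 0)
        + (if hi (r - p) = i then pair_coord x (lo (r - p)) a else 0))"

lemma vertex_shift_carrier [simp]: "vertex_shift i a x \<in> carrier_vec n"
  unfolding vertex_shift_def by simp

lemma vertex_shift_vertex: "r < p \<Longrightarrow> vertex_shift i a x $ r = (if r = i then x $ a else 0)"
  unfolding vertex_shift_def by simp

lemma vertex_shift_edge:
  "k < q \<Longrightarrow> vertex_shift i a x $ (p + k) =
    (if lo k = i then pair_coord x a (hi k) else 0) + (if hi k = i then pair_coord x (lo k) a else 0)"
  unfolding vertex_shift_def by simp

text \<open>
  The Leibniz rule on \<open>[e\<^sub>a, e\<^sub>w]\<close> needs \<open>[e\<^sub>i, e\<^sub>w] = 0\<close> whenever \<open>a\<close> and \<open>w\<close> are not joined, and this is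
  the inclusion of neighbourhoods. For \<open>a = i\<close> it holds trivially, and the derivation is diagonal.
\<close>

lemma vertex_shift_derivation:
  assumes ia: "i < p" "a < p" and sub: "nbrs i - {a} \<subseteq> nbrs a"
  shows "derivation n br (vertex_shift i a)"
  unfolding derivation_def linear_vec_iff
proof (intro conjI ballI allI; (rule vertex_shift_carrier)?)
  have pc_add: "pair_coord (x + y) u w = pair_coord x u w + pair_coord y u w"
    if "x \<in> carrier_vec n" "y \<in> carrier_vec n" for x y u w
    unfolding pair_coord_def sum.distrib[symmetric] using that
    by (intro sum.cong refl) (auto simp: algebra_simps)
  have pc_smult: "pair_coord (c \<cdot>\<^sub>v x) u w = c * pair_coord x u w" if "x \<in> carrier_vec n" for x u w c
    unfolding pair_coord_def sum_distrib_left using that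
    by (intro sum.cong refl) auto
  fix x y :: "real vec" and c :: real
  assume x: "x \<in> carrier_vec n"
  have dim: "dim_vec (vertex_shift i a u) = n" for u using carrier_vecD[OF vertex_shift_carrier] .
  show "vertex_shift i a (c \<cdot>\<^sub>v x) = c \<cdot>\<^sub>v vertex_shift i a x"
    using x ia by (intro vec_eq_cases) (auto simp: vertex_shift_vertex vertex_shift_edge pc_smult dim distrib_left)
  assume y: "y \<in> carrier_vec n"
  show "vertex_shift i a (x + y) = vertex_shift i a x + vertex_shift i a y"
    using x y ia by (intro vec_eq_cases) (auto simp: vertex_shift_vertex vertex_shift_edge pc_add dim)
  show "vertex_shift i a (br x y) = br (vertex_shift i a x) y + br x (vertex_shift i a y)"
  proof (rule vec_eq_cases)
    fix r assume "r < p"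
    then show "vertex_shift i a (br x y) $ r = (br (vertex_shift i a x) y + br x (vertex_shift i a y)) $ r"
      using ia by (simp add: vertex_shift_vertex bracket_vertex)
  next
    fix k assume k: "k < q"
    \<comment> \<open>The case \<open>a = hi k\<close> is harmless, since a vertex commutes with itself.\<close>
    have adj: "a = hi k \<or> adjacent a (hi k)" if "lo k = i"
      using sub adjacent_ends[OF k] that unfolding nbrs_def by auto
    have adj': "lo k = a \<or> adjacent (lo k) a" if "hi k = i"
      using sub adjacent_ends[OF k] that adjacent_sym unfolding nbrs_def by auto
    have "vertex_shift i a (br x y) $ (p + k) =
        (if lo k = i then x $ a * y $ hi k - x $ hi k * y $ a else 0)
      + (if hi k = i then x $ lo k * y $ a - x $ a * y $ lo k else 0)"
      unfolding vertex_shift_edge[OF k] using pair_coord_bracket[OF adj] pair_coord_bracket[OF adj'] by simp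
    moreover have "(br (vertex_shift i a x) y + br x (vertex_shift i a y)) $ (p + k)
      = br (vertex_shift i a x) y $ (p + k) + br x (vertex_shift i a y) $ (p + k)"
      using k by simp
    ultimately show "vertex_shift i a (br x y) $ (p + k) = (br (vertex_shift i a x) y + br x (vertex_shift i a y)) $ (p + k)"
      using k by (simp add: bracket_edge vertex_shift_vertex)
  qed auto
qed

lemma vertex_shift_trace:
  assumes "i < p" "a < p"
  shows "(\<Sum>r<n. vertex_shift i a (bv r) $ r) = (if a = i then 1 + star_sum (\<lambda>_. 1) i else 0)"
proof -
  have "(\<Sum>r<p. vertex_shift i a (bv r) $ r) = (\<Sum>r<p. if r = i then (if a = i then 1 else 0) else 0)"
    using assms by (intro sum.cong refl) (simp add: vertex_shift_vertex)
  moreover have "(\<Sum>k<q. vertex_shift i a (bv (p + k)) $ (p + k)) = (\<Sum>k<q. if a = i then inc i k else 0)"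
    by (intro sum.cong refl) (auto simp: vertex_shift_edge pair_coord_unit inc_def)
  ultimately show ?thesis
    unfolding sum_n star_sum_def using assms by simp
qed

lemma edge_unit_bracket:
  assumes k: "k < q"
  shows "bv (p + k) = br (bv (lo k)) (bv (hi k))"
proof (rule vec_eq_cases)
  fix l assume l: "l < q"
  show "bv (p + k) $ (p + l) = br (bv (lo k)) (bv (hi k)) $ (p + l)"
    using edge_not_reversed[OF k l] edge_index_iff[OF k l] k l by (auto simp: bracket_edge)
qed (use k in \<open>auto simp: bracket_vertex\<close>)

context
  fixes S assumes S: "derivation n br S"
begin

lemma derivation_edge:
  assumes k: "k < q" and x: "x \<in> carrier_vec n" and y: "y \<in> carrier_vec n"
  shows "S (br x y) $ (p + k) = S x $ lo k * y $ hi k - S x $ hi k * y $ lo k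
    + (x $ lo k * S y $ hi k - x $ hi k * S y $ lo k)"
proof -
  have "S (br x y) = br (S x) y + br x (S y)" using S x y unfolding derivation_def by simp
  then show ?thesis using k by (simp add: bracket_edge)
qed

lemma derivation_vertex:
  assumes "r < p" and x: "x \<in> carrier_vec n" and y: "y \<in> carrier_vec n"
  shows "S (br x y) $ r = 0"
proof -
  have "S (br x y) = br (S x) y + br x (S y)" using S x y unfolding derivation_def by simp
  then show ?thesis using assms(1) by (simp add: bracket_vertex)
qed

text \<open>
  If \<open>a\<close> were joined to some \<open>l\<close> that is not joined to \<open>i\<close>, then \<open>[e\<^sub>i, e\<^sub>l] = 0\<close>, but applying \<open>S\<close> to it
  would produce the entry of \<open>S\<close> as a coordinate at the edge joining \<open>a\<close> and \<open>l\<close>.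
\<close>

lemma derivation_offdiag_nbrs:
  assumes ai: "a < p" "i < p" "a \<noteq> i" and nz: "S (bv i) $ a \<noteq> 0"
  shows "nbrs a - {i} \<subseteq> nbrs i - {a}"
proof
  fix l assume l: "l \<in> nbrs a - {i}"
  then have al: "adjacent a l" and li: "l \<noteq> i" unfolding nbrs_def by auto
  have "adjacent i l"
  proof (rule ccontr)
    assume na: "\<not> adjacent i l"
    obtain k where k: "k < q" "lo k = a \<and> hi k = l \<or> lo k = l \<and> hi k = a"
      using al unfolding adjacent_def by blast
    have lp: "l < p" "a \<noteq> l" using adjacent_less[OF al] by auto
    have "br (bv i) (bv l) = 0\<^sub>v n"
    proof (rule vec_eq_cases)
      fix m assume m: "m < q"
      have "\<not> (lo m = i \<and> hi m = l)" "\<not> (lo m = l \<and> hi m = i)" using na m unfolding adjacent_def by auto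
      then show "br (bv i) (bv l) $ (p + m) = 0\<^sub>v n $ (p + m)"
        using m ai lp by (auto simp: bracket_edge)
    qed (auto simp: bracket_vertex)
    moreover have "S (0\<^sub>v n) $ (p + k) = 0"
      using S k(1) linear_form_zero[OF linear_form_index[of n n S "p + k"]] unfolding derivation_def by simp
    ultimately have "S (br (bv i) (bv l)) $ (p + k) = 0" by simp
    then show False
      using derivation_edge[OF k(1), of "bv i" "bv l"] k(2) ai lp li nz by auto
  qed
  then show "l \<in> nbrs i - {a}" using al adjacent_less[OF al] unfolding nbrs_def by auto
qed

lemma derivation_diag_edge:
  assumes k: "k < q"
  shows "S (bv (p + k)) $ (p + k) = S (bv (lo k)) $ lo k + S (bv (hi k)) $ hi k"
  unfolding edge_unit_bracket[OF k] using k by (simp add: derivation_edge)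

lemma vertex_shift_unit:
  assumes ia: "i < p" "a < p" and r: "r < p"
  shows "vertex_shift i a (bv r) = (if r = a then bv i else 0\<^sub>v n)"
proof (rule vec_eq_cases)
  fix k assume k: "k < q"
  have "pair_coord (bv r) u w = 0" for u w
    unfolding pair_coord_def using r by (intro sum.neutral) auto
  then show "vertex_shift i a (bv r) $ (p + k) = (if r = a then bv i else 0\<^sub>v n) $ (p + k)"
    using k ia by (simp add: vertex_shift_edge)
qed (use ia r in \<open>auto simp: vertex_shift_vertex\<close>)

text \<open>
  For \<open>i \<noteq> a\<close> every edge at \<open>a\<close> that does not end at \<open>i\<close> contributes the same entry of \<open>S\<close> as the vertex
  does, with the same sign; so these contributions cannot cancel.
\<close>

lemma derivation_shift_trace:
  assumes ia: "i < p" "a < p" and sub: "nbrs i - {a} \<subseteq> nbrs a"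
  shows "(\<Sum>r<n. S (vertex_shift i a (bv r)) $ r) = S (bv i) $ a +
    (\<Sum>k<q. if lo k = a then (if i = a then S (bv (p + k)) $ (p + k) else if hi k = i then 0 else S (bv i) $ a)
       else if hi k = a then (if i = a then S (bv (p + k)) $ (p + k) else if lo k = i then 0 else S (bv i) $ a)
       else 0)"
    (is "_ = _ + (\<Sum>k<q. ?t k)")
proof -
  let ?\<psi> = "vertex_shift i a"
  have S0: "S (0\<^sub>v n) $ r = 0" if "r < n" for r
    using S that linear_form_zero[OF linear_form_index[of n n S r]] unfolding derivation_def by simp
  have "(\<Sum>r<p. S (?\<psi> (bv r)) $ r) = (\<Sum>r<p. if r = a then S (bv i) $ a else 0)"
    using ia S0 by (intro sum.cong refl) (auto simp: vertex_shift_unit)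
  then have 1: "(\<Sum>r<p. S (?\<psi> (bv r)) $ r) = S (bv i) $ a" using ia by simp
  have 2: "S (?\<psi> (bv (p + k))) $ (p + k) = ?t k" if k: "k < q" for k
  proof -
    let ?l = "bv (lo k)" and ?h = "bv (hi k)"
    have Sadd: "S (x + y) $ (p + k) = S x $ (p + k) + S y $ (p + k)"
      if "x \<in> carrier_vec n" "y \<in> carrier_vec n" for x y
      using S k linear_form_index[of n n S "p + k"] that unfolding derivation_def linear_form_def by simp
    have "?\<psi> (br ?l ?h) = br (?\<psi> ?l) ?h + br ?l (?\<psi> ?h)"
      using vertex_shift_derivation[OF ia sub] unfolding derivation_def by simp
    then have "S (?\<psi> (br ?l ?h)) $ (p + k) = S (br (?\<psi> ?l) ?h) $ (p + k) + S (br ?l (?\<psi> ?h)) $ (p + k)"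
      by (simp add: Sadd)
    also have "S (br (?\<psi> ?l) ?h) $ (p + k) = (if lo k = a then S (br (bv i) ?h) $ (p + k) else 0)"
      using k ia S0[of "p + k"] bracket_central[of "0\<^sub>v n" ?h] by (simp add: vertex_shift_unit)
    also have "S (br ?l (?\<psi> ?h)) $ (p + k) = (if hi k = a then S (br ?l (bv i)) $ (p + k) else 0)"
      using k ia S0[of "p + k"] bracket_central[of "0\<^sub>v n" ?l] by (simp add: vertex_shift_unit)
    finally show ?thesis
      unfolding derivation_diag_edge[OF k] unfolding edge_unit_bracket[OF k]
      using k ia by (auto simp: derivation_edge)
  qed
  show ?thesis unfolding sum_n 1 using 2 by simp
qed

context
  fixes \<kappa> :: real
  assumes trace: "\<And>\<psi>. derivation n br \<psi> \<Longrightarrow>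
    (\<Sum>r<n. S (\<psi> (bv r)) $ r) = - \<kappa> * (\<Sum>r<n. \<psi> (bv r) $ r)"
begin

text \<open>
  A nonzero entry gives an inclusion of neighbourhoods. If the degrees were not strictly ordered, this
  inclusion would be an equality, and the opposite shift would be a derivation as well. Its
  product with \<open>S\<close> has as trace a positive multiple of the entry, whereas the trace identity gives 0.
\<close>

lemma derivation_offdiag_degree:
  assumes ai: "a < p" "i < p" "a \<noteq> i" and nz: "S (bv i) $ a \<noteq> 0"
  shows "card (nbrs a) < card (nbrs i)"
proof (rule ccontr)
  assume "\<not> card (nbrs a) < card (nbrs i)"
  then have le: "card (nbrs i) \<le> card (nbrs a)" by simp
  have sub: "nbrs a - {i} \<subseteq> nbrs i - {a}" using derivation_offdiag_nbrs[OF ai nz] .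
  have iff: "i \<in> nbrs a \<longleftrightarrow> a \<in> nbrs i" unfolding nbrs_def using adjacent_sym by simp
  \<comment> \<open>Adjacency is symmetric, so the two sets lose an element simultaneously.\<close>
  have "card (nbrs i - {a}) \<le> card (nbrs a - {i})"
    using le iff finite_nbrs by (cases "a \<in> nbrs i") simp_all
  then have "nbrs a - {i} = nbrs i - {a}"
    using card_seteq[OF _ sub] finite_nbrs by simp
  then have sub': "nbrs i - {a} \<subseteq> nbrs a" by blast
  let ?s = "S (bv i) $ a"
  \<comment> \<open>The number of edges at \<open>a\<close> that do not end at \<open>i\<close>.\<close>
  define N where "N = (\<Sum>k<q. if lo k = a then (if hi k = i then 0 else 1)
     else if hi k = a then (if lo k = i then 0 else (1 :: real)) else 0)"
  have "(\<Sum>r<n. S (vertex_shift i a (bv r)) $ r) = 0"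
    using trace[OF vertex_shift_derivation[OF ai(2,1) sub']] vertex_shift_trace[OF ai(2,1)] ai(3) by simp
  moreover have "(\<Sum>r<n. S (vertex_shift i a (bv r)) $ r) = ?s + ?s * N"
    unfolding derivation_shift_trace[OF ai(2,1) sub'] N_def sum_distrib_left using ai(3)
    by (intro arg_cong2[where f = plus] sum.cong refl) auto
  ultimately have "?s * (1 + N) = 0" by (simp add: distrib_left)
  moreover have "N \<ge> 0" unfolding N_def by (intro sum_nonneg) auto
  ultimately show False using nz by simp
qed

text \<open>
  The diagonal entries of the Ricci operator \<open>\<kappa> I + S\<close> at the edges. They turn out to be \<open>- \<kappa>\<close> times the
  solution of the system of the line graph.
\<close>

definition weight :: "nat \<Rightarrow> real" where
  "weight k = S (bv (p + k)) $ (p + k) + \<kappa>"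

text \<open>
  The trace identity for the diagonal derivation belonging to the vertex \<open>i\<close>.
\<close>

lemma derivation_diag_vertex:
  assumes i: "i < p"
  shows "S (bv i) $ i = - \<kappa> - star_sum weight i"
proof -
  have "(\<Sum>r<n. S (vertex_shift i i (bv r)) $ r) = - \<kappa> * (1 + star_sum (\<lambda>_. 1) i)"
    using trace[OF vertex_shift_derivation[OF i i]] vertex_shift_trace[OF i i] by auto
  moreover have "(\<Sum>r<n. S (vertex_shift i i (bv r)) $ r)
      = S (bv i) $ i + (\<Sum>k<q. inc i k * S (bv (p + k)) $ (p + k))"
    unfolding derivation_shift_trace[OF i i Diff_subset] inc_def
    by (intro arg_cong2[where f = plus] sum.cong refl) auto
  moreover have "star_sum weight i
      = (\<Sum>k<q. inc i k * S (bv (p + k)) $ (p + k)) + \<kappa> * star_sum (\<lambda>_. 1) i"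
    unfolding star_sum_def weight_def by (simp add: distrib_left sum.distrib sum_distrib_left mult.commute)
  ultimately show ?thesis by (simp add: algebra_simps)
qed

lemma weight_equation:
  assumes k: "k < q"
  shows "weight k + star_sum weight (lo k) + star_sum weight (hi k) = - \<kappa>"
  using derivation_diag_edge[OF k] derivation_diag_vertex[of "lo k"] derivation_diag_vertex[of "hi k"] k
  unfolding weight_def[of k] by simp

text \<open>
  The degree order on vertices makes \<open>S\<close> triangular; on the edges the sum of the degrees of the two
  ends does the same.
\<close>

definition height :: "nat \<Rightarrow> nat" where
  "height k = card (nbrs (lo k)) + card (nbrs (hi k))"

lemma derivation_offdiag_height:
  assumes k: "k < q" and l: "l < q" and kl: "l \<noteq> k" and nz: "S (bv (p + k)) $ (p + l) \<noteq> 0"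
  shows "height l < height k"
proof -
  let ?l = "bv (lo k)" and ?h = "bv (hi k)"
  note deg = derivation_offdiag_degree
  have eq: "S (bv (p + k)) $ (p + l)
      = (if hi l = hi k then S ?l $ lo l else 0) - (if lo l = hi k then S ?l $ hi l else 0)
      + ((if lo l = lo k then S ?h $ hi l else 0) - (if hi l = lo k then S ?h $ lo l else 0))"
    unfolding edge_unit_bracket[OF k] using k l by (simp add: derivation_edge)
  have ne: "\<not> (lo l = lo k \<and> hi l = hi k)" "\<not> (lo l = hi k \<and> hi l = lo k)"
    using edge_index_unique[OF l k] kl edge_not_reversed[OF k l] by blast+
  have "a - b + (c - d) \<noteq> 0 \<Longrightarrow> a \<noteq> 0 \<or> b \<noteq> 0 \<or> c \<noteq> 0 \<or> d \<noteq> 0" for a b c d :: real by auto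
  note cases = this[OF nz[unfolded eq]]
  have if_nonzero: "(if P then x else 0) \<noteq> 0 \<longleftrightarrow> P \<and> x \<noteq> 0" for P and x :: real by simp
  consider "hi l = hi k" "S ?l $ lo l \<noteq> 0" | "lo l = hi k" "S ?l $ hi l \<noteq> 0"
    | "lo l = lo k" "S ?h $ hi l \<noteq> 0" | "hi l = lo k" "S ?h $ lo l \<noteq> 0"
    using cases unfolding if_nonzero by argo
  then show ?thesis
  proof cases
    case 1
    then show ?thesis using deg[of "lo l" "lo k"] ne(1) k l unfolding height_def by simp
  next
    case 2
    then show ?thesis using deg[of "hi l" "lo k"] ne(2) k l unfolding height_def by simp
  next
    case 3
    then show ?thesis using deg[of "hi l" "hi k"] ne(1) k l unfolding height_def by simp
  next
    case 4
    then show ?thesis using deg[of "lo l" "hi k"] ne(2) k l unfolding height_def by simp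
  qed
qed

lemma derivation_central:
  assumes x: "x \<in> carrier_vec n" "\<And>i. i < p \<Longrightarrow> x $ i = 0"
  shows "i < p \<Longrightarrow> S x $ i = 0"
    and "l < q \<Longrightarrow> S x $ (p + l) = (\<Sum>k<q. x $ (p + k) * S (bv (p + k)) $ (p + l))"
proof -
  have "S x $ r = (\<Sum>k<q. x $ (p + k) * S (bv (p + k)) $ r)" if "r < n" for r
    using S linear_form_coords[OF linear_form_index[of n n S r] x(1)] that x(2)
    unfolding derivation_def sum_n by simp
  note * = this
  show "l < q \<Longrightarrow> S x $ (p + l) = (\<Sum>k<q. x $ (p + k) * S (bv (p + k)) $ (p + l))"
    using * by simp
  assume i: "i < p"
  have "S (bv (p + k)) $ i = 0" if "k < q" for k
    unfolding edge_unit_bracket[OF that] using derivation_vertex[OF i] by simp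
  then show "S x $ i = 0" using *[of i] i by simp
qed

text \<open>
  Let \<open>W\<close> be spanned by the edges of smaller height than \<open>k\<close>, and let \<open>u\<close> be the component of the basis
  vector of \<open>k\<close> orthogonal to \<open>W\<close>. By triangularity \<open>\<kappa> I + S\<close> maps \<open>u\<close> to \<open>weight k\<close> times \<open>u\<close> modulo
  \<open>W\<close>. So the inner product of this image with \<open>u\<close>, which is positive, is \<open>weight k\<close> times that of \<open>u\<close>
  with itself.
\<close>

lemma weight_positive:
  assumes g: "inner_product n g"
    and pos: "\<And>x y z. x \<in> carrier_vec n \<Longrightarrow> y \<in> carrier_vec n \<Longrightarrow> z \<in> carrier_vec n \<Longrightarrow> g (br x y) z \<noteq> 0 \<Longrightarrow>
      (\<And>u. u \<in> carrier_vec n \<Longrightarrow> br z u = 0\<^sub>v n) \<Longrightarrow> g (S z + \<kappa> \<cdot>\<^sub>v z) z > 0"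
    and k: "k < q"
  shows "weight k > 0"
proof -
  define U where "U = {l. l < q \<and> height l < height k}"
  define W :: "real vec set" where
    "W = {x \<in> carrier_vec n. (\<forall>i<p. x $ i = 0) \<and> (\<forall>l<q. l \<notin> U \<longrightarrow> x $ (p + l) = 0)}"
  have W: "vec_subspace n W"
    unfolding subspace_iff W_def by auto
  have finU: "finite U" unfolding U_def by simp
  obtain us where us: "set us = U" using finite_list[OF finU] by blast
  have UW: "bv (p + l) \<in> W" if "l \<in> U" for l
    using that unfolding W_def U_def by auto
  have "set (map (\<lambda>l. bv (p + l)) us) \<subseteq> W" using us UW by auto
  from gram_schmidt_system[OF g W this] obtain m F where
    F: "orthonormal_system n g m F" "\<And>a. a < m \<Longrightarrow> F a \<in> W" and
    ex: "\<And>l. l \<in> U \<Longrightarrow> expands n g m F (bv (p + l))" using us by auto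
  let ?e = "bv (p + k)"
  have Fc: "F a \<in> carrier_vec n" if "a < m" for a using F(2)[OF that] unfolding W_def by simp
  define w where "w = vec_comb n m (\<lambda>a. g ?e (F a)) F"
  have w: "w \<in> W" "w \<in> carrier_vec n" unfolding w_def using vec_comb_in_subspace[OF W F(2)] by auto
  define u where "u = ?e - w"
  have e: "?e \<in> carrier_vec n" by simp
  have u: "u \<in> carrier_vec n" unfolding u_def using w by simp
  have kU: "k \<notin> U" unfolding U_def by simp
  have u_vertex: "u $ i = 0" if "i < p" for i
    using w that k unfolding u_def W_def by simp
  have u_edge: "u $ (p + l) = (if l = k then 1 else 0)" if "l < q" "l \<notin> U" for l
    using w that k unfolding u_def W_def by simp
  have orthF: "g (F a) u = 0" if "a < m" for a
    unfolding u_def w_def by (rule projection_orthogonal[OF g F(1) e that])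
  define \<phi> where "\<phi> x = g x u" for x
  have \<phi>: "linear_form n \<phi>" unfolding \<phi>_def by (rule linear_form_inner_vec(1)[OF g u])
  have \<phi>U: "\<phi> (bv (p + l)) = 0" if "l \<in> U" for l
  proof -
    have "\<phi> (bv (p + l)) = (\<Sum>a<m. g (bv (p + l)) (F a) * \<phi> (F a))"
      using ex[OF that] \<phi> unfolding expands_def by blast
    then show ?thesis using orthF unfolding \<phi>_def by simp
  qed
  have \<phi>_coord: "\<phi> x = x $ (p + k) * \<phi> ?e"
    if x: "x \<in> carrier_vec n" "\<And>i. i < p \<Longrightarrow> x $ i = 0" "\<And>l. l < q \<Longrightarrow> l \<notin> U \<Longrightarrow> l \<noteq> k \<Longrightarrow> x $ (p + l) = 0" for x
  proof -
    have "\<phi> x = (\<Sum>l<q. x $ (p + l) * \<phi> (bv (p + l)))"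
      unfolding linear_form_coords[OF \<phi> x(1)] sum_n using x(2) by simp
    also have "\<dots> = (\<Sum>l<q. if l = k then x $ (p + l) * \<phi> (bv (p + l)) else 0)"
      using \<phi>U x(3) by (intro sum.cong refl) force
    finally show ?thesis using k by simp
  qed
  have Su: "S u \<in> carrier_vec n" using S u unfolding derivation_def by (blast intro: linear_vecD(1))
  \<comment> \<open>By triangularity, \<open>k\<close> is the only coordinate of \<open>S u\<close> outside \<open>W\<close>.\<close>
  have S_coord: "S u $ (p + l) = (if l = k then S ?e $ (p + k) else 0)" if l: "l < q" "l \<notin> U" for l
  proof -
    have "S u $ (p + l) = (\<Sum>m<q. u $ (p + m) * S (bv (p + m)) $ (p + l))"
      using derivation_central(2)[OF u u_vertex l(1)] .
    also have "\<dots> = (\<Sum>m<q. if m = k then (if l = k then S ?e $ (p + k) else 0) else 0)"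
    proof (rule sum.cong[OF refl])
      fix m assume "m \<in> {..<q}"
      then have m: "m < q" by simp
      have off: "S (bv (p + m)) $ (p + l) = 0" if "l \<noteq> m" "height m \<le> height k" "\<not> height l < height m"
        using derivation_offdiag_height[OF m l(1) that(1)] that by blast
      have lU: "\<not> height l < height k" using l unfolding U_def by simp
      show "u $ (p + m) * S (bv (p + m)) $ (p + l) = (if m = k then (if l = k then S ?e $ (p + k) else 0) else 0)"
      proof (cases "m \<in> U")
        case True
        then have "height m < height k" "m \<noteq> k" "l \<noteq> m" using l kU unfolding U_def by auto
        then show ?thesis using off lU by simp
      next
        case False
        then show ?thesis using u_edge[OF m False] off lU by auto
      qed
    qed
    finally show ?thesis using k by simp
  qed
  have "\<phi> (S u) = S u $ (p + k) * \<phi> ?e"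
    using Su S_coord derivation_central(1)[OF u u_vertex] by (intro \<phi>_coord) auto
  then have \<phi>S: "\<phi> (S u) = S ?e $ (p + k) * \<phi> ?e" using S_coord[OF k kU] by simp
  have \<phi>u: "\<phi> u = \<phi> ?e" using \<phi>_coord[OF u u_vertex] u_edge[OF k kU] u_edge by simp
  have "u \<noteq> 0\<^sub>v n" using u_edge[OF k kU] k by auto
  then have uu: "\<phi> u > 0" unfolding \<phi>_def using inner_productD(4)[OF g u] by simp
  have "\<phi> ?e \<noteq> 0" using uu \<phi>u by simp
  then have "g (br (bv (lo k)) (bv (hi k))) u \<noteq> 0"
    unfolding \<phi>_def edge_unit_bracket[OF k] .
  moreover have "br u v = 0\<^sub>v n" for v using bracket_central u_vertex by blast
  ultimately have "g (S u + \<kappa> \<cdot>\<^sub>v u) u > 0"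
    using pos[OF unit_vec_carrier unit_vec_carrier u] by blast
  moreover have "g (S u + \<kappa> \<cdot>\<^sub>v u) u = \<phi> (S u) + \<kappa> * \<phi> u"
    unfolding \<phi>_def using Su u by (simp add: inner_productD(1,2)[OF g])
  ultimately have "weight k * \<phi> u > 0"
    unfolding \<phi>S \<phi>u weight_def by (simp add: distrib_right)
  then show ?thesis using uu by (simp add: zero_less_mult_iff)
qed

end

end

theorem einstein_nilradical_positive:
  assumes "einstein_nilradical n br" and "es \<noteq> []"
  shows "positive_graph es"
proof -
  obtain g N br' g' \<iota> \<aa> where g: "inner_product n g"
    and ext: "einstein_solvable_extension n br g N br' g' \<iota> \<aa>"
    using assms unfolding einstein_nilradical_def by blast
  obtain \<kappa> S where S: "derivation n br S"
    and tr: "\<And>\<psi>. derivation n br \<psi> \<Longrightarrow> (\<Sum>r<n. S (\<psi> (bv r)) $ r) = - \<kappa> * (\<Sum>r<n. \<psi> (bv r) $ r)"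
    and pos: "\<And>x y z. x \<in> carrier_vec n \<Longrightarrow> y \<in> carrier_vec n \<Longrightarrow> z \<in> carrier_vec n \<Longrightarrow> g (br x y) z \<noteq> 0 \<Longrightarrow>
      (\<And>u. u \<in> carrier_vec n \<Longrightarrow> br z u = 0\<^sub>v n) \<Longrightarrow> g (S z + \<kappa> \<cdot>\<^sub>v z) z > 0"
    by (rule einstein_extension_nilsoliton[OF lie_algebra_graph g ext bracket_two_step bracket_unimodular]; rule that; blast)
  define y where "y = weight S \<kappa>"
  have y: "y k > 0" if "k < q" for k unfolding y_def using weight_positive[OF S tr g pos that] .
  have eq: "y k + star_sum y (lo k) + star_sum y (hi k) = - \<kappa>" if "k < q" for k
    unfolding y_def using weight_equation[OF S tr that] .
  have nn: "star_sum y i \<ge> 0" for i unfolding star_sum_def inc_def using y by (intro sum_nonneg) (simp add: less_imp_le)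
  have "0 < q" using assms(2) by simp
  then have \<kappa>: "- \<kappa> > 0" using eq[of 0] y[of 0] nn[of "lo 0"] nn[of "hi 0"] by linarith
  have "star_sum (\<lambda>k. y k / - \<kappa>) i = star_sum y i / - \<kappa>" for i
    unfolding star_sum_def by (simp add: sum_divide_distrib sum_negf)
  then have "y k / - \<kappa> + star_sum (\<lambda>k. y k / - \<kappa>) (lo k) + star_sum (\<lambda>k. y k / - \<kappa>) (hi k) = 1" if "k < q" for k
    using eq[OF that] \<kappa> by (simp only: add_divide_distrib[symmetric]) simp
  then show ?thesis
    unfolding positive_graph_iff using divide_pos_pos[OF y \<kappa>] by (intro exI[of _ "\<lambda>k. y k / - \<kappa>"]) blast
qed

end

section \<open>Positive graphs give Einstein nilradicals\<close>

context graph_enumeration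
begin

lemma nilpotent_graph: "nilpotent_lie_algebra n br"
proof -
  define Z where "Z = {x \<in> carrier_vec n. \<forall>i<p. x $ i = (0 :: real)}"
  have Z: "vec_subspace n Z" unfolding Z_def subspace_iff by auto
  have 0: "vec_subspace n {0\<^sub>v n}" unfolding subspace_iff by auto
  have 1: "lower_central_series n br 1 \<subseteq> Z"
    using bracket_vertex by (simp, intro bracket_span_subset[OF Z]) (auto simp: Z_def)
  then have c: "lower_central_series n br 1 \<subseteq> carrier_vec n" unfolding Z_def by auto
  have "lower_central_series n br 2 = bracket_span n br (carrier_vec n) (lower_central_series n br 1)"
    by (simp add: numeral_2_eq_2)
  moreover have "\<dots> \<subseteq> {0\<^sub>v n}"
  proof (rule bracket_span_subset[OF 0])
    fix x z assume "z \<in> lower_central_series n br 1"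
    then have "\<And>i. i < p \<Longrightarrow> z $ i = 0" using 1 unfolding Z_def by auto
    then show "br x z \<in> {0\<^sub>v n}" using bracket_central by blast
  qed
  moreover have "0\<^sub>v n \<in> bracket_span n br (carrier_vec n) (lower_central_series n br 1)"
    using bracket_span_subspace[OF bracket_bilinear _ c] unfolding subspace_iff by auto
  ultimately have "lower_central_series n br 2 = {0\<^sub>v n}" by blast
  then show ?thesis unfolding nilpotent_lie_algebra_def using lie_algebra_graph by blast
qed

context
  fixes y :: "nat \<Rightarrow> real"
  assumes y_pos: "\<And>k. k < q \<Longrightarrow> y k > 0"
    and y_eq: "\<And>k. k < q \<Longrightarrow> y k + star_sum y (lo k) + star_sum y (hi k) = 1"
    and q_pos: "0 < q"
begin

text \<open>
  The diagonal derivation \<open>Ric + I / 2\<close> for the metric in which \<open>z\<^sub>k\<close> has length \<open>sqrt (y k)\<close>.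
\<close>

definition eigenvalue :: "nat \<Rightarrow> real" where
  "eigenvalue r = (if r < p then (1 - star_sum y r) / 2 else (1 + y (r - p)) / 2)"

text \<open>
  The factor for which the square of \<open>speed\<close> times the trace of the derivation is 1, as the Einstein
  equation along the nilradical requires.
\<close>

definition speed :: real where "speed = 1 / sqrt (\<Sum>r<n. eigenvalue r)"

definition rate :: "nat \<Rightarrow> real" where "rate r = speed * eigenvalue r"

text \<open>
  The basis is rescaled to an orthonormal one, so that the edge \<open>k\<close> carries the structure constant
  \<open>sqrt (y k)\<close>. The last basis vector acts on the others by \<open>speed\<close> times the diagonal derivation.
\<close>

definition ext_br :: "real vec \<Rightarrow> real vec \<Rightarrow> real vec" where
  "ext_br x z = vec (Suc n) (\<lambda>r. if r < n then
     rate r * (x $ n * z $ r - x $ r * z $ n) + (if r < p then 0 else sqrt (y (r - p)) * br x z $ r) else 0)"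

text \<open>
  At a vertex that is an end of \<open>k\<close>, the equation of \<open>k\<close> leaves the positive number \<open>y k\<close> as a gap.
\<close>

lemma star_sum_less_one:
  assumes i: "i < p"
  shows "star_sum y i < 1"
proof (cases "\<exists>k<q. i = lo k \<or> i = hi k")
  case True
  then obtain k where k: "k < q" "i = lo k \<or> i = hi k" by blast
  have "star_sum y j \<ge> 0" for j
    unfolding star_sum_def inc_def using y_pos by (intro sum_nonneg) (simp add: less_imp_le)
  then show ?thesis using y_eq[OF k(1)] y_pos[OF k(1)] k(2) by (smt (verit))
next
  case False
  then have "star_sum y i = 0" unfolding star_sum_def inc_def by (intro sum.neutral) auto
  then show ?thesis by simp
qed

lemma eigenvalue_pos: "r < n \<Longrightarrow> eigenvalue r > 0"
proof -
  assume "r < n"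
  then show ?thesis
  proof (cases rule: index_cases)
    case 1
    then show ?thesis using star_sum_less_one[of r] unfolding eigenvalue_def by simp
  next
    case (2 k)
    then show ?thesis using y_pos[of k] unfolding eigenvalue_def by simp
  qed
qed

lemma eigenvalue_double:
  "i < p \<Longrightarrow> 2 * eigenvalue i = 1 - star_sum y i" "2 * eigenvalue (p + k) = 1 + y k"
  unfolding eigenvalue_def by simp_all

text \<open>
  The equation of the edge \<open>k\<close> says exactly that the diagonal map is a derivation.
\<close>

lemma eigenvalue_edge: "k < q \<Longrightarrow> eigenvalue (p + k) = eigenvalue (lo k) + eigenvalue (hi k)"
  using y_eq[of k] unfolding eigenvalue_def by (simp add: field_simps)

lemma sum_eigenvalue_pos: "(\<Sum>r<n. eigenvalue r) > 0"
  using q_pos eigenvalue_pos by (intro sum_pos) auto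

lemma speed_square: "speed * speed * (\<Sum>r<n. eigenvalue r) = 1"
  unfolding speed_def using sum_eigenvalue_pos by (simp add: field_simps)

lemma speed_pos: "speed > 0"
  unfolding speed_def using sum_eigenvalue_pos by simp

lemma rate_pos: "r < n \<Longrightarrow> rate r > 0"
  unfolding rate_def using speed_pos eigenvalue_pos by simp

lemma rate_edge: "k < q \<Longrightarrow> rate (p + k) = rate (lo k) + rate (hi k)"
  unfolding rate_def by (simp add: eigenvalue_edge distrib_left)

text \<open>
  The derivation is orthogonal to the Ricci operator, its own difference from \<open>I / 2\<close>. This makes the
  Ricci curvature of the last basis vector equal to \<open>- 1 / 2\<close>.
\<close>

lemma sum_eigenvalue_square: "(\<Sum>r<n. eigenvalue r * eigenvalue r) = (\<Sum>r<n. eigenvalue r) / 2"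
proof -
  have "(\<Sum>r<n. eigenvalue r * (2 * eigenvalue r - 1)) = - (\<Sum>i<p. eigenvalue i * star_sum y i) + (\<Sum>k<q. eigenvalue (p + k) * y k)"
    unfolding sum_n sum_negf[symmetric] by (intro arg_cong2[where f = plus] sum.cong refl) (auto simp: eigenvalue_double)
  also have "(\<Sum>i<p. eigenvalue i * star_sum y i) = (\<Sum>k<q. (\<Sum>i<p. inc i k * eigenvalue i) * y k)"
    unfolding star_sum_def sum_distrib_left sum_distrib_right by (subst sum.swap) (simp only: ac_simps)
  also have "\<dots> = (\<Sum>k<q. eigenvalue (p + k) * y k)"
    by (intro sum.cong refl) (simp add: sum_inc eigenvalue_edge)
  finally have "2 * (\<Sum>r<n. eigenvalue r * eigenvalue r) - (\<Sum>r<n. eigenvalue r) = 0"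
    by (simp add: right_diff_distrib sum_subtractf sum_distrib_left mult.left_commute)
  then show ?thesis by simp
qed

lemma ext_br_carrier [simp]: "ext_br x z \<in> carrier_vec (Suc n)"
  unfolding ext_br_def by simp

lemma ext_br_dim [simp]: "dim_vec (ext_br x z) = Suc n"
  unfolding ext_br_def by simp

lemma ext_br_vertex: "i < p \<Longrightarrow> ext_br x z $ i = rate i * (x $ n * z $ i - x $ i * z $ n)"
  unfolding ext_br_def by simp

lemma ext_br_edge: "k < q \<Longrightarrow> ext_br x z $ (p + k) =
    rate (p + k) * (x $ n * z $ (p + k) - x $ (p + k) * z $ n)
    + sqrt (y k) * (x $ lo k * z $ hi k - x $ hi k * z $ lo k)"
  unfolding ext_br_def by (simp add: bracket_edge)

lemma ext_br_last: "ext_br x z $ n = 0"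
  unfolding ext_br_def by simp

lemma ext_vec_eq:
  assumes "x \<in> carrier_vec (Suc n)" "z \<in> carrier_vec (Suc n)" "\<And>i. i < p \<Longrightarrow> x $ i = z $ i"
    "\<And>k. k < q \<Longrightarrow> x $ (p + k) = z $ (p + k)" "x $ n = z $ n"
  shows "x = z"
proof (rule eq_vecI)
  fix r assume "r < dim_vec z"
  then have "r < Suc n" using assms(2) by simp
  then have "r = n \<or> r < n" by auto
  then show "x $ r = z $ r"
  proof
    assume "r < n"
    then show ?thesis using assms(3,4) by (cases rule: index_cases) auto
  qed (use assms in simp)
qed (use assms in auto)

lemma ends_less_Suc [simp]: "k < q \<Longrightarrow> lo k < Suc n" "k < q \<Longrightarrow> hi k < Suc n"
  using endpoints_less(3,4) by (auto intro: less_SucI)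

lemma ext_bilinear: "bilinear_vec (Suc n) ext_br"
  unfolding bilinear_vec_def linear_vec_iff
proof (intro conjI ballI allI; (rule ext_br_carrier)?)
  fix x z w :: "real vec" and c :: real
  assume x: "x \<in> carrier_vec (Suc n)" and z: "z \<in> carrier_vec (Suc n)"
  note dz = carrier_vecD[OF z]
  show "ext_br x (c \<cdot>\<^sub>v z) = c \<cdot>\<^sub>v ext_br x z"
    by (rule ext_vec_eq; simp add: ext_br_vertex ext_br_edge ext_br_last dz; simp add: algebra_simps)
  show "ext_br (c \<cdot>\<^sub>v z) x = c \<cdot>\<^sub>v ext_br z x"
    by (rule ext_vec_eq; simp add: ext_br_vertex ext_br_edge ext_br_last dz; simp add: algebra_simps)
  assume w: "w \<in> carrier_vec (Suc n)"
  note dw = carrier_vecD[OF w]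
  show "ext_br x (z + w) = ext_br x z + ext_br x w"
    by (rule ext_vec_eq; simp add: ext_br_vertex ext_br_edge ext_br_last dz dw; simp add: algebra_simps)
  show "ext_br (z + w) x = ext_br z x + ext_br w x"
    by (rule ext_vec_eq; simp add: ext_br_vertex ext_br_edge ext_br_last dz dw; simp add: algebra_simps)
qed

lemma ext_lie_algebra: "lie_algebra (Suc n) ext_br"
  unfolding lie_algebra_def
proof (intro conjI ballI)
  show "bilinear_vec (Suc n) ext_br" by (rule ext_bilinear)
  fix u v w :: "real vec"
  show "ext_br u u = 0\<^sub>v (Suc n)"
    by (rule ext_vec_eq; simp add: ext_br_vertex ext_br_edge ext_br_last)
  show "ext_br u (ext_br v w) + ext_br v (ext_br w u) + ext_br w (ext_br u v) = 0\<^sub>v (Suc n)"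
  proof (rule ext_vec_eq)
    fix k assume "k < q"
    then show "(ext_br u (ext_br v w) + ext_br v (ext_br w u) + ext_br w (ext_br u v)) $ (p + k) = 0\<^sub>v (Suc n) $ (p + k)"
      by (simp add: ext_br_vertex ext_br_edge ext_br_last rate_edge) (simp add: algebra_simps)
  qed (simp_all add: ext_br_vertex ext_br_last algebra_simps)
qed

definition nil_ideal :: "real vec set" where
  "nil_ideal = {x \<in> carrier_vec (Suc n). x $ n = 0}"

lemma nil_ideal_subspace: "vec_subspace (Suc n) nil_ideal"
  unfolding nil_ideal_def subspace_iff by auto

text \<open>
  The last basis vector acts invertibly on the ideal, so every element of it is a single bracket.
\<close>

lemma ext_derived_algebra: "bracket_span (Suc n) ext_br (carrier_vec (Suc n)) (carrier_vec (Suc n)) = nil_ideal"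
proof
  show "bracket_span (Suc n) ext_br (carrier_vec (Suc n)) (carrier_vec (Suc n)) \<subseteq> nil_ideal"
    using ext_br_last by (intro bracket_span_subset[OF nil_ideal_subspace]) (auto simp: nil_ideal_def)
  show "nil_ideal \<subseteq> bracket_span (Suc n) ext_br (carrier_vec (Suc n)) (carrier_vec (Suc n))"
  proof
    fix x assume x: "x \<in> nil_ideal"
    \<comment> \<open>The preimage of \<open>x\<close> under the action of the last basis vector.\<close>
    define z where "z = vec (Suc n) (\<lambda>r. if r < n then x $ r / rate r else 0)"
    have "ext_br (unit_vec (Suc n) n) z = x"
    proof (rule ext_vec_eq)
      show "x \<in> carrier_vec (Suc n)" using x unfolding nil_ideal_def by simp
      show "ext_br (unit_vec (Suc n) n) z $ i = x $ i" if "i < p" for i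
        using that rate_pos[of i] by (simp add: ext_br_vertex z_def)
      show "ext_br (unit_vec (Suc n) n) z $ (p + k) = x $ (p + k)" if "k < q" for k
        using that rate_pos[of "p + k"] endpoints_less(3,4)[OF that] by (simp add: ext_br_edge z_def)
      show "ext_br (unit_vec (Suc n) n) z $ n = x $ n"
        using x by (simp add: ext_br_last nil_ideal_def)
    qed simp
    moreover have "z \<in> carrier_vec (Suc n)" unfolding z_def by simp
    ultimately show "x \<in> bracket_span (Suc n) ext_br (carrier_vec (Suc n)) (carrier_vec (Suc n))"
      using bracket_in_bracket_span[OF ext_bilinear order_refl order_refl unit_vec_carrier, of z n] by simp
  qed
qed

lemma ext_solvable: "solvable_lie_algebra (Suc n) ext_br"
proof -
  let ?N = "Suc n"
  define Z where "Z = {x \<in> carrier_vec ?N. (\<forall>i<p. x $ i = (0 :: real)) \<and> x $ n = 0}"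
  have Z: "vec_subspace ?N Z" unfolding Z_def subspace_iff by auto
  have 0: "vec_subspace ?N {0\<^sub>v ?N}" unfolding subspace_iff by auto
  have "bracket_span ?N ext_br nil_ideal nil_ideal \<subseteq> Z"
    by (rule bracket_span_subset[OF Z]) (auto simp: nil_ideal_def Z_def ext_br_vertex ext_br_last)
  moreover define D2 where "D2 = bracket_span ?N ext_br nil_ideal nil_ideal"
  ultimately have D2: "D2 \<subseteq> Z" by simp
  have "bracket_span ?N ext_br D2 D2 \<subseteq> {0\<^sub>v ?N}"
  proof (rule bracket_span_subset[OF 0])
    fix x z assume "x \<in> D2" "z \<in> D2"
    then have "x \<in> Z" "z \<in> Z" using D2 by auto
    then have "ext_br x z = 0\<^sub>v ?N"
      unfolding Z_def by (intro ext_vec_eq) (auto simp: ext_br_vertex ext_br_edge ext_br_last)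
    then show "ext_br x z \<in> {0\<^sub>v ?N}" by simp
  qed
  moreover have "0\<^sub>v ?N \<in> bracket_span ?N ext_br D2 D2"
    using bracket_span_subspace[OF ext_bilinear, of D2 D2] D2 unfolding subspace_iff Z_def by blast
  ultimately have "derived_series ?N ext_br 3 = {0\<^sub>v ?N}"
    using ext_derived_algebra unfolding D2_def by (auto simp: numeral_3_eq_3)
  then show ?thesis unfolding solvable_lie_algebra_def using ext_lie_algebra by blast
qed

subsection \<open>The Einstein equation for the extension\<close>

abbreviation cs :: "nat \<Rightarrow> nat \<Rightarrow> nat \<Rightarrow> real" where
  "cs \<equiv> structure_constants ext_br (\<lambda>x y. x \<bullet> y) (unit_vec (Suc n))"

lemma cs_index: "k < Suc n \<Longrightarrow> cs a b k = ext_br (unit_vec (Suc n) a) (unit_vec (Suc n) b) $ k"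
  unfolding structure_constants_def by (rule scalar_prod_unit[OF ext_br_carrier])

lemma cs_vertex:
  assumes "a < n" "b < n" "i < p"
  shows "cs a b i = 0"
  using assms by (simp add: cs_index ext_br_vertex)

lemma cs_edge:
  assumes "a < n" "b < n" "k < q"
  shows "cs a b (p + k) = sqrt (y k) * ((if a = lo k \<and> b = hi k then 1 else 0) - (if a = hi k \<and> b = lo k then 1 else 0))"
  using assms endpoints_less(3,4)[OF assms(3)] by (auto simp: cs_index ext_br_edge)

lemma cs_edge_zero:
  assumes "a < n" "b < n" "k < q" "\<not> (a = lo k \<and> b = hi k \<or> a = hi k \<and> b = lo k)"
  shows "cs a b (p + k) = 0"
proof -
  have 1: "\<not> (a = lo k \<and> b = hi k)" and 2: "\<not> (a = hi k \<and> b = lo k)" using assms(4) by blast+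
  show ?thesis unfolding cs_edge[OF assms(1-3)] if_not_P[OF 1] if_not_P[OF 2] by simp
qed

lemma cs_last_right: "a < Suc n \<Longrightarrow> b < Suc n \<Longrightarrow> cs a b n = 0"
  by (simp add: cs_index ext_br_last)

lemma cs_last_left:
  assumes "b < n" "k < n"
  shows "cs n b k = (if b = k then rate k else 0)"
  using assms(2)
proof (cases rule: index_cases)
  case 1
  then show ?thesis using assms by (simp add: cs_index ext_br_vertex)
next
  case (2 l)
  then show ?thesis using assms endpoints_less(3,4)[of l] by (simp add: cs_index ext_br_edge)
qed

lemma cs_last_last: "k < Suc n \<Longrightarrow> cs n n k = 0"
proof (cases "k = n")
  case False
  assume "k < Suc n"
  then have "k < n" using False by simp
  then show ?thesis
    by (cases rule: index_cases) (simp_all add: cs_index ext_br_vertex ext_br_edge)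
qed (simp add: cs_last_right)

lemma cs_antisym: "a < Suc n \<Longrightarrow> b < Suc n \<Longrightarrow> k < Suc n \<Longrightarrow> cs b a k = - cs a b k"
  by (rule structure_constants_antisym[OF inner_product_scalar_prod ext_lie_algebra orthonormal_frame_unit])

lemma cs_central: "k < q \<Longrightarrow> b < n \<Longrightarrow> m < n \<Longrightarrow> cs (p + k) b m = 0"
  by (rule index_cases[of m]) (auto simp: cs_vertex cs_edge)

text \<open>
  Two brackets contribute to the same entry only if they come from the same edge, so the Ricci tensor
  is diagonal. An edge contributes at itself and, with the opposite sign, at its two ends.
\<close>

lemma nil_ricci_cs:
  assumes b: "b < n" and d: "d < n"
  shows "nil_ricci n cs b d = (if b = d then eigenvalue b - 1 / 2 else 0)"
proof -
  have edge_sum: "(\<Sum>i<n. \<Sum>j<n. cs i j b * cs i j d) =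
      (if b = d \<and> \<not> b < p then 2 * y (b - p) else 0)"
  proof (cases "b < p \<or> d < p")
    case True
    then have "(\<Sum>i<n. \<Sum>j<n. cs i j b * cs i j d) = 0" by (intro sum.neutral ballI) (auto simp: cs_vertex)
    then show ?thesis using True by auto
  next
    case False
    then obtain k l where kl: "b = p + k" "k < q" "d = p + l" "l < q"
      using b d by (metis index_cases)
    let ?t = "\<lambda>i j. if k = l then
      (if j = hi k then if i = lo k then y k else 0 else 0) + (if j = lo k then if i = hi k then y k else 0 else 0) else 0"
    have "cs i j b * cs i j d = ?t i j" if ij: "i < n" "j < n" for i j
    proof (cases "k = l")
      case True
      then show ?thesis
        using kl cs_edge[OF ij kl(2)] y_pos[OF kl(2)] endpoints_less(5)[OF kl(2)] by auto
    next
      case False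
      then have "\<not> (lo l = lo k \<and> hi l = hi k)" "\<not> (lo l = hi k \<and> hi l = lo k)"
        using edge_index_unique[OF kl(4,2)] edge_not_reversed[OF kl(2,4)] by blast+
      then have "\<not> (i = lo k \<and> j = hi k \<or> i = hi k \<and> j = lo k) \<or> \<not> (i = lo l \<and> j = hi l \<or> i = hi l \<and> j = lo l)"
        by metis
      then show ?thesis
        unfolding kl(1,3) using cs_edge_zero[OF ij kl(2)] cs_edge_zero[OF ij kl(4)] False
        by (metis mult_zero_left mult_zero_right)
    qed
    then have "(\<Sum>i<n. \<Sum>j<n. cs i j b * cs i j d) = (\<Sum>i<n. \<Sum>j<n. ?t i j)"
      by (intro sum.cong refl) auto
    also have "\<dots> = (if k = l then 2 * y k else 0)"
      using kl(2,4) by (cases "k = l") (simp_all add: sum.distrib)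
    finally show ?thesis using kl by simp
  qed
  have vertex_sum: "(\<Sum>i<n. \<Sum>j<n. cs b i j * cs d i j) =
      (if b = d \<and> b < p then star_sum y b else 0)"
  proof -
    have "(\<Sum>i<n. \<Sum>j<n. cs b i j * cs d i j) = (\<Sum>i<n. \<Sum>k<q. cs b i (p + k) * cs d i (p + k))"
      unfolding sum_n[of "\<lambda>j. cs b _ j * cs d _ j"] using b d by (simp add: cs_vertex)
    also have "\<dots> = (\<Sum>k<q. \<Sum>i<n. cs b i (p + k) * cs d i (p + k))" by (rule sum.swap)
    also have "\<dots> = (\<Sum>k<q. if b = d then inc b k * y k else 0)"
    proof (rule sum.cong[OF refl])
      fix k assume "k \<in> {..<q}"
      then have k: "k < q" by simp
      let ?t = "\<lambda>i. if b = d then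
        (if i = hi k then if b = lo k then y k else 0 else 0) + (if i = lo k then if b = hi k then y k else 0 else 0) else 0"
      have "cs b i (p + k) * cs d i (p + k) = ?t i" if i: "i < n" for i
        unfolding cs_edge[OF b i k] cs_edge[OF d i k]
        using y_pos[OF k] endpoints_less(5)[OF k] by auto
      then have "(\<Sum>i<n. cs b i (p + k) * cs d i (p + k)) = (\<Sum>i<n. ?t i)"
        by (intro sum.cong refl) auto
      also have "\<dots> = (if b = d then inc b k * y k else 0)"
        using endpoints_less[OF k] unfolding inc_def by (auto simp: sum.distrib)
      finally show "(\<Sum>i<n. cs b i (p + k) * cs d i (p + k)) = (if b = d then inc b k * y k else 0)" .
    qed
    also have "\<dots> = (if b = d then star_sum y b else 0)" unfolding star_sum_def by simp
    also have "\<dots> = (if b = d \<and> b < p then star_sum y b else 0)"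
    proof (cases "b < p")
      case False
      then have "star_sum y b = 0"
        unfolding star_sum_def inc_def using endpoints_less(1,2) by (intro sum.neutral) auto
      then show ?thesis using False by auto
    qed simp
    finally show ?thesis .
  qed
  show ?thesis
    unfolding nil_ricci_def edge_sum vertex_sum eigenvalue_def by (simp add: field_simps)
qed

text \<open>
  Along the nilradical the Ricci operator \<open>eigenvalue - 1 / 2\<close> is corrected by \<open>eigenvalue\<close>. The remaining
  diagonal entry is minus the trace of the square of the action of the last basis vector.
\<close>

lemma ricci_cs:
  assumes b: "b < Suc n" and d: "d < Suc n"
  shows "ricci_coeff (Suc n) cs b d = (if b = d then - 1 / 2 else 0)"
proof -
  have trace_last: "(\<Sum>a<n. cs n a a) = speed * (\<Sum>r<n. eigenvalue r)"
    by (simp add: cs_last_left rate_def sum_distrib_left)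
  have diag0: "cs m a a = 0" if "m < n" "a < Suc n" for m a
  proof (cases "a = n")
    case False
    then have "a < n" using that by simp
    then show ?thesis
      using that by (cases rule: index_cases) (auto simp: cs_vertex cs_edge)
  qed (use that in \<open>simp add: cs_last_right\<close>)
  have trace_last': "(\<Sum>a<Suc n. cs n a a) = speed * (\<Sum>r<n. eigenvalue r)"
    using trace_last cs_last_last[of n] by simp
  have ric_nil: "ricci_coeff (Suc n) cs b d = (if b = d then - 1 / 2 else 0)" if bd: "b < n" "d < n"
  proof -
    have killing: "(\<Sum>a<n. \<Sum>m<n. cs b a m * cs d m a) = 0" if bd: "b < n" "d < n" for b d
    proof -
      have "cs b a m * cs d m a = 0" if am: "a < n" "m < n" for a m
        using am(1)
      proof (cases rule: index_cases)
        case 1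
        then show ?thesis using bd am by (simp add: cs_vertex)
      next
        case (2 k)
        then have "cs b a m = 0"
          using cs_antisym[of "p + k" b m] cs_central[OF 2(1) bd(1) am(2)] bd am by simp
        then show ?thesis by simp
      qed
      then show ?thesis by (simp add: sum.neutral)
    qed
    have atLeast: "{n..<Suc n} = {n}" by auto
    have sq: "(\<Sum>m<n. cs n m b * cs n m d - cs n b m * cs n d m) = 0"
      using bd by (intro sum.neutral ballI) (auto simp: cs_last_left)
    have "ricci_coeff (Suc n) cs b d = nil_ricci n cs b d
      + (\<Sum>i\<in>{n..<Suc n}. \<Sum>m<n. cs i m b * cs i m d - cs i b m * cs i d m) / 2
      - (\<Sum>i\<in>{n..<Suc n}. (\<Sum>a<n. cs i a a) * (cs i b d + cs i d b)) / 2"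
    proof (rule ricci_coeff_nilradical[OF _ cs_antisym _ _ killing _ bd])
      show "n \<le> Suc n" by simp
    next
      fix a b k assume "a < Suc n" "b < Suc n" and k: "n \<le> k" "k < Suc n"
      moreover have "k = n" using k by linarith
      ultimately show "cs a b k = 0" by (simp only: cs_last_right)
    next
      fix a b k assume ab: "n \<le> a" "a < Suc n" "n \<le> b" "b < Suc n" and k: "k < Suc n"
      have "a = n" "b = n" using ab by linarith+
      then show "cs a b k = 0" using k by (simp only: cs_last_last)
    next
      show "(\<Sum>a<n. cs m a a) = 0" if "m < n" for m
        using diag0 that by (intro sum.neutral ballI) simp
    qed
    also have "\<dots> = nil_ricci n cs b d - (if b = d then speed * (\<Sum>r<n. eigenvalue r) * rate b else 0)"
      unfolding atLeast using sq trace_last bd by (simp add: cs_last_left)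
    also have "speed * (\<Sum>r<n. eigenvalue r) * rate b = eigenvalue b"
      using speed_square unfolding rate_def by (metis mult.assoc mult.commute mult_1)
    finally show ?thesis using nil_ricci_cs[OF bd] by simp
  qed
  have h0: "(\<Sum>m<Suc n. (\<Sum>a<Suc n. cs m a a) * christoffel cs u v m)
      = speed * (\<Sum>r<n. eigenvalue r) * christoffel cs u v n" for u v
    using diag0 trace_last' by (simp add: sum.neutral)
  have lastlast: "ricci_coeff (Suc n) cs n n = - 1 / 2"
  proof -
    have products: "cs n a m * cs n a m = (if m = a then rate a * rate a else 0)"
      "cs n a m * cs n m a = (if m = a then rate a * rate a else 0)" if "a < n" "m < n" for a m
      using that by (simp_all add: cs_last_left)
    have "christoffel cs n n n = 0" unfolding christoffel_def using cs_last_right by simp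
    moreover have "(\<Sum>a<Suc n. \<Sum>m<Suc n. cs n a m * cs n a m) = (\<Sum>a<n. \<Sum>m<n. if m = a then rate a * rate a else 0)"
      by (simp add: cs_last_last cs_last_right products)
    moreover have "(\<Sum>a<Suc n. \<Sum>m<Suc n. cs n a m * cs n m a) = (\<Sum>a<n. \<Sum>m<n. if m = a then rate a * rate a else 0)"
      by (simp add: cs_last_last cs_last_right products)
    moreover have "(\<Sum>a<n. \<Sum>m<n. if m = a then rate a * rate a else 0) = speed * speed * (\<Sum>r<n. eigenvalue r * eigenvalue r)"
      unfolding rate_def by (simp add: sum_distrib_left ac_simps)
    moreover have "\<dots> = 1 / 2" unfolding sum_eigenvalue_square using speed_square by simp
    moreover have "(\<Sum>a<Suc n. \<Sum>m<Suc n. cs a m n * cs a m n) = 0"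
      by (intro sum.neutral ballI) (simp add: cs_last_right)
    ultimately show ?thesis unfolding ricci_coeff_def h0 by simp
  qed
  have mixed1: "ricci_coeff (Suc n) cs b n = 0" if b: "b < n" for b
  proof -
    have "christoffel cs b n n = 0"
      unfolding christoffel_def using cs_last_right[of b n] cs_last_right[of n b] cs_last_last[of b] b by simp
    moreover have "cs b a m * cs n a m = 0" "cs b a m * cs n m a = 0" if "a < Suc n" "m < Suc n" for a m
      using that diag0[OF b, of a] cs_last_last cs_last_right[of n a] cs_last_right[of n m]
      by (cases "a = n"; cases "m = n"; cases "a = m"; auto simp: cs_last_left)+
    then have "(\<Sum>a<Suc n. \<Sum>m<Suc n. cs b a m * cs n a m) = 0" "(\<Sum>a<Suc n. \<Sum>m<Suc n. cs b a m * cs n m a) = 0"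
      by (auto intro!: sum.neutral simp del: sum.lessThan_Suc mult_eq_0_iff)
    moreover have "(\<Sum>a<Suc n. \<Sum>m<Suc n. cs a m b * cs a m n) = 0"
      by (intro sum.neutral ballI) (simp add: cs_last_right)
    ultimately show ?thesis unfolding ricci_coeff_def h0 by simp
  qed
  have mixed2: "ricci_coeff (Suc n) cs n b = 0" if b: "b < n" for b
  proof -
    have c: "christoffel cs n b n = 0" "christoffel cs b n n = 0"
      unfolding christoffel_def using cs_last_right[of b n] cs_last_right[of n b] cs_last_last[of b] b by simp_all
    have "(\<Sum>a<Suc n. \<Sum>m<Suc n. cs n a m * cs b m a) = (\<Sum>a<Suc n. \<Sum>m<Suc n. cs n m a * cs b a m)"
      by (rule sum.swap)
    then have "ricci_coeff (Suc n) cs n b = ricci_coeff (Suc n) cs b n"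
      unfolding ricci_coeff_def h0 c by (simp only: mult.commute)
    then show ?thesis using mixed1[OF b] by simp
  qed
  show ?thesis
    using b d ric_nil lastlast mixed1 mixed2 by (cases "b = n"; cases "d = n") auto
qed

lemma ext_einstein: "left_invariant_einstein (Suc n) ext_br (\<lambda>x y. x \<bullet> y)"
  using ricci_cs
  by (rule left_invariant_einsteinI[OF inner_product_scalar_prod ext_lie_algebra orthonormal_frame_unit])

subsection \<open>The Einstein extension\<close>

text \<open>
  The change from the basis of the graph to the orthonormal basis of the extension.
\<close>

definition embed :: "real vec \<Rightarrow> real vec" where
  "embed x = vec (Suc n) (\<lambda>r. if r < p then x $ r else if r < n then sqrt (y (r - p)) * x $ r else 0)"

lemma embed_carrier [simp]: "embed x \<in> carrier_vec (Suc n)"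
  unfolding embed_def by simp

lemma embed_dim [simp]: "dim_vec (embed x) = Suc n"
  unfolding embed_def by simp

lemma embed_index:
  "i < p \<Longrightarrow> embed x $ i = x $ i" "k < q \<Longrightarrow> embed x $ (p + k) = sqrt (y k) * x $ (p + k)" "embed x $ n = 0"
  unfolding embed_def by simp_all

lemma embed_linear: "linear_vec n (Suc n) embed"
  unfolding linear_vec_iff
proof (intro conjI ballI allI; (rule embed_carrier)?)
  fix x z :: "real vec" and c :: real
  assume x: "x \<in> carrier_vec n"
  note d = carrier_vecD[OF x]
  show "embed (c \<cdot>\<^sub>v x) = c \<cdot>\<^sub>v embed x"
    by (rule ext_vec_eq) (simp_all add: embed_index d)
  assume z: "z \<in> carrier_vec n"
  note d' = carrier_vecD[OF z]
  show "embed (x + z) = embed x + embed z"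
    by (rule ext_vec_eq) (simp_all add: embed_index d d' distrib_left)
qed

lemma embed_inj: "inj_on embed (carrier_vec n)"
proof (rule inj_onI)
  fix x z assume xz: "x \<in> carrier_vec n" "z \<in> carrier_vec n" "embed x = embed z"
  show "x = z"
  proof (rule vec_eq_cases[OF xz(1,2)])
    show "x $ i = z $ i" if "i < p" for i
      using arg_cong[OF xz(3), of "\<lambda>v. v $ i"] that by (simp add: embed_index)
    show "x $ (p + k) = z $ (p + k)" if "k < q" for k
      using arg_cong[OF xz(3), of "\<lambda>v. v $ (p + k)"] that y_pos[OF that] by (simp add: embed_index)
  qed
qed

lemma embed_bracket: "ext_br (embed x) (embed z) = embed (br x z)"
  by (rule ext_vec_eq)
    (simp_all add: embed_index ext_br_vertex ext_br_edge ext_br_last bracket_vertex bracket_edge)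

lemma embed_image: "embed ` carrier_vec n = nil_ideal"
proof
  show "embed ` carrier_vec n \<subseteq> nil_ideal" unfolding nil_ideal_def by (auto simp: embed_index)
  show "nil_ideal \<subseteq> embed ` carrier_vec n"
  proof
    fix x assume x: "x \<in> nil_ideal"
    define z where "z = vec n (\<lambda>r. if r < p then x $ r else x $ r / sqrt (y (r - p)))"
    have "embed z = x"
    proof (rule ext_vec_eq)
      show "x \<in> carrier_vec (Suc n)" using x unfolding nil_ideal_def by simp
      show "embed z $ (p + k) = x $ (p + k)" if "k < q" for k
        using that y_pos[OF that] by (simp add: embed_index z_def)
      show "embed z $ n = x $ n" using x unfolding nil_ideal_def by (simp add: embed_index)
    qed (simp_all add: embed_index z_def)
    moreover have "z \<in> carrier_vec n" unfolding z_def by simp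
    ultimately show "x \<in> embed ` carrier_vec n" by blast
  qed
qed

definition torus :: "real vec set" where
  "torus = {x \<in> carrier_vec (Suc n). \<forall>r<n. x $ r = 0}"

lemma einstein_extension_of_positive:
  "einstein_solvable_extension n br (\<lambda>x z. embed x \<bullet> embed z) (Suc n) ext_br (\<lambda>x z. x \<bullet> z) embed torus"
  unfolding einstein_solvable_extension_def embed_image
proof (intro conjI ballI)
  show "vec_subspace (Suc n) torus"
    unfolding subspace_iff torus_def by auto
  show "\<exists>x\<in>torus. \<exists>u\<in>nil_ideal. z = x + u" if "z \<in> carrier_vec (Suc n)" for z
  proof (intro bexI)
    show "z = vec (Suc n) (\<lambda>r. if r = n then z $ n else 0) + vec (Suc n) (\<lambda>r. if r = n then 0 else z $ r)"
      using that by (intro eq_vecI) auto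
  qed (auto simp: torus_def nil_ideal_def)
  show "x \<bullet> u = 0" if "x \<in> torus" "u \<in> nil_ideal" for x u
    using that unfolding torus_def nil_ideal_def scalar_prod_def
    by (auto intro!: sum.neutral simp: less_Suc_eq)
  show "ext_br x z = 0\<^sub>v (Suc n)" if "x \<in> torus" "z \<in> torus" for x z
    using that unfolding torus_def
    by (intro ext_vec_eq) (auto simp: ext_br_vertex ext_br_edge ext_br_last)
qed (simp_all add: ext_solvable inner_product_scalar_prod embed_linear embed_inj embed_bracket
    ext_derived_algebra ext_einstein)

lemma inner_product_embed: "inner_product n (\<lambda>x z. embed x \<bullet> embed z)"
  unfolding inner_product_def
proof (intro conjI ballI allI impI)
  note g = inner_productD[OF inner_product_scalar_prod[of "Suc n"]] and l = linear_vecD[OF embed_linear]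
  fix x z w :: "real vec" and c :: real
  assume x: "x \<in> carrier_vec n"
  show "0 < embed x \<bullet> embed x" if "x \<noteq> 0\<^sub>v n"
  proof (rule g(4)[OF embed_carrier])
    have "embed (0\<^sub>v n) = 0\<^sub>v (Suc n)" by (rule ext_vec_eq) (simp_all add: embed_index)
    then show "embed x \<noteq> 0\<^sub>v (Suc n)" using inj_onD[OF embed_inj, of x "0\<^sub>v n"] x that by auto
  qed
  assume z: "z \<in> carrier_vec n"
  show "embed x \<bullet> embed z = embed z \<bullet> embed x" by (rule g(3)) simp_all
  show "embed (c \<cdot>\<^sub>v x) \<bullet> embed z = c * (embed x \<bullet> embed z)"
    unfolding l(3)[OF x] by (rule g(2)) simp_all
  assume w: "w \<in> carrier_vec n"
  show "embed (x + z) \<bullet> embed w = embed x \<bullet> embed w + embed z \<bullet> embed w"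
    unfolding l(2)[OF x z] by (rule g(1)) simp_all
qed

end

theorem positive_einstein_nilradical:
  assumes "positive_graph es" and "es \<noteq> []"
  shows "einstein_nilradical n br"
proof -
  obtain y where y: "\<And>k. k < q \<Longrightarrow> y k > 0" "\<And>k. k < q \<Longrightarrow> y k + star_sum y (lo k) + star_sum y (hi k) = 1"
    using assms(1) unfolding positive_graph_iff by blast
  have q: "0 < q" using assms(2) by simp
  show ?thesis
    unfolding einstein_nilradical_def
    using nilpotent_graph inner_product_embed[OF y q] einstein_extension_of_positive[OF y q] by blast
qed

end

theorem theorem5p3:
  fixes V :: "'a set" and E :: "'a set set"
    and vs :: "'a list" and es :: "'a set list"
  assumes "simple_graph V E" and "E \<noteq> {}"
    and "distinct vs" and "set vs = V"
    and "distinct es" and "set es = E"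
  shows "einstein_nilradical (length vs + length es) (graph_bracket vs es) \<longleftrightarrow> positive_graph es"
proof -
  interpret graph_enumeration vs es
    using assms by unfold_locales (auto simp: simple_graph_def)
  have "es \<noteq> []" using assms by auto
  then show ?thesis using einstein_nilradical_positive positive_einstein_nilradical by blast
qed

end
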